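(* Let $k$ be a field and let $C$ be a finite dimensional $k$-coalgebra. Let $Q^{r}_{\max}(C^* )$ be the maximal right ring of quotients of the dual algebra $C^*$. Then $D=\left(Q^{r}_{\max}(C^* )\right)^*$ is a finite dimensional coalgebra, and there exists a surjective coalgebra homomorphism $\pi: D\rightarrow C$ whose kernel is small as a right $C$-subcomodule of $D$.
   Context: $C^*=\mathrm{Hom}_k(C,k)$ is the dual algebra with the convolution product; for a finite dimensional algebra $A$, $A^*$ denotes the dual coalgebra. For a ring $R$, the maximal right ring of quotients $Q^r_{\max}(R)$ is the overring of $R$ which, as a right $R$-module, is $\{x\in E \mid f(x)=0 \text{ for all } f\in \mathrm{End}(E_R) \text{ with } f(R)=0\}$, where $E=E(R_R)$ is the injective hull of $R$ as a right $R$-module; equivalently it is the maximal dense extension of $R_R$. The coalgebra $D$ is regarded as a right $C$-comodule via $\pi$, with coaction $(\mathrm{id}\otimes\pi)\Delta_D$. A subcomodule (submodule) $N$ of $M$ is small, written $N\ll M$, if $N+L\neq M$ for every proper subcomodule (submodule) $L$ of $M$. *)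

theory Defs
  imports
    "HOL-Algebra.AbelCoset"
    "Jordan_Normal_Form.Missing_VectorSpace"
begin

text \<open>
  Vector spaces over a field are carrier-based records (locale \<^locale>\<open>vectorspace\<close>); they use
  only the additive part and the scalar multiplication of a \<^typ>\<open>('k, 'v) module\<close>, so the
  multiplicative fields of spaces that are not algebras are fillers.
\<close>

section \<open>Tensor products\<close>

definition free_module :: "('k, 'm) ring_scheme \<Rightarrow> 's set \<Rightarrow> ('k, 's \<Rightarrow> 'k) module" where
  "free_module K S =
    \<lparr>carrier = {\<phi>. (\<forall>s\<in>S. \<phi> s \<in> carrier K) \<and> (\<forall>s. s \<notin> S \<longrightarrow> \<phi> s = \<zero>\<^bsub>K\<^esub>) \<and> finite {s. \<phi> s \<noteq> \<zero>\<^bsub>K\<^esub>}},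
     mult = (\<lambda>\<phi> \<psi> s. \<zero>\<^bsub>K\<^esub>), one = (\<lambda>s. \<zero>\<^bsub>K\<^esub>),
     zero = (\<lambda>s. \<zero>\<^bsub>K\<^esub>), add = (\<lambda>\<phi> \<psi> s. \<phi> s \<oplus>\<^bsub>K\<^esub> \<psi> s),
     smult = (\<lambda>a \<phi> s. a \<otimes>\<^bsub>K\<^esub> \<phi> s)\<rparr>"

definition free_gen :: "('k, 'm) ring_scheme \<Rightarrow> 's \<Rightarrow> 's \<Rightarrow> 'k" where
  "free_gen K p = (\<lambda>q. if q = p then \<one>\<^bsub>K\<^esub> else \<zero>\<^bsub>K\<^esub>)"

definition quotient_module :: "('k, 'v, 'n) module_scheme \<Rightarrow> 'v set \<Rightarrow> ('k, 'v set) module" where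
  "quotient_module M N =
    \<lparr>carrier = a_rcosets\<^bsub>M\<^esub> N, mult = (\<lambda>X Y. N), one = N,
     zero = N, add = (\<lambda>X Y. X <+>\<^bsub>M\<^esub> Y),
     smult = (\<lambda>a X. N <+>\<^bsub>M\<^esub> ((\<lambda>x. a \<odot>\<^bsub>M\<^esub> x) ` X))\<rparr>"

definition tensor_relations ::
  "('k, 'm) ring_scheme \<Rightarrow> ('k, 'v, 'n) module_scheme \<Rightarrow> ('k, 'w, 'p) module_scheme
    \<Rightarrow> ('v \<times> 'w \<Rightarrow> 'k) set" where
  "tensor_relations K V W =
    (let F = free_module K (carrier V \<times> carrier W); d = free_gen K in
      {d (v \<oplus>\<^bsub>V\<^esub> v', w) \<ominus>\<^bsub>F\<^esub> (d (v, w) \<oplus>\<^bsub>F\<^esub> d (v', w)) | v v' w.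
         v \<in> carrier V \<and> v' \<in> carrier V \<and> w \<in> carrier W} \<union>
      {d (v, w \<oplus>\<^bsub>W\<^esub> w') \<ominus>\<^bsub>F\<^esub> (d (v, w) \<oplus>\<^bsub>F\<^esub> d (v, w')) | v w w'.
         v \<in> carrier V \<and> w \<in> carrier W \<and> w' \<in> carrier W} \<union>
      {d (a \<odot>\<^bsub>V\<^esub> v, w) \<ominus>\<^bsub>F\<^esub> a \<odot>\<^bsub>F\<^esub> d (v, w) | a v w.
         a \<in> carrier K \<and> v \<in> carrier V \<and> w \<in> carrier W} \<union>
      {d (v, a \<odot>\<^bsub>W\<^esub> w) \<ominus>\<^bsub>F\<^esub> a \<odot>\<^bsub>F\<^esub> d (v, w) | a v w.
         a \<in> carrier K \<and> v \<in> carrier V \<and> w \<in> carrier W})"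

definition tensor_kernel ::
  "('k, 'm) ring_scheme \<Rightarrow> ('k, 'v, 'n) module_scheme \<Rightarrow> ('k, 'w, 'p) module_scheme
    \<Rightarrow> ('v \<times> 'w \<Rightarrow> 'k) set" where
  "tensor_kernel K V W =
    module.span K (free_module K (carrier V \<times> carrier W)) (tensor_relations K V W)"

definition tensor ::
  "('k, 'm) ring_scheme \<Rightarrow> ('k, 'v, 'n) module_scheme \<Rightarrow> ('k, 'w, 'p) module_scheme
    \<Rightarrow> ('k, ('v \<times> 'w \<Rightarrow> 'k) set) module" where
  "tensor K V W =
    quotient_module (free_module K (carrier V \<times> carrier W)) (tensor_kernel K V W)"

definition pure_tensor ::
  "('k, 'm) ring_scheme \<Rightarrow> ('k, 'v, 'n) module_scheme \<Rightarrow> ('k, 'w, 'p) module_scheme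
    \<Rightarrow> 'v \<Rightarrow> 'w \<Rightarrow> ('v \<times> 'w \<Rightarrow> 'k) set" where
  "pure_tensor K V W v w =
    tensor_kernel K V W +>\<^bsub>free_module K (carrier V \<times> carrier W)\<^esub> free_gen K (v, w)"

text \<open>The linear map on \<open>V \<otimes> W\<close> induced by a bilinear map \<open>b\<close>.\<close>

definition tensor_lift ::
  "('k, 'm) ring_scheme \<Rightarrow> ('k, 'v, 'n) module_scheme \<Rightarrow> ('k, 'w, 'p) module_scheme
    \<Rightarrow> ('k, 'u, 'q) module_scheme \<Rightarrow> ('v \<Rightarrow> 'w \<Rightarrow> 'u) \<Rightarrow> ('v \<times> 'w \<Rightarrow> 'k) set \<Rightarrow> 'u" where
  "tensor_lift K V W U b =
    (THE h. h \<in> module_hom K (tensor K V W) U \<and> h \<in> extensional (carrier (tensor K V W)) \<and>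
       (\<forall>v\<in>carrier V. \<forall>w\<in>carrier W. h (pure_tensor K V W v w) = b v w))"

definition tensor_map ::
  "('k, 'm) ring_scheme \<Rightarrow> ('k, 'v, 'n) module_scheme \<Rightarrow> ('k, 'w, 'p) module_scheme
    \<Rightarrow> ('k, 'v1, 'n1) module_scheme \<Rightarrow> ('k, 'w1, 'p1) module_scheme
    \<Rightarrow> ('v \<Rightarrow> 'v1) \<Rightarrow> ('w \<Rightarrow> 'w1) \<Rightarrow> ('v \<times> 'w \<Rightarrow> 'k) set \<Rightarrow> ('v1 \<times> 'w1 \<Rightarrow> 'k) set" where
  "tensor_map K V W V1 W1 f g =
    tensor_lift K V W (tensor K V1 W1) (\<lambda>v w. pure_tensor K V1 W1 (f v) (g w))"

text \<open>The isomorphism \<open>(U \<otimes> V) \<otimes> W \<rightarrow> U \<otimes> (V \<otimes> W)\<close>.\<close>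

definition tensor_assoc ::
  "('k, 'm) ring_scheme \<Rightarrow> ('k, 'u, 'q) module_scheme \<Rightarrow> ('k, 'v, 'n) module_scheme
    \<Rightarrow> ('k, 'w, 'p) module_scheme
    \<Rightarrow> (('u \<times> 'v \<Rightarrow> 'k) set \<times> 'w \<Rightarrow> 'k) set \<Rightarrow> ('u \<times> ('v \<times> 'w \<Rightarrow> 'k) set \<Rightarrow> 'k) set" where
  "tensor_assoc K U V W =
    tensor_lift K (tensor K U V) W (tensor K U (tensor K V W))
      (\<lambda>t w. tensor_lift K U V (tensor K U (tensor K V W))
         (\<lambda>u v. pure_tensor K U (tensor K V W) u (pure_tensor K V W v w)) t)"

definition scalar_module :: "('k, 'm) ring_scheme \<Rightarrow> ('k, 'k) module" where
  "scalar_module K =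
    \<lparr>carrier = carrier K, mult = mult K, one = \<one>\<^bsub>K\<^esub>, zero = \<zero>\<^bsub>K\<^esub>, add = add K, smult = mult K\<rparr>"

section \<open>Algebras, coalgebras, and their duals\<close>

text \<open>The library's \<^locale>\<open>algebra\<close> is restricted to commutative algebras.\<close>

locale assoc_algebra = vectorspace K A + A?: ring A for K and A (structure) +
  assumes smult_mult_left:
      "\<lbrakk>a \<in> carrier K; x \<in> carrier A; y \<in> carrier A\<rbrakk> \<Longrightarrow> (a \<odot> x) \<otimes> y = a \<odot> (x \<otimes> y)"
    and smult_mult_right:
      "\<lbrakk>a \<in> carrier K; x \<in> carrier A; y \<in> carrier A\<rbrakk> \<Longrightarrow> x \<otimes> (a \<odot> y) = a \<odot> (x \<otimes> y)"

record ('k, 'c) coalgebra = "('k, 'c) module" +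
  comult :: "'c \<Rightarrow> ('c \<times> 'c \<Rightarrow> 'k) set"
  counit :: "'c \<Rightarrow> 'k"

locale coalgebra = vectorspace K C
  for K :: "('k, 'm) ring_scheme" and C :: "('k, 'c, 'n) coalgebra_scheme" (structure) +
  assumes comult_hom: "comult C \<in> module_hom K C (tensor K C C)"
    and counit_hom: "counit C \<in> module_hom K C (scalar_module K)"
    and coassoc: "c \<in> carrier C \<Longrightarrow>
      tensor_assoc K C C C (tensor_map K C C (tensor K C C) C (comult C) (\<lambda>x. x) (comult C c)) =
      tensor_map K C C C (tensor K C C) (\<lambda>x. x) (comult C) (comult C c)"
    and counit_left: "c \<in> carrier C \<Longrightarrow>
      tensor_lift K C C C (\<lambda>x y. counit C x \<odot> y) (comult C c) = c"
    and counit_right: "c \<in> carrier C \<Longrightarrow>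
      tensor_lift K C C C (\<lambda>x y. counit C y \<odot> x) (comult C c) = c"

definition coalgebra_hom ::
  "('k, 'm) ring_scheme \<Rightarrow> ('k, 'd, 'p) coalgebra_scheme \<Rightarrow> ('k, 'c, 'n) coalgebra_scheme
    \<Rightarrow> ('d \<Rightarrow> 'c) set" where
  "coalgebra_hom K D C =
    {f \<in> module_hom K D C.
       (\<forall>d\<in>carrier D. comult C (f d) = tensor_map K D D C C f f (comult D d)) \<and>
       (\<forall>d\<in>carrier D. counit C (f d) = counit D d)}"

definition dual_space :: "('k, 'm) ring_scheme \<Rightarrow> ('k, 'v, 'n) module_scheme \<Rightarrow> ('k, 'v \<Rightarrow> 'k) module"
  where
  "dual_space K V =
    \<lparr>carrier = module_hom K V (scalar_module K) \<inter> extensional (carrier V),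
     mult = (\<lambda>f g. \<lambda>v\<in>carrier V. \<zero>\<^bsub>K\<^esub>), one = (\<lambda>v\<in>carrier V. \<zero>\<^bsub>K\<^esub>),
     zero = (\<lambda>v\<in>carrier V. \<zero>\<^bsub>K\<^esub>), add = (\<lambda>f g. \<lambda>v\<in>carrier V. f v \<oplus>\<^bsub>K\<^esub> g v),
     smult = (\<lambda>a f. \<lambda>v\<in>carrier V. a \<otimes>\<^bsub>K\<^esub> f v)\<rparr>"

definition dual_algebra ::
  "('k, 'm) ring_scheme \<Rightarrow> ('k, 'c, 'n) coalgebra_scheme \<Rightarrow> ('k, 'c \<Rightarrow> 'k) module" where
  "dual_algebra K C = (dual_space K C)
    \<lparr>mult := (\<lambda>f g. \<lambda>c\<in>carrier C.
        tensor_lift K C C (scalar_module K) (\<lambda>x y. f x \<otimes>\<^bsub>K\<^esub> g y) (comult C c)),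
     one := (\<lambda>c\<in>carrier C. counit C c)\<rparr>"

text \<open>
  For finite dimensional \<open>A\<close> the canonical map \<open>A\<^sup>* \<otimes> A\<^sup>* \<rightarrow> (A \<otimes> A)\<^sup>*\<close> is bijective; the
  comultiplication sends \<open>f\<close> to the tensor corresponding to \<open>x \<otimes> y \<mapsto> f (x y)\<close>.
\<close>

definition dual_coalgebra ::
  "('k, 'm) ring_scheme \<Rightarrow> ('k, 'a, 'n) module_scheme \<Rightarrow> ('k, 'a \<Rightarrow> 'k) coalgebra" where
  "dual_coalgebra K A = (let A' = dual_space K A in
    \<lparr>carrier = carrier A', mult = mult A', one = one A', zero = zero A', add = add A',
     smult = smult A',
     comult = (\<lambda>f. THE t. t \<in> carrier (tensor K A' A') \<and>
       (\<forall>x\<in>carrier A. \<forall>y\<in>carrier A.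
          tensor_lift K A' A' (scalar_module K) (\<lambda>g h. g x \<otimes>\<^bsub>K\<^esub> h y) t = f (x \<otimes>\<^bsub>A\<^esub> y))),
     counit = (\<lambda>f. f \<one>\<^bsub>A\<^esub>)\<rparr>)"

section \<open>Comodules\<close>

locale right_comodule = M?: vectorspace K M + C?: coalgebra K C
  for K :: "('k, 'm) ring_scheme" and C :: "('k, 'c, 'n) coalgebra_scheme" and M :: "('k, 'v, 'p) module_scheme" and \<rho> +
  assumes coact_hom: "\<rho> \<in> module_hom K M (tensor K M C)"
    and coact_coassoc: "m \<in> carrier M \<Longrightarrow>
      tensor_assoc K M C C (tensor_map K M C (tensor K M C) C \<rho> (\<lambda>c. c) (\<rho> m)) =
      tensor_map K M C M (tensor K C C) (\<lambda>x. x) (comult C) (\<rho> m)"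
    and coact_counit: "m \<in> carrier M \<Longrightarrow>
      tensor_lift K M C M (\<lambda>x c. counit C c \<odot>\<^bsub>M\<^esub> x) (\<rho> m) = m"

text \<open>The span below is the image of \<open>N \<otimes> C\<close> in \<open>M \<otimes> C\<close>.\<close>

definition subcomodule ::
  "('k, 'm) ring_scheme \<Rightarrow> ('k, 'c, 'n) coalgebra_scheme \<Rightarrow> ('k, 'v, 'p) module_scheme
    \<Rightarrow> ('v \<Rightarrow> ('v \<times> 'c \<Rightarrow> 'k) set) \<Rightarrow> 'v set \<Rightarrow> bool" where
  "subcomodule K C M \<rho> N \<longleftrightarrow>
    right_comodule K C M \<rho> \<and> submodule K N M \<and>
    (\<forall>x\<in>N. \<rho> x \<in> module.span K (tensor K M C)
       {pure_tensor K M C y c | y c. y \<in> N \<and> c \<in> carrier C})"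

definition small_subcomodule ::
  "('k, 'm) ring_scheme \<Rightarrow> ('k, 'c, 'n) coalgebra_scheme \<Rightarrow> ('k, 'v, 'p) module_scheme
    \<Rightarrow> ('v \<Rightarrow> ('v \<times> 'c \<Rightarrow> 'k) set) \<Rightarrow> 'v set \<Rightarrow> bool" where
  "small_subcomodule K C M \<rho> N \<longleftrightarrow>
    subcomodule K C M \<rho> N \<and>
    (\<forall>L. subcomodule K C M \<rho> L \<and> L \<noteq> carrier M \<longrightarrow> N <+>\<^bsub>M\<^esub> L \<noteq> carrier M)"

section \<open>Right modules and the maximal right ring of quotients\<close>

text \<open>
  The action \<open>x r\<close> of a right module is written \<open>r \<odot> x\<close>.  With this convention
  \<^const>\<open>module_hom\<close> is the set of homomorphisms of right modules as well.
\<close>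

locale right_module = R?: ring R + E?: abelian_group E
  for R :: "('r, 'm) ring_scheme" and E :: "('r, 'e, 'n) module_scheme" (structure) +
  assumes act_closed: "\<lbrakk>r \<in> carrier R; x \<in> carrier E\<rbrakk> \<Longrightarrow> r \<odot> x \<in> carrier E"
    and act_add_left: "\<lbrakk>r \<in> carrier R; s \<in> carrier R; x \<in> carrier E\<rbrakk> \<Longrightarrow>
      (r \<oplus>\<^bsub>R\<^esub> s) \<odot> x = r \<odot> x \<oplus> s \<odot> x"
    and act_add_right: "\<lbrakk>r \<in> carrier R; x \<in> carrier E; y \<in> carrier E\<rbrakk> \<Longrightarrow>
      r \<odot> (x \<oplus> y) = r \<odot> x \<oplus> r \<odot> y"
    and act_assoc: "\<lbrakk>r \<in> carrier R; s \<in> carrier R; x \<in> carrier E\<rbrakk> \<Longrightarrow>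
      (r \<otimes>\<^bsub>R\<^esub> s) \<odot> x = s \<odot> (r \<odot> x)"
    and act_one: "x \<in> carrier E \<Longrightarrow> \<one>\<^bsub>R\<^esub> \<odot> x = x"

definition right_submodule ::
  "('r, 'm) ring_scheme \<Rightarrow> ('r, 'e, 'n) module_scheme \<Rightarrow> 'e set \<Rightarrow> bool" where
  "right_submodule R E N \<longleftrightarrow>
    additive_subgroup N E \<and> (\<forall>r\<in>carrier R. \<forall>x\<in>N. r \<odot>\<^bsub>E\<^esub> x \<in> N)"

definition regular_right_module :: "('r, 'm) ring_scheme \<Rightarrow> ('r, 'r) module" where
  "regular_right_module R =
    \<lparr>carrier = carrier R, mult = mult R, one = \<one>\<^bsub>R\<^esub>, zero = \<zero>\<^bsub>R\<^esub>, add = add R,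
     smult = (\<lambda>r x. x \<otimes>\<^bsub>R\<^esub> r)\<rparr>"

text \<open>
  A definition cannot quantify over all types of modules.  The modules tested below live on the
  type \<^typ>\<open>'r + 'e\<close>, which has room for the right ideals of \<open>R\<close>; by Baer's criterion, extending
  homomorphisms from these already gives injectivity with respect to all right modules.
\<close>

definition injective_right_module ::
  "('r, 'm) ring_scheme \<Rightarrow> ('r, 'e, 'n) module_scheme \<Rightarrow> bool" where
  "injective_right_module R E \<longleftrightarrow> right_module R E \<and>
    (\<forall>(A :: ('r, 'r + 'e) module) (B :: ('r, 'r + 'e) module) i f.
       right_module R A \<and> right_module R B \<and>
       i \<in> module_hom R A B \<and> inj_on i (carrier A) \<and> f \<in> module_hom R A E \<longrightarrow>
       (\<exists>g \<in> module_hom R B E. \<forall>x\<in>carrier A. g (i x) = f x))"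

text \<open>\<open>E\<close>, with the embedding \<open>j\<close>, is an injective hull of \<open>R\<close> as a right \<open>R\<close>-module.\<close>

definition injective_hull ::
  "('r, 'm) ring_scheme \<Rightarrow> ('r, 'e, 'n) module_scheme \<Rightarrow> ('r \<Rightarrow> 'e) \<Rightarrow> bool" where
  "injective_hull R E j \<longleftrightarrow>
    injective_right_module R E \<and>
    j \<in> module_hom R (regular_right_module R) E \<and> inj_on j (carrier R) \<and>
    (\<forall>N. right_submodule R E N \<and> N \<noteq> {\<zero>\<^bsub>E\<^esub>} \<longrightarrow> N \<inter> j ` carrier R \<noteq> {\<zero>\<^bsub>E\<^esub>})"

text \<open>
  \<open>Q\<close> is the maximal right ring of quotients of \<open>R\<close>, realised inside the injective hull \<open>E\<close>:
  the ring structure is the (unique) one whose addition is that of \<open>E\<close> and for which right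
  multiplication by elements of \<open>R\<close>, identified with \<open>j ` carrier R\<close>, is the action on \<open>E\<close>.
\<close>

definition max_right_quotient_ring ::
  "('r, 'm) ring_scheme \<Rightarrow> ('r, 'e, 'n) module_scheme \<Rightarrow> ('r \<Rightarrow> 'e) \<Rightarrow> ('e, 'q) ring_scheme \<Rightarrow> bool"
  where
  "max_right_quotient_ring R E j Q \<longleftrightarrow>
    injective_hull R E j \<and> ring Q \<and>
    carrier Q = {x \<in> carrier E. \<forall>f \<in> module_hom R E E.
      (\<forall>r\<in>carrier R. f (j r) = \<zero>\<^bsub>E\<^esub>) \<longrightarrow> f x = \<zero>\<^bsub>E\<^esub>} \<and>
    (\<forall>x\<in>carrier Q. \<forall>y\<in>carrier Q. x \<oplus>\<^bsub>Q\<^esub> y = x \<oplus>\<^bsub>E\<^esub> y) \<and>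
    \<one>\<^bsub>Q\<^esub> = j \<one>\<^bsub>R\<^esub> \<and>
    (\<forall>x\<in>carrier Q. \<forall>r\<in>carrier R. x \<otimes>\<^bsub>Q\<^esub> j r = r \<odot>\<^bsub>E\<^esub> x)"

text \<open>If \<open>R\<close> is a \<open>K\<close>-algebra, an overring \<open>Q\<close> has scalars through \<open>K \<rightarrow> R \<rightarrow> Q\<close>.\<close>

definition overring_with_scalars ::
  "('k, 'r, 'n) module_scheme \<Rightarrow> ('r \<Rightarrow> 'e) \<Rightarrow> ('e, 'q) ring_scheme \<Rightarrow> ('k, 'e) module" where
  "overring_with_scalars R j Q =
    \<lparr>carrier = carrier Q, mult = mult Q, one = \<one>\<^bsub>Q\<^esub>, zero = \<zero>\<^bsub>Q\<^esub>, add = add Q,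
     smult = (\<lambda>a x. x \<otimes>\<^bsub>Q\<^esub> j (a \<odot>\<^bsub>R\<^esub> \<one>\<^bsub>R\<^esub>))\<rparr>"

end

theory Submission
  imports Defs
begin

text \<open>
  Write \<open>R = C\<^sup>*\<close> and let \<open>A\<close> be its maximal right ring of quotients, an essential extension of \<open>R\<close> as a right
  \<open>R\<close>-module. \<open>A\<close> is finite dimensional because the coordinate functionals of \<open>R\<close>, extended linearly
  to \<open>A\<close> and translated by a basis of \<open>R\<close>, separate the points of \<open>A\<close>: their common kernel contains a right
  submodule that misses \<open>R\<close>. The map \<open>\<pi>\<close> is the transpose \<open>A\<^sup>* \<rightarrow> R\<^sup>* \<cong> C\<close> of the inclusion \<open>R \<rightarrow> A\<close>, with
  kernel the annihilator of \<open>R\<close>. Annihilators turn right subcomodules \<open>L\<close> of \<open>D = A\<^sup>*\<close> into right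
  \<open>R\<close>-submodules of \<open>A\<close>, and \<open>L + ker \<pi> = D\<close> into \<open>L\<^sup>\<bottom> \<inter> R = 0\<close>; by essentiality \<open>L\<^sup>\<bottom> = 0\<close>, that is \<open>L = D\<close>.
  Identities between tensors are checked by evaluating products of functionals on them.
\<close>

section \<open>Linear maps\<close>

text \<open>Scalars act on \<open>Q\<close> by right multiplication with the elements
  \<open>j (a \<odot> 1)\<close>. This makes \<open>Q\<close> a \<open>K\<close>-algebra only if
  these elements are central in \<open>Q\<close> and not just in \<open>R\<close>; here the
  description of \<open>Q\<close> by endomorphisms of the hull enters, together with injectivity.
  The later arguments rest on essentiality.

  A functional extended from \<open>R\<close> to \<open>A\<close> is merely \<open>K\<close>-linear.
  The finiteness argument therefore tests a point x through all its translates x r, which turns the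
  common kernel into a right submodule. The dimension of \<open>A\<close> is not known at that
  stage, so functionals are produced by Zorn's lemma and not from a basis.

  The comultiplication of \<open>D\<close> is a definite description and needs existence and
  uniqueness. Both come from dual bases, finite families with v = sum of \<phi> i (v) e i. This
  formula passes to dual spaces with the two families exchanged, and it turns equations between
  tensors into equations in \<open>K\<close>. Under evaluation at points of \<open>A\<close>, the
  axioms for \<open>D\<close> and for its coaction become the associativity and unit laws of
  \<open>A\<close>.\<close>

lemma module_homI:
  assumes "\<And>x. x \<in> carrier M \<Longrightarrow> f x \<in> carrier N"
    and "\<And>x y. \<lbrakk>x \<in> carrier M; y \<in> carrier M\<rbrakk> \<Longrightarrow> f (x \<oplus>\<^bsub>M\<^esub> y) = f x \<oplus>\<^bsub>N\<^esub> f y"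
    and "\<And>r x. \<lbrakk>r \<in> carrier R; x \<in> carrier M\<rbrakk> \<Longrightarrow> f (r \<odot>\<^bsub>M\<^esub> x) = r \<odot>\<^bsub>N\<^esub> f x"
  shows "f \<in> module_hom R M N"
  using assms unfolding module_hom_def by blast

lemma module_hom_mem: "f \<in> module_hom R M N \<Longrightarrow> x \<in> carrier M \<Longrightarrow> f x \<in> carrier N"
  unfolding module_hom_def by blast

lemma module_hom_compose:
  "f \<in> module_hom R L M \<Longrightarrow> g \<in> module_hom R M N \<Longrightarrow> (\<lambda>x. g (f x)) \<in> module_hom R L N"
  by (rule module_homI) (simp_all add: module_hom_mem module_hom_add module_hom_smult)

lemma module_hom_id: "(\<lambda>x. x) \<in> module_hom R M M"
  by (rule module_homI) auto

lemma mod_homI: "module R M \<Longrightarrow> module R N \<Longrightarrow> f \<in> module_hom R M N \<Longrightarrow> mod_hom R M N f"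
  by (simp add: mod_hom_def mod_hom_axioms_def)

lemma vectorspace_imp_module: "vectorspace K V \<Longrightarrow> module K V"
  by (simp add: vectorspace_def)

lemma module_hom_zero:
  "vectorspace K V \<Longrightarrow> vectorspace K W \<Longrightarrow> f \<in> module_hom K V W \<Longrightarrow> f \<zero>\<^bsub>V\<^esub> = \<zero>\<^bsub>W\<^esub>"
  by (intro mod_hom.f0_is_0 mod_homI vectorspace_imp_module)

lemma module_hom_minus:
  "\<lbrakk>vectorspace K V; vectorspace K W; f \<in> module_hom K V W; x \<in> carrier V; y \<in> carrier V\<rbrakk>
    \<Longrightarrow> f (x \<ominus>\<^bsub>V\<^esub> y) = f x \<ominus>\<^bsub>W\<^esub> f y"
  by (intro mod_hom.f_minus mod_homI vectorspace_imp_module)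

lemma module_hom_finsum:
  assumes "vectorspace K V" "vectorspace K W" "f \<in> module_hom K V W"
    and "finite I" "\<And>i. i \<in> I \<Longrightarrow> g i \<in> carrier V"
  shows "f (\<Oplus>\<^bsub>V\<^esub>i\<in>I. g i) = (\<Oplus>\<^bsub>W\<^esub>i\<in>I. f (g i))"
proof -
  interpret V: vectorspace K V by fact
  interpret W: vectorspace K W by fact
  show ?thesis
    using assms(4,5)
  proof (induction I)
    case empty
    show ?case using module_hom_zero[OF assms(1-3)] by simp
  next
    case (insert i I)
    then have "(\<Oplus>\<^bsub>V\<^esub>i\<in>I. g i) \<in> carrier V"
      by (intro V.finsum_closed) auto
    then show ?case
      using insert assms(3)
      by (subst V.finsum_insert) (auto simp: module_hom_add module_hom_mem)
  qed
qed

lemma module_hom_ext_finsum: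
  assumes "vectorspace K V" "vectorspace K W" "finite I"
    and "\<And>i. i \<in> I \<Longrightarrow> f i \<in> module_hom K V W"
  shows "(\<lambda>x. \<Oplus>\<^bsub>W\<^esub>i\<in>I. f i x) \<in> module_hom K V W"
proof -
  interpret V: vectorspace K V by fact
  interpret W: vectorspace K W by fact
  have mem: "f i x \<in> carrier W" if "i \<in> I" "x \<in> carrier V" for i x
    using assms(4)[OF that(1)] that(2) by (rule module_hom_mem)
  show ?thesis
  proof (rule module_homI)
    show "(\<Oplus>\<^bsub>W\<^esub>i\<in>I. f i x) \<in> carrier W" if "x \<in> carrier V" for x
      using mem that by (intro W.finsum_closed) auto
  next
    fix x y assume xy: "x \<in> carrier V" "y \<in> carrier V"
    have "(\<Oplus>\<^bsub>W\<^esub>i\<in>I. f i (x \<oplus>\<^bsub>V\<^esub> y)) = (\<Oplus>\<^bsub>W\<^esub>i\<in>I. f i x \<oplus>\<^bsub>W\<^esub> f i y)"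
      using xy mem module_hom_add[OF assms(4)] by (intro W.finsum_cong') auto
    also have "\<dots> = (\<Oplus>\<^bsub>W\<^esub>i\<in>I. f i x) \<oplus>\<^bsub>W\<^esub> (\<Oplus>\<^bsub>W\<^esub>i\<in>I. f i y)"
      using xy mem by (intro W.finsum_addf) auto
    finally show "(\<Oplus>\<^bsub>W\<^esub>i\<in>I. f i (x \<oplus>\<^bsub>V\<^esub> y)) = (\<Oplus>\<^bsub>W\<^esub>i\<in>I. f i x) \<oplus>\<^bsub>W\<^esub> (\<Oplus>\<^bsub>W\<^esub>i\<in>I. f i y)" .
  next
    fix r x assume rx: "r \<in> carrier K" "x \<in> carrier V"
    have "(\<Oplus>\<^bsub>W\<^esub>i\<in>I. f i (r \<odot>\<^bsub>V\<^esub> x)) = (\<Oplus>\<^bsub>W\<^esub>i\<in>I. r \<odot>\<^bsub>W\<^esub> f i x)"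
      using rx mem module_hom_smult[OF assms(4)] by (intro W.finsum_cong') auto
    also have "\<dots> = r \<odot>\<^bsub>W\<^esub> (\<Oplus>\<^bsub>W\<^esub>i\<in>I. f i x)"
      using rx mem assms(3) by (intro W.finsum_smult_ldistr[symmetric]) auto
    finally show "(\<Oplus>\<^bsub>W\<^esub>i\<in>I. f i (r \<odot>\<^bsub>V\<^esub> x)) = r \<odot>\<^bsub>W\<^esub> (\<Oplus>\<^bsub>W\<^esub>i\<in>I. f i x)" .
  qed
qed

text \<open>Allows passing to a restriction, whose values off the carrier have been altered.\<close>

lemma module_hom_cong:
  assumes "vectorspace K V" "f \<in> module_hom K V W" "\<And>x. x \<in> carrier V \<Longrightarrow> g x = f x"
  shows "g \<in> module_hom K V W"
proof -
  interpret V: vectorspace K V by fact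
  show ?thesis
    using assms(2,3)
    by (intro module_homI) (auto simp: module_hom_mem module_hom_add module_hom_smult)
qed

lemma scalar_module_simps [simp]:
  "carrier (scalar_module K) = carrier K" "\<zero>\<^bsub>scalar_module K\<^esub> = \<zero>\<^bsub>K\<^esub>"
  "x \<oplus>\<^bsub>scalar_module K\<^esub> y = x \<oplus>\<^bsub>K\<^esub> y" "a \<odot>\<^bsub>scalar_module K\<^esub> x = a \<otimes>\<^bsub>K\<^esub> x"
  by (simp_all add: scalar_module_def)

lemma module_hom_smult_left:
  assumes "vectorspace K V" "vectorspace K W" "f \<in> module_hom K V (scalar_module K)" "w \<in> carrier W"
  shows "(\<lambda>v. f v \<odot>\<^bsub>W\<^esub> w) \<in> module_hom K V W"
proof -
  interpret W: vectorspace K W by fact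
  have "f v \<in> carrier K" if "v \<in> carrier V" for v
    using module_hom_mem[OF assms(3) that] by simp
  then show ?thesis
    using assms(3,4)
    by (intro module_homI) (auto simp: module_hom_add module_hom_smult W.smult_l_distr W.smult_assoc1)
qed

lemma module_hom_smult_right:
  assumes "vectorspace K V" "vectorspace K W" "f \<in> module_hom K V W" "a \<in> carrier K"
  shows "(\<lambda>v. a \<odot>\<^bsub>W\<^esub> f v) \<in> module_hom K V W"
proof -
  interpret W: vectorspace K W by fact
  have "f v \<in> carrier W" if "v \<in> carrier V" for v
    using module_hom_mem[OF assms(3) that] .
  then show ?thesis
    using assms(3,4)
    by (intro module_homI)
      (auto simp: module_hom_add module_hom_smult W.smult_r_distr W.smult_assoc1[symmetric] W.R.m_comm)
qed

lemma vectorspace_scalar_module: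
  assumes "field K" shows "vectorspace K (scalar_module K)"
proof -
  interpret K: field K by fact
  show ?thesis
    by (rule vs_criteria)
      (auto simp: assms K.a_ac K.m_ac K.l_distr K.r_distr intro: bexI[of _ "\<ominus>\<^bsub>K\<^esub> _"] K.r_neg)
qed

section \<open>Quotients and free modules\<close>

lemma submodule_abelian_subgroup:
  assumes "submodule R N M" shows "abelian_subgroup N M"
proof -
  interpret submodule R N M by fact
  interpret M: module R M by (rule module)
  have "additive_subgroup N M"
  proof (intro additive_subgroup.intro M.add.subgroupI)
    \<comment> \<open>Negatives are not among the closure properties of a submodule; they are the
      multiples by -1.\<close>
    show "\<ominus>\<^bsub>M\<^esub> a \<in> N" if "a \<in> N" for a
    proof -
      have "(\<ominus>\<^bsub>R\<^esub> \<one>\<^bsub>R\<^esub>) \<odot>\<^bsub>M\<^esub> a \<in> N" using that by (intro smult_closed) auto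
      moreover have "a \<in> carrier M" using that subset by auto
      ultimately show ?thesis by (simp add: M.smult_minus_1)
    qed
  next
    show "N \<noteq> {}" using zero_closed by blast
  qed (use subset in auto)
  then show ?thesis by (intro abelian_subgroupI3 M.abelian_group_axioms)
qed

text \<open>Scalar multiplication of cosets adds \<open>N\<close> to the image of the coset, since
  that image may be smaller than a coset: for \<open>a = 0\<close> it is a single point. With the
  summand the result is the coset of the scaled representative.\<close>

lemma quotient_module_simps:
  assumes "submodule R N M"
  shows "\<And>x. x \<in> carrier M \<Longrightarrow> N +>\<^bsub>M\<^esub> x \<in> carrier (quotient_module M N)"
    and "\<And>X. X \<in> carrier (quotient_module M N) \<Longrightarrow> \<exists>x\<in>carrier M. X = N +>\<^bsub>M\<^esub> x"
    and "\<And>x y. \<lbrakk>x \<in> carrier M; y \<in> carrier M\<rbrakk> \<Longrightarrow>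
      (N +>\<^bsub>M\<^esub> x) \<oplus>\<^bsub>quotient_module M N\<^esub> (N +>\<^bsub>M\<^esub> y) = N +>\<^bsub>M\<^esub> (x \<oplus>\<^bsub>M\<^esub> y)"
    and "\<And>a x. \<lbrakk>a \<in> carrier R; x \<in> carrier M\<rbrakk> \<Longrightarrow>
      a \<odot>\<^bsub>quotient_module M N\<^esub> (N +>\<^bsub>M\<^esub> x) = N +>\<^bsub>M\<^esub> (a \<odot>\<^bsub>M\<^esub> x)"
    and "\<zero>\<^bsub>quotient_module M N\<^esub> = N +>\<^bsub>M\<^esub> \<zero>\<^bsub>M\<^esub>"
proof -
  interpret submodule R N M by fact
  interpret M: module R M by (rule module)
  interpret N: abelian_subgroup N M by (rule submodule_abelian_subgroup) fact
  show "N +>\<^bsub>M\<^esub> x \<in> carrier (quotient_module M N)" if "x \<in> carrier M" for x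
    using that by (auto simp: quotient_module_def A_RCOSETS_def')
  show "\<exists>x\<in>carrier M. X = N +>\<^bsub>M\<^esub> x" if "X \<in> carrier (quotient_module M N)" for X
    using that by (auto simp: quotient_module_def A_RCOSETS_def')
  show "(N +>\<^bsub>M\<^esub> x) \<oplus>\<^bsub>quotient_module M N\<^esub> (N +>\<^bsub>M\<^esub> y) = N +>\<^bsub>M\<^esub> (x \<oplus>\<^bsub>M\<^esub> y)"
    if "x \<in> carrier M" "y \<in> carrier M" for x y
    using N.a_rcos_sum that by (simp add: quotient_module_def)
  show "a \<odot>\<^bsub>quotient_module M N\<^esub> (N +>\<^bsub>M\<^esub> x) = N +>\<^bsub>M\<^esub> (a \<odot>\<^bsub>M\<^esub> x)"
    if ax: "a \<in> carrier R" "x \<in> carrier M" for a x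
  proof
    show "a \<odot>\<^bsub>quotient_module M N\<^esub> (N +>\<^bsub>M\<^esub> x) \<subseteq> N +>\<^bsub>M\<^esub> (a \<odot>\<^bsub>M\<^esub> x)"
    proof
      fix z assume "z \<in> a \<odot>\<^bsub>quotient_module M N\<^esub> (N +>\<^bsub>M\<^esub> x)"
      then obtain n m where nm: "n \<in> N" "m \<in> N" "z = n \<oplus>\<^bsub>M\<^esub> a \<odot>\<^bsub>M\<^esub> (m \<oplus>\<^bsub>M\<^esub> x)"
        by (auto simp: quotient_module_def set_add_def' a_r_coset_def')
      then have "z = (n \<oplus>\<^bsub>M\<^esub> a \<odot>\<^bsub>M\<^esub> m) \<oplus>\<^bsub>M\<^esub> a \<odot>\<^bsub>M\<^esub> x"
        using ax subset by (auto simp: M.smult_r_distr M.a_assoc subset_iff)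
      then show "z \<in> N +>\<^bsub>M\<^esub> (a \<odot>\<^bsub>M\<^esub> x)"
        using nm ax by (auto simp: a_r_coset_def')
    qed
    show "N +>\<^bsub>M\<^esub> (a \<odot>\<^bsub>M\<^esub> x) \<subseteq> a \<odot>\<^bsub>quotient_module M N\<^esub> (N +>\<^bsub>M\<^esub> x)"
    proof
      fix z assume "z \<in> N +>\<^bsub>M\<^esub> (a \<odot>\<^bsub>M\<^esub> x)"
      \<comment> \<open>The representative \<open>x\<close> is written as 0 + x to exhibit it as a
        member of its own coset.\<close>
      then obtain n where "n \<in> N" "z = n \<oplus>\<^bsub>M\<^esub> a \<odot>\<^bsub>M\<^esub> (\<zero>\<^bsub>M\<^esub> \<oplus>\<^bsub>M\<^esub> x)"
        using ax by (auto simp: a_r_coset_def')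
      moreover have "\<zero>\<^bsub>M\<^esub> \<oplus>\<^bsub>M\<^esub> x \<in> N +>\<^bsub>M\<^esub> x"
        using zero_closed unfolding a_r_coset_def' by blast
      ultimately show "z \<in> a \<odot>\<^bsub>quotient_module M N\<^esub> (N +>\<^bsub>M\<^esub> x)"
        unfolding quotient_module_def set_add_def' by auto
    qed
  qed
  show "\<zero>\<^bsub>quotient_module M N\<^esub> = N +>\<^bsub>M\<^esub> \<zero>\<^bsub>M\<^esub>"
    using subset by (simp add: quotient_module_def)
qed

lemma vectorspace_quotient_module:
  assumes "vectorspace K M" "submodule K N M"
  shows "vectorspace K (quotient_module M N)"
proof -
  interpret M: vectorspace K M by fact
  note [simp] = quotient_module_simps[OF assms(2)]
  note q = quotient_module_simps(2)[OF assms(2)]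
  show ?thesis
  proof (rule vs_criteria, goal_cases)
    case 4
    have "(N +>\<^bsub>M\<^esub> x) \<oplus>\<^bsub>quotient_module M N\<^esub> (N +>\<^bsub>M\<^esub> (\<ominus>\<^bsub>M\<^esub> x)) = N +>\<^bsub>M\<^esub> \<zero>\<^bsub>M\<^esub>"
      if "x \<in> carrier M" for x using that by (simp add: M.r_neg)
    then show ?case
      using q quotient_module_simps(1)[OF assms(2)] M.a_inv_closed by (metis quotient_module_simps(5)[OF assms(2)])
  qed (use M.field_axioms in \<open>auto dest!: q simp: M.smult_l_distr M.smult_r_distr M.smult_assoc1 M.a_ac\<close>)
qed

lemma free_module_simps [simp]:
  "\<zero>\<^bsub>free_module K S\<^esub> = (\<lambda>s. \<zero>\<^bsub>K\<^esub>)"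
  "\<phi> \<oplus>\<^bsub>free_module K S\<^esub> \<psi> = (\<lambda>s. \<phi> s \<oplus>\<^bsub>K\<^esub> \<psi> s)"
  "a \<odot>\<^bsub>free_module K S\<^esub> \<phi> = (\<lambda>s. a \<otimes>\<^bsub>K\<^esub> \<phi> s)"
  by (simp_all add: free_module_def)

lemma free_module_carrier:
  "\<phi> \<in> carrier (free_module K S) \<longleftrightarrow>
    (\<forall>s\<in>S. \<phi> s \<in> carrier K) \<and> (\<forall>s. s \<notin> S \<longrightarrow> \<phi> s = \<zero>\<^bsub>K\<^esub>) \<and> finite {s. \<phi> s \<noteq> \<zero>\<^bsub>K\<^esub>}"
  by (simp add: free_module_def)

lemma free_module_value:
  assumes "field K" "\<phi> \<in> carrier (free_module K S)" shows "\<phi> s \<in> carrier K"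
proof -
  interpret K: field K by fact
  show ?thesis using assms(2) by (cases "s \<in> S") (auto simp: free_module_carrier)
qed

lemma vectorspace_free_module:
  fixes K :: "('a, 'm) ring_scheme" and S :: "'s set"
  assumes "field K" shows "vectorspace K (free_module K S)"
proof -
  interpret K: field K by fact
  have fin: "finite {s. f s \<noteq> \<zero>\<^bsub>K\<^esub>}"
    if "finite {s. \<phi> s \<noteq> \<zero>\<^bsub>K\<^esub>}" "finite {s. \<psi> s \<noteq> \<zero>\<^bsub>K\<^esub>}"
      "\<And>s. \<phi> s = \<zero>\<^bsub>K\<^esub> \<Longrightarrow> \<psi> s = \<zero>\<^bsub>K\<^esub> \<Longrightarrow> f s = \<zero>\<^bsub>K\<^esub>"  for f \<phi> \<psi> :: "'s \<Rightarrow> 'a"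
    by (rule finite_subset[OF _ finite_UnI[OF that(1,2)]]) (use that(3) in blast)
  note v = free_module_value[OF assms]
  show ?thesis
  proof (rule vs_criteria, goal_cases)
    case 3
    have "(\<lambda>s. \<phi> s \<oplus>\<^bsub>K\<^esub> \<psi> s) \<in> carrier (free_module K S)"
      if "\<phi> \<in> carrier (free_module K S)" "\<psi> \<in> carrier (free_module K S)" for \<phi> \<psi>
      using that fin[of \<phi> \<psi> "\<lambda>s. \<phi> s \<oplus>\<^bsub>K\<^esub> \<psi> s"] by (auto simp: free_module_carrier)
    then show ?case by simp
  next
    case 4
    show ?case
    proof
      fix \<phi> assume \<phi>: "\<phi> \<in> carrier (free_module K S)"
      show "\<exists>\<psi>\<in>carrier (free_module K S). \<phi> \<oplus>\<^bsub>free_module K S\<^esub> \<psi> = \<zero>\<^bsub>free_module K S\<^esub>"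
      proof (rule bexI[of _ "\<lambda>s. \<ominus>\<^bsub>K\<^esub> \<phi> s"])
        show "(\<lambda>s. \<ominus>\<^bsub>K\<^esub> \<phi> s) \<in> carrier (free_module K S)"
          using \<phi> fin[of \<phi> \<phi> "\<lambda>s. \<ominus>\<^bsub>K\<^esub> \<phi> s"] by (auto simp: free_module_carrier)
      qed (use v[OF \<phi>] in \<open>simp add: K.r_neg\<close>)
    qed
  next
    case 5
    have "(\<lambda>s. a \<otimes>\<^bsub>K\<^esub> \<phi> s) \<in> carrier (free_module K S)"
      if "a \<in> carrier K" "\<phi> \<in> carrier (free_module K S)" for a \<phi>
      using that fin[of \<phi> \<phi> "\<lambda>s. a \<otimes>\<^bsub>K\<^esub> \<phi> s"] by (auto simp: free_module_carrier)
    then show ?case by simp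
  qed (use assms in \<open>auto simp: v K.a_ac K.m_ac K.l_distr K.r_distr free_module_carrier[of "\<lambda>s. \<zero>\<^bsub>K\<^esub>"]\<close>)
qed

lemma free_gen_closed:
  assumes "field K" "s \<in> S" shows "free_gen K s \<in> carrier (free_module K S)"
proof -
  interpret K: field K by fact
  have "finite {q. free_gen K s q \<noteq> \<zero>\<^bsub>K\<^esub>}"
    by (rule finite_subset[of _ "{s}"]) (auto simp: free_gen_def)
  then show ?thesis using assms(2) by (auto simp: free_module_carrier free_gen_def)
qed

text \<open>Induction on the support: one point is removed by setting the value there to zero, and
  its contribution is restored by a multiple of the generator.\<close>

lemma free_module_induct [consumes 2, case_names zero gen]:
  assumes "field K" and "\<phi> \<in> carrier (free_module K S)"
    and zero: "P (\<lambda>s. \<zero>\<^bsub>K\<^esub>)"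
    and gen: "\<And>a s \<phi>. \<lbrakk>a \<in> carrier K; s \<in> S; \<phi> \<in> carrier (free_module K S); P \<phi>\<rbrakk> \<Longrightarrow>
      P (a \<odot>\<^bsub>free_module K S\<^esub> free_gen K s \<oplus>\<^bsub>free_module K S\<^esub> \<phi>)"
  shows "P \<phi>"
proof -
  interpret K: field K by fact
  have "finite {s. \<phi> s \<noteq> \<zero>\<^bsub>K\<^esub>}" using assms(2) by (simp add: free_module_carrier)
  then show ?thesis
    using assms(2)
  proof (induction "{s. \<phi> s \<noteq> \<zero>\<^bsub>K\<^esub>}" arbitrary: \<phi> rule: finite_induct)
    case empty
    then have "\<phi> = (\<lambda>s. \<zero>\<^bsub>K\<^esub>)" by auto
    then show ?case using zero by simp
  next
    case (insert t T)
    let ?\<psi> = "\<phi>(t := \<zero>\<^bsub>K\<^esub>)"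
    have t: "t \<in> S" "\<phi> t \<in> carrier K"
      using insert.hyps(4) insert.prems free_module_value[OF assms(1)] by (auto simp: free_module_carrier)
    have T: "T = {s. ?\<psi> s \<noteq> \<zero>\<^bsub>K\<^esub>}" using insert.hyps(2,4) by auto
    have \<psi>: "?\<psi> \<in> carrier (free_module K S)"
      using insert.prems insert.hyps(1) T by (auto simp: free_module_carrier)
    have "P ?\<psi>" using insert.hyps(3)[OF T \<psi>] .
    from gen[OF t(2,1) \<psi> this]
    have "P (\<phi> t \<odot>\<^bsub>free_module K S\<^esub> free_gen K t \<oplus>\<^bsub>free_module K S\<^esub> ?\<psi>)" .
    also have "\<phi> t \<odot>\<^bsub>free_module K S\<^esub> free_gen K t \<oplus>\<^bsub>free_module K S\<^esub> ?\<psi> = \<phi>"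
      using t free_module_value[OF assms(1) insert.prems] by (auto simp: free_gen_def)
    finally show ?case .
  qed
qed

lemma free_module_lift:
  assumes "vectorspace K U" and g: "\<And>s. s \<in> S \<Longrightarrow> g s \<in> carrier U"
  obtains h where "h \<in> module_hom K (free_module K S) U" "\<And>s. s \<in> S \<Longrightarrow> h (free_gen K s) = g s"
proof -
  interpret U: vectorspace K U by fact
  let ?F = "free_module K S"
  define h where "h \<phi> = (\<Oplus>\<^bsub>U\<^esub>s\<in>{s. \<phi> s \<noteq> \<zero>\<^bsub>K\<^esub>}. \<phi> s \<odot>\<^bsub>U\<^esub> g s)" for \<phi>
  note v = free_module_value[OF U.field_axioms]
  have t: "\<phi> s \<odot>\<^bsub>U\<^esub> g s \<in> carrier U" if "\<phi> \<in> carrier ?F" "s \<in> S" for \<phi> s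
    using that(2) by (simp add: v[OF that(1)] g)
  \<comment> \<open>Supports shrink when values cancel, so the sum defining \<open>h\<close> is also
    needed over larger finite index sets, for instance a common one for both summands of a
    sum.\<close>
  have h: "h \<phi> = (\<Oplus>\<^bsub>U\<^esub>s\<in>T. \<phi> s \<odot>\<^bsub>U\<^esub> g s)"
    if "\<phi> \<in> carrier ?F" "finite T" "{s. \<phi> s \<noteq> \<zero>\<^bsub>K\<^esub>} \<subseteq> T" "T \<subseteq> S" for \<phi> T
    unfolding h_def
  proof (rule U.add.finprod_mono_neutral_cong_left)
    show "\<phi> s \<odot>\<^bsub>U\<^esub> g s = \<zero>\<^bsub>U\<^esub>" if "s \<in> T - {s. \<phi> s \<noteq> \<zero>\<^bsub>K\<^esub>}" for s
      using that \<open>T \<subseteq> S\<close> g by auto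
    show "(\<lambda>s. \<phi> s \<odot>\<^bsub>U\<^esub> g s) \<in> T \<rightarrow> carrier U"
      using t[OF that(1)] that(4) by blast
  qed (use that in auto)
  have S: "{s. \<phi> s \<noteq> \<zero>\<^bsub>K\<^esub>} \<subseteq> S" "finite {s. \<phi> s \<noteq> \<zero>\<^bsub>K\<^esub>}" if "\<phi> \<in> carrier ?F" for \<phi>
    using that by (auto simp: free_module_carrier)
  interpret F: vectorspace K ?F by (rule vectorspace_free_module[OF U.field_axioms])
  show thesis
  proof
    show "h \<in> module_hom K ?F U"
    proof (rule module_homI)
      show "h \<phi> \<in> carrier U" if "\<phi> \<in> carrier ?F" for \<phi>
        unfolding h_def using t[OF that] S(1)[OF that] by (intro U.finsum_closed) blast
    next
      fix \<phi> \<psi> assume p: "\<phi> \<in> carrier ?F" "\<psi> \<in> carrier ?F"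
      let ?T = "{s. \<phi> s \<noteq> \<zero>\<^bsub>K\<^esub>} \<union> {s. \<psi> s \<noteq> \<zero>\<^bsub>K\<^esub>}"
      have T: "finite ?T" "?T \<subseteq> S" using S p by blast+
      have "h (\<phi> \<oplus>\<^bsub>?F\<^esub> \<psi>) = (\<Oplus>\<^bsub>U\<^esub>s\<in>?T. (\<phi> \<oplus>\<^bsub>?F\<^esub> \<psi>) s \<odot>\<^bsub>U\<^esub> g s)"
        using p T by (intro h F.a_closed) auto
      also have "\<dots> = (\<Oplus>\<^bsub>U\<^esub>s\<in>?T. \<phi> s \<odot>\<^bsub>U\<^esub> g s \<oplus>\<^bsub>U\<^esub> \<psi> s \<odot>\<^bsub>U\<^esub> g s)"
        using T(2) v[OF p(1)] v[OF p(2)] g t[OF p(1)] t[OF p(2)]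
        by (intro U.finsum_cong') (auto simp: U.smult_l_distr)
      also have "\<dots> = h \<phi> \<oplus>\<^bsub>U\<^esub> h \<psi>"
        using T t[OF p(1)] t[OF p(2)]
        by (subst U.finsum_addf) (auto simp: h[OF p(1) T(1) _ T(2)] h[OF p(2) T(1) _ T(2)])
      finally show "h (\<phi> \<oplus>\<^bsub>?F\<^esub> \<psi>) = h \<phi> \<oplus>\<^bsub>U\<^esub> h \<psi>" .
    next
      fix a \<phi> assume a: "a \<in> carrier K" and p: "\<phi> \<in> carrier ?F"
      let ?T = "{s. \<phi> s \<noteq> \<zero>\<^bsub>K\<^esub>}"
      have "h (a \<odot>\<^bsub>?F\<^esub> \<phi>) = (\<Oplus>\<^bsub>U\<^esub>s\<in>?T. (a \<odot>\<^bsub>?F\<^esub> \<phi>) s \<odot>\<^bsub>U\<^esub> g s)"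
        using p S a by (intro h F.smult_closed) auto
      also have "\<dots> = (\<Oplus>\<^bsub>U\<^esub>s\<in>?T. a \<odot>\<^bsub>U\<^esub> (\<phi> s \<odot>\<^bsub>U\<^esub> g s))"
        using v[OF p] g S[OF p] t[OF p] a by (intro U.finsum_cong') (auto simp: U.smult_assoc1 subset_iff)
      also have "\<dots> = a \<odot>\<^bsub>U\<^esub> h \<phi>"
        unfolding h_def using S[OF p] t[OF p] a
        by (intro U.finsum_smult_ldistr[symmetric]) (auto simp: subset_iff)
      finally show "h (a \<odot>\<^bsub>?F\<^esub> \<phi>) = a \<odot>\<^bsub>U\<^esub> h \<phi>" .
    qed
    show "h (free_gen K s) = g s" if "s \<in> S" for s
      using that g free_gen_closed[OF U.field_axioms that]
      by (subst h[of _ "{s}"]) (auto simp: free_gen_def split: if_splits)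
  qed
qed

section \<open>Tensor products\<close>

definition bilinear_map ::
  "('k, 'm) ring_scheme \<Rightarrow> ('k, 'v, 'n) module_scheme \<Rightarrow> ('k, 'w, 'p) module_scheme
    \<Rightarrow> ('k, 'u, 'q) module_scheme \<Rightarrow> ('v \<Rightarrow> 'w \<Rightarrow> 'u) \<Rightarrow> bool" where
  "bilinear_map K V W U b \<longleftrightarrow>
    (\<forall>w\<in>carrier W. (\<lambda>v. b v w) \<in> module_hom K V U) \<and> (\<forall>v\<in>carrier V. b v \<in> module_hom K W U)"

lemma bilinear_mapI:
  assumes "\<And>w. w \<in> carrier W \<Longrightarrow> (\<lambda>v. b v w) \<in> module_hom K V U"
    and "\<And>v. v \<in> carrier V \<Longrightarrow> (\<lambda>w. b v w) \<in> module_hom K W U"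
  shows "bilinear_map K V W U b"
  using assms by (simp add: bilinear_map_def)

lemma bilinear_mapD:
  assumes "bilinear_map K V W U b"
  shows "w \<in> carrier W \<Longrightarrow> (\<lambda>v. b v w) \<in> module_hom K V U"
    and "v \<in> carrier V \<Longrightarrow> (\<lambda>w. b v w) \<in> module_hom K W U"
    and "v \<in> carrier V \<Longrightarrow> w \<in> carrier W \<Longrightarrow> b v w \<in> carrier U"
  using assms by (auto simp: bilinear_map_def intro: module_hom_mem)

locale tensor_product = V: vectorspace K V + W: vectorspace K W
  for K :: "('k, 'm) ring_scheme" and V :: "('k, 'v, 'n) module_scheme"
    and W :: "('k, 'w, 'p) module_scheme"
begin

abbreviation "F \<equiv> free_module K (carrier V \<times> carrier W)"
abbreviation "N \<equiv> tensor_kernel K V W"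

lemma vectorspace_F: "vectorspace K F"
  by (rule vectorspace_free_module) (rule V.field_axioms)

sublocale F: vectorspace K F by (rule vectorspace_F)

lemma gen_closed: "v \<in> carrier V \<Longrightarrow> w \<in> carrier W \<Longrightarrow> free_gen K (v, w) \<in> carrier F"
  by (intro free_gen_closed V.field_axioms) auto

lemma tensor_relations_subset: "tensor_relations K V W \<subseteq> carrier F"
  unfolding tensor_relations_def Let_def
  by (auto intro!: F.minus_closed F.a_closed F.smult_closed gen_closed simp del: free_module_simps)

lemma submodule_kernel: "submodule K N F"
  unfolding tensor_kernel_def by (intro F.span_is_submodule tensor_relations_subset)

lemma vectorspace_tensor: "vectorspace K (tensor K V W)"
  unfolding tensor_def by (intro vectorspace_quotient_module vectorspace_F submodule_kernel)

sublocale T: vectorspace K "tensor K V W" by (rule vectorspace_tensor)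

lemmas coset_simps = quotient_module_simps[OF submodule_kernel, folded tensor_def]

lemma pure_tensor_closed [simp, intro]:
  "v \<in> carrier V \<Longrightarrow> w \<in> carrier W \<Longrightarrow> pure_tensor K V W v w \<in> carrier (tensor K V W)"
  unfolding pure_tensor_def by (intro coset_simps(1) gen_closed)

lemma coset_eqI:
  assumes "x \<in> carrier F" "y \<in> carrier F" "x \<ominus>\<^bsub>F\<^esub> y \<in> tensor_relations K V W"
  shows "N +>\<^bsub>F\<^esub> x = N +>\<^bsub>F\<^esub> y"
proof -
  interpret N: abelian_subgroup N F by (rule submodule_abelian_subgroup[OF submodule_kernel])
  have "x \<ominus>\<^bsub>F\<^esub> y \<in> N"
    unfolding tensor_kernel_def using F.in_own_span[OF tensor_relations_subset] assms(3) by auto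
  then have "x \<in> N +>\<^bsub>F\<^esub> y"
    using assms N.a_rcos_module_rev by (simp add: a_minus_def del: free_module_simps)
  then show ?thesis
    using N.a_repr_independence' assms(2) by metis
qed

lemma pure_tensor_add_left:
  assumes "v \<in> carrier V" "v' \<in> carrier V" "w \<in> carrier W"
  shows "pure_tensor K V W (v \<oplus>\<^bsub>V\<^esub> v') w =
    pure_tensor K V W v w \<oplus>\<^bsub>tensor K V W\<^esub> pure_tensor K V W v' w"
proof -
  note gen = gen_closed[OF assms(1,3)] gen_closed[OF assms(2,3)]
  show ?thesis
    unfolding pure_tensor_def coset_simps(3)[OF gen]
  proof (rule coset_eqI)
    show "free_gen K (v \<oplus>\<^bsub>V\<^esub> v', w) \<ominus>\<^bsub>F\<^esub> (free_gen K (v, w) \<oplus>\<^bsub>F\<^esub> free_gen K (v', w))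
        \<in> tensor_relations K V W"
      unfolding tensor_relations_def Let_def
      by (rule UnI1, rule UnI1, rule UnI1; (intro CollectI exI conjI; (rule refl assms)?)+)
  qed (intro F.a_closed gen_closed V.a_closed assms)+
qed

lemma pure_tensor_add_right:
  assumes "v \<in> carrier V" "w \<in> carrier W" "w' \<in> carrier W"
  shows "pure_tensor K V W v (w \<oplus>\<^bsub>W\<^esub> w') =
    pure_tensor K V W v w \<oplus>\<^bsub>tensor K V W\<^esub> pure_tensor K V W v w'"
proof -
  note gen = gen_closed[OF assms(1,2)] gen_closed[OF assms(1,3)]
  show ?thesis
    unfolding pure_tensor_def coset_simps(3)[OF gen]
  proof (rule coset_eqI)
    show "free_gen K (v, w \<oplus>\<^bsub>W\<^esub> w') \<ominus>\<^bsub>F\<^esub> (free_gen K (v, w) \<oplus>\<^bsub>F\<^esub> free_gen K (v, w'))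
        \<in> tensor_relations K V W"
      unfolding tensor_relations_def Let_def
      by (rule UnI1, rule UnI1, rule UnI2; (intro CollectI exI conjI; (rule refl assms)?)+)
  qed (intro F.a_closed gen_closed W.a_closed assms)+
qed

lemma pure_tensor_smult_left:
  assumes "a \<in> carrier K" "v \<in> carrier V" "w \<in> carrier W"
  shows "pure_tensor K V W (a \<odot>\<^bsub>V\<^esub> v) w = a \<odot>\<^bsub>tensor K V W\<^esub> pure_tensor K V W v w"
  unfolding pure_tensor_def coset_simps(4)[OF assms(1) gen_closed[OF assms(2,3)]]
proof (rule coset_eqI)
  show "free_gen K (a \<odot>\<^bsub>V\<^esub> v, w) \<ominus>\<^bsub>F\<^esub> a \<odot>\<^bsub>F\<^esub> free_gen K (v, w) \<in> tensor_relations K V W"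
    unfolding tensor_relations_def Let_def
      by (rule UnI1, rule UnI2; (intro CollectI exI conjI; (rule refl assms)?)+)
qed (intro F.smult_closed gen_closed V.smult_closed assms)+

lemma pure_tensor_smult_right:
  assumes "a \<in> carrier K" "v \<in> carrier V" "w \<in> carrier W"
  shows "pure_tensor K V W v (a \<odot>\<^bsub>W\<^esub> w) = a \<odot>\<^bsub>tensor K V W\<^esub> pure_tensor K V W v w"
  unfolding pure_tensor_def coset_simps(4)[OF assms(1) gen_closed[OF assms(2,3)]]
proof (rule coset_eqI)
  show "free_gen K (v, a \<odot>\<^bsub>W\<^esub> w) \<ominus>\<^bsub>F\<^esub> a \<odot>\<^bsub>F\<^esub> free_gen K (v, w) \<in> tensor_relations K V W"
    unfolding tensor_relations_def Let_def
      by (rule UnI2; (intro CollectI exI conjI; (rule refl assms)?)+)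
qed (intro F.smult_closed gen_closed W.smult_closed assms)+

lemma bilinear_pure_tensor: "bilinear_map K V W (tensor K V W) (pure_tensor K V W)"
  by (intro bilinear_mapI module_homI)
    (simp_all add: pure_tensor_add_left pure_tensor_add_right pure_tensor_smult_left
      pure_tensor_smult_right)

text \<open>There is no case for zero or for scalar multiples: scalars are absorbed into the left
  factor, and zero is the pure tensor of two zeros.\<close>

lemma tensor_induct [consumes 1, case_names pure add]:
  assumes "t \<in> carrier (tensor K V W)"
    and pure: "\<And>v w. v \<in> carrier V \<Longrightarrow> w \<in> carrier W \<Longrightarrow> P (pure_tensor K V W v w)"
    and add: "\<And>s t. \<lbrakk>s \<in> carrier (tensor K V W); t \<in> carrier (tensor K V W); P s; P t\<rbrakk> \<Longrightarrow>
      P (s \<oplus>\<^bsub>tensor K V W\<^esub> t)"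
  shows "P t"
proof -
  obtain \<phi> where \<phi>: "\<phi> \<in> carrier F" and t: "t = N +>\<^bsub>F\<^esub> \<phi>"
    using coset_simps(2)[OF assms(1)] by blast
  from V.field_axioms \<phi> have "P (N +>\<^bsub>F\<^esub> \<phi>)"
  proof (induction rule: free_module_induct)
    case zero
    have "\<zero>\<^bsub>tensor K V W\<^esub> = pure_tensor K V W (\<zero>\<^bsub>K\<^esub> \<odot>\<^bsub>V\<^esub> \<zero>\<^bsub>V\<^esub>) \<zero>\<^bsub>W\<^esub>"
      by (subst pure_tensor_smult_left) (simp_all add: T.smult_l_null)
    then have "P \<zero>\<^bsub>tensor K V W\<^esub>" using pure by simp
    then show ?case by (simp add: coset_simps(5))
  next
    case (gen a s \<phi>)
    obtain v w where s: "s = (v, w)" and vw: "v \<in> carrier V" "w \<in> carrier W"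
      using gen(2) by auto
    have "N +>\<^bsub>F\<^esub> (a \<odot>\<^bsub>F\<^esub> free_gen K (v, w) \<oplus>\<^bsub>F\<^esub> \<phi>)
        = pure_tensor K V W (a \<odot>\<^bsub>V\<^esub> v) w \<oplus>\<^bsub>tensor K V W\<^esub> (N +>\<^bsub>F\<^esub> \<phi>)"
      unfolding pure_tensor_smult_left[OF gen(1) vw]
      unfolding pure_tensor_def coset_simps(4)[OF gen(1) gen_closed[OF vw]]
      by (rule coset_simps(3)[symmetric]; intro F.smult_closed gen_closed gen vw)
    moreover have "N +>\<^bsub>F\<^esub> \<phi> \<in> carrier (tensor K V W)"
      using coset_simps(1) gen(3) by simp
    ultimately show ?case
      unfolding s using gen(1,4) vw by (auto intro!: add pure simp del: free_module_simps)
  qed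
  then show ?thesis by (simp add: t)
qed

lemma tensor_hom_eqI:
  assumes "vectorspace K U" "f \<in> module_hom K (tensor K V W) U" "g \<in> module_hom K (tensor K V W) U"
    and "\<And>v w. v \<in> carrier V \<Longrightarrow> w \<in> carrier W \<Longrightarrow>
      f (pure_tensor K V W v w) = g (pure_tensor K V W v w)"
    and "t \<in> carrier (tensor K V W)"
  shows "f t = g t"
  using assms(5) by (induction rule: tensor_induct)
    (simp_all add: assms(4) module_hom_add[OF assms(2)] module_hom_add[OF assms(3)])

text \<open>The linear extension of \<open>b\<close> to the free module kills the relations because
  \<open>b\<close> is bilinear, hence is constant on cosets. The induced map may then be read off at
  an arbitrarily chosen representative.\<close>

lemma tensor_universal:
  assumes "vectorspace K U" and b: "bilinear_map K V W U b"
  shows "\<exists>h\<in>module_hom K (tensor K V W) U.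
    \<forall>v\<in>carrier V. \<forall>w\<in>carrier W. h (pure_tensor K V W v w) = b v w"
proof -
  interpret U: vectorspace K U by fact
  note bD = bilinear_mapD[OF b]
  obtain g where g: "g \<in> module_hom K F U"
    and gb: "\<And>s. s \<in> carrier V \<times> carrier W \<Longrightarrow> g (free_gen K s) = (case s of (v, w) \<Rightarrow> b v w)"
    by (rule free_module_lift[OF U.vectorspace_axioms, of "carrier V \<times> carrier W" "\<lambda>(v, w). b v w"])
      (auto simp: bD(3))
  interpret g: mod_hom K F U g by (intro mod_homI F.module_axioms U.module_axioms g)
  note [simp del] = free_module_simps
  have "tensor_relations K V W \<subseteq> g.ker"
    unfolding tensor_relations_def Let_def g.ker_def
    by (auto simp: gb gen_closed bD(3) F.minus_closed module_hom_add[OF bD(1)] module_hom_add[OF bD(2)]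
        module_hom_smult[OF bD(1)] module_hom_smult[OF bD(2)] U.r_neg a_minus_def)
  then have ker: "g n = \<zero>\<^bsub>U\<^esub>" if "n \<in> N" for n
    using F.span_is_subset[OF _ g.ker_is_submodule] that unfolding tensor_kernel_def g.ker_def by blast
  define h where "h X = g (SOME \<phi>. \<phi> \<in> X)" for X
  have h: "h (N +>\<^bsub>F\<^esub> \<phi>) = g \<phi>" if \<phi>: "\<phi> \<in> carrier F" for \<phi>
  proof -
    interpret N: abelian_subgroup N F by (rule submodule_abelian_subgroup[OF submodule_kernel])
    have "(SOME \<psi>. \<psi> \<in> N +>\<^bsub>F\<^esub> \<phi>) \<in> N +>\<^bsub>F\<^esub> \<phi>"
      using N.a_rcos_self[OF \<phi>] by (rule someI[of "\<lambda>\<psi>. \<psi> \<in> N +>\<^bsub>F\<^esub> \<phi>"])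
    then obtain n where "n \<in> N" "(SOME \<psi>. \<psi> \<in> N +>\<^bsub>F\<^esub> \<phi>) = n \<oplus>\<^bsub>F\<^esub> \<phi>"
      unfolding a_r_coset_def' by blast
    then show ?thesis
      using \<phi> ker N.a_subset g.f_im[OF \<phi>] by (simp add: h_def subset_iff)
  qed
  show ?thesis
  proof (intro bexI ballI)
    show "h \<in> module_hom K (tensor K V W) U"
    proof (rule module_homI)
      show "h X \<in> carrier U" if "X \<in> carrier (tensor K V W)" for X
        using coset_simps(2)[OF that] h by auto
      show "h (X \<oplus>\<^bsub>tensor K V W\<^esub> Y) = h X \<oplus>\<^bsub>U\<^esub> h Y"
        if "X \<in> carrier (tensor K V W)" "Y \<in> carrier (tensor K V W)" for X Y
        using coset_simps(2)[OF that(1)] coset_simps(2)[OF that(2)] h by (auto simp: coset_simps(3))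
      show "h (a \<odot>\<^bsub>tensor K V W\<^esub> X) = a \<odot>\<^bsub>U\<^esub> h X"
        if "a \<in> carrier K" "X \<in> carrier (tensor K V W)" for a X
        using coset_simps(2)[OF that(2)] that(1) h by (auto simp: coset_simps(4))
    qed
    show "h (pure_tensor K V W v w) = b v w" if "v \<in> carrier V" "w \<in> carrier W" for v w
      using that by (simp add: pure_tensor_def h gen_closed gb)
  qed
qed

text \<open>Justifies the definite description: pure tensors determine a linear map on the carrier
  and extensionality fixes its values elsewhere, so the restriction of the map from
  \<open>tensor_universal\<close> is the unique solution.\<close>

lemma tensor_lift:
  assumes U: "vectorspace K U" and b: "bilinear_map K V W U b"
  shows "tensor_lift K V W U b \<in> module_hom K (tensor K V W) U" (is ?hom)
    and "\<lbrakk>v \<in> carrier V; w \<in> carrier W\<rbrakk> \<Longrightarrow> tensor_lift K V W U b (pure_tensor K V W v w) = b v w"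
proof -
  let ?P = "\<lambda>h. h \<in> module_hom K (tensor K V W) U \<and> h \<in> extensional (carrier (tensor K V W)) \<and>
    (\<forall>v\<in>carrier V. \<forall>w\<in>carrier W. h (pure_tensor K V W v w) = b v w)"
  obtain h where h: "h \<in> module_hom K (tensor K V W) U"
    "\<And>v w. v \<in> carrier V \<Longrightarrow> w \<in> carrier W \<Longrightarrow> h (pure_tensor K V W v w) = b v w"
    using tensor_universal[OF assms] by blast
  have "?P (restrict h (carrier (tensor K V W)))"
    using h module_hom_cong[OF vectorspace_tensor h(1)] by auto
  moreover have "f = g" if "?P f" "?P g" for f g
    using that tensor_hom_eqI[OF U, of f g] by (intro extensionalityI[of f "carrier (tensor K V W)" g]) auto
  ultimately have "\<exists>!h. ?P h" by blast
  then have "?P (tensor_lift K V W U b)"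
    unfolding tensor_lift_def by (rule theI')
  then show ?hom
    and "\<lbrakk>v \<in> carrier V; w \<in> carrier W\<rbrakk> \<Longrightarrow> tensor_lift K V W U b (pure_tensor K V W v w) = b v w"
    by auto
qed

lemma tensor_lift_closed:
  "\<lbrakk>vectorspace K U; bilinear_map K V W U b; t \<in> carrier (tensor K V W)\<rbrakk> \<Longrightarrow>
    tensor_lift K V W U b t \<in> carrier U"
  by (rule module_hom_mem[OF tensor_lift(1)])

end

lemmas vectorspace_tensor = tensor_product.vectorspace_tensor[OF tensor_product.intro]
lemmas pure_tensor_closed = tensor_product.pure_tensor_closed[OF tensor_product.intro]
lemmas bilinear_pure_tensor = tensor_product.bilinear_pure_tensor[OF tensor_product.intro]
lemmas tensor_hom_eqI = tensor_product.tensor_hom_eqI[OF tensor_product.intro]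
lemmas tensor_lift_hom = tensor_product.tensor_lift(1)[OF tensor_product.intro]
lemmas tensor_lift_pure = tensor_product.tensor_lift(2)[OF tensor_product.intro]
lemmas tensor_lift_closed = tensor_product.tensor_lift_closed[OF tensor_product.intro]

section \<open>Product functionals and induced maps on tensor products\<close>

abbreviation dual_hom where "dual_hom K V \<equiv> module_hom K V (scalar_module K)"

text \<open>The functional usually written f \<otimes> g; these are the test functions for equality
  of tensors.\<close>

abbreviation tensor_eval ::
  "('k, 'm) ring_scheme \<Rightarrow> ('k, 'v, 'n) module_scheme \<Rightarrow> ('k, 'w, 'p) module_scheme
    \<Rightarrow> ('v \<Rightarrow> 'k) \<Rightarrow> ('w \<Rightarrow> 'k) \<Rightarrow> ('v \<times> 'w \<Rightarrow> 'k) set \<Rightarrow> 'k" where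
  "tensor_eval K V W f g \<equiv> tensor_lift K V W (scalar_module K) (\<lambda>x y. f x \<otimes>\<^bsub>K\<^esub> g y)"

lemma vectorspace_scalar: "vectorspace K V \<Longrightarrow> vectorspace K (scalar_module K)"
  by (simp add: vectorspace_def vectorspace_scalar_module[unfolded vectorspace_def])

lemma tensor_lift_cong:
  assumes "\<And>v w. v \<in> carrier V \<Longrightarrow> w \<in> carrier W \<Longrightarrow> b v w = b' v w"
  shows "tensor_lift K V W U b = tensor_lift K V W U b'"
  using assms by (simp add: tensor_lift_def)

lemma bilinear_smult_left:
  assumes "vectorspace K V" "vectorspace K W" "f \<in> dual_hom K V"
  shows "bilinear_map K V W W (\<lambda>v w. f v \<odot>\<^bsub>W\<^esub> w)"
proof (rule bilinear_mapI)
  show "(\<lambda>v. f v \<odot>\<^bsub>W\<^esub> w) \<in> module_hom K V W" if "w \<in> carrier W" for w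
    using module_hom_smult_left[OF assms(1-3) that] .
  show "(\<lambda>w. f v \<odot>\<^bsub>W\<^esub> w) \<in> module_hom K W W" if "v \<in> carrier V" for v
    using module_hom_smult_right[OF assms(2,2) module_hom_id] module_hom_mem[OF assms(3) that] by simp
qed

lemma bilinear_smult_right:
  assumes "vectorspace K V" "vectorspace K W" "g \<in> dual_hom K W"
  shows "bilinear_map K V W V (\<lambda>v w. g w \<odot>\<^bsub>V\<^esub> v)"
proof (rule bilinear_mapI)
  show "(\<lambda>v. g w \<odot>\<^bsub>V\<^esub> v) \<in> module_hom K V V" if "w \<in> carrier W" for w
    using module_hom_smult_right[OF assms(1,1) module_hom_id] module_hom_mem[OF assms(3) that] by simp
  show "(\<lambda>w. g w \<odot>\<^bsub>V\<^esub> v) \<in> module_hom K W V" if "v \<in> carrier V" for v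
    using module_hom_smult_left[OF assms(2,1,3) that] .
qed

lemma bilinear_map_compose:
  assumes "bilinear_map K V W U b" "f \<in> module_hom K V' V" "g \<in> module_hom K W' W"
  shows "bilinear_map K V' W' U (\<lambda>v w. b (f v) (g w))"
proof (rule bilinear_mapI)
  show "(\<lambda>v. b (f v) (g w)) \<in> module_hom K V' U" if "w \<in> carrier W'" for w
    using module_hom_compose[OF assms(2) bilinear_mapD(1)[OF assms(1) module_hom_mem[OF assms(3) that]]] .
  show "(\<lambda>w. b (f v) (g w)) \<in> module_hom K W' U" if "v \<in> carrier V'" for v
    using module_hom_compose[OF assms(3) bilinear_mapD(2)[OF assms(1) module_hom_mem[OF assms(2) that]]] .
qed

text \<open>Multiplication in \<open>K\<close> is the scalar action of \<open>K\<close> on itself,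
  so this is \<open>bilinear_smult_left\<close> for two copies of \<open>K\<close>, composed with
  \<open>f\<close> and \<open>g\<close>.\<close>

lemma bilinear_mult:
  assumes "vectorspace K V" "vectorspace K W" "f \<in> dual_hom K V" "g \<in> dual_hom K W"
  shows "bilinear_map K V W (scalar_module K) (\<lambda>x y. f x \<otimes>\<^bsub>K\<^esub> g y)"
  using bilinear_map_compose[OF bilinear_smult_left[OF vectorspace_scalar vectorspace_scalar module_hom_id]
      assms(3,4)] assms(1) by simp

lemma tensor_eval_hom:
  assumes "vectorspace K V" "vectorspace K W" "f \<in> dual_hom K V" "g \<in> dual_hom K W"
  shows "tensor_eval K V W f g \<in> dual_hom K (tensor K V W)"
  by (rule tensor_lift_hom[OF assms(1,2) vectorspace_scalar[OF assms(1)] bilinear_mult[OF assms]])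

lemma tensor_eval_pure:
  assumes "vectorspace K V" "vectorspace K W" "f \<in> dual_hom K V" "g \<in> dual_hom K W"
    "v \<in> carrier V" "w \<in> carrier W"
  shows "tensor_eval K V W f g (pure_tensor K V W v w) = f v \<otimes>\<^bsub>K\<^esub> g w"
  by (rule tensor_lift_pure[OF assms(1,2) vectorspace_scalar[OF assms(1)] bilinear_mult]) fact+

text \<open>Both sides are linear in \<open>t\<close> and agree on pure tensors. The lemma moves a
  linear map through a lift; \<open>b'\<close> is a separate parameter so that the composite may be
  given in any convenient form.\<close>

lemma tensor_eval_lift:
  assumes vs: "vectorspace K V" "vectorspace K W" "vectorspace K U"
    and b: "bilinear_map K V W U b" and h: "h \<in> module_hom K U U'" "vectorspace K U'"
    and b': "bilinear_map K V W U' b'"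
    and eq: "\<And>v w. v \<in> carrier V \<Longrightarrow> w \<in> carrier W \<Longrightarrow> h (b v w) = b' v w"
    and t: "t \<in> carrier (tensor K V W)"
  shows "h (tensor_lift K V W U b t) = tensor_lift K V W U' b' t"
  by (rule tensor_hom_eqI[OF vs(1,2) h(2) module_hom_compose[OF tensor_lift_hom h(1)] tensor_lift_hom])
    (auto simp: vs h b b' t tensor_lift_pure eq)

context
  fixes K :: "('k, 'm) ring_scheme" and V :: "('k, 'v, 'n) module_scheme"
    and W :: "('k, 'w, 'p) module_scheme" and V1 :: "('k, 'v1, 'n1) module_scheme"
    and W1 :: "('k, 'w1, 'p1) module_scheme" and f g
  assumes vs: "vectorspace K V" "vectorspace K W" "vectorspace K V1" "vectorspace K W1"
    and f: "f \<in> module_hom K V V1" and g: "g \<in> module_hom K W W1"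
begin

lemma bilinear_tensor_map:
  "bilinear_map K V W (tensor K V1 W1) (\<lambda>v w. pure_tensor K V1 W1 (f v) (g w))"
  by (rule bilinear_map_compose[OF bilinear_pure_tensor f g]) (fact vs)+

lemma tensor_map_hom: "tensor_map K V W V1 W1 f g \<in> module_hom K (tensor K V W) (tensor K V1 W1)"
  unfolding tensor_map_def by (intro tensor_lift_hom vectorspace_tensor bilinear_tensor_map vs)

text \<open>Pulls a bilinear map back along \<open>f\<close> and \<open>g\<close>: a product
  functional applied to the image of a tensor becomes a product functional applied to the tensor
  itself.\<close>

lemma tensor_lift_tensor_map:
  assumes U: "vectorspace K U" and b: "bilinear_map K V1 W1 U b" and t: "t \<in> carrier (tensor K V W)"
  shows "tensor_lift K V1 W1 U b (tensor_map K V W V1 W1 f g t) =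
    tensor_lift K V W U (\<lambda>v w. b (f v) (g w)) t"
  unfolding tensor_map_def
  by (rule tensor_eval_lift[OF vs(1,2) vectorspace_tensor bilinear_tensor_map tensor_lift_hom])
    (auto simp: vs U b t tensor_lift_pure module_hom_mem[OF f] module_hom_mem[OF g]
      intro!: bilinear_map_compose[OF b f g])

end

section \<open>The associator\<close>

context
  fixes K :: "('k, 'm) ring_scheme" and U :: "('k, 'u, 'q) module_scheme"
    and V :: "('k, 'v, 'n) module_scheme" and W :: "('k, 'w, 'p) module_scheme"
  assumes vs: "vectorspace K U" "vectorspace K V" "vectorspace K W"
begin

lemma bilinear_assoc_inner:
  assumes "w \<in> carrier W"
  shows "bilinear_map K U V (tensor K U (tensor K V W))
    (\<lambda>u v. pure_tensor K U (tensor K V W) u (pure_tensor K V W v w))"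
  using bilinear_map_compose[OF bilinear_pure_tensor[OF vs(1) vectorspace_tensor[OF vs(2,3)]]
      module_hom_id bilinear_mapD(1)[OF bilinear_pure_tensor[OF vs(2,3)] assms]] .

text \<open>Linearity in \<open>w\<close> is not immediate, since \<open>w\<close> sits inside the
  bilinear map being lifted. Both sides of each linearity law are linear in \<open>t\<close>, so
  they may be compared on pure tensors, where \<open>pure\<close> gives the linear dependence on
  \<open>w\<close>.\<close>

lemma bilinear_tensor_assoc:
  "bilinear_map K (tensor K U V) W (tensor K U (tensor K V W))
    (\<lambda>t w. tensor_lift K U V (tensor K U (tensor K V W))
       (\<lambda>u v. pure_tensor K U (tensor K V W) u (pure_tensor K V W v w)) t)" (is "bilinear_map K _ _ ?T ?b")
proof (rule bilinear_mapI)
  have T: "vectorspace K ?T" and UV: "vectorspace K (tensor K U V)" by (intro vectorspace_tensor vs)+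
  interpret T: vectorspace K ?T by (rule T)
  interpret UV: vectorspace K "tensor K U V" by (rule UV)
  interpret W: vectorspace K W by (rule vs)
  show hom: "(\<lambda>t. ?b t w) \<in> module_hom K (tensor K U V) ?T" if "w \<in> carrier W" for w
    by (intro tensor_lift_hom vs T bilinear_assoc_inner that)
  have pure: "(\<lambda>w. ?b (pure_tensor K U V u v) w) \<in> module_hom K W ?T"
    if uv: "u \<in> carrier U" "v \<in> carrier V" for u v
  proof (rule module_hom_cong[OF vs(3)])
    show "(\<lambda>w. pure_tensor K U (tensor K V W) u (pure_tensor K V W v w)) \<in> module_hom K W ?T"
      using module_hom_compose[OF bilinear_mapD(2)[OF bilinear_pure_tensor[OF vs(2,3)] uv(2)]
          bilinear_mapD(2)[OF bilinear_pure_tensor[OF vs(1) vectorspace_tensor[OF vs(2,3)]] uv(1)]] .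
  qed (intro tensor_lift_pure vs T bilinear_assoc_inner uv)
  show "(\<lambda>w. ?b t w) \<in> module_hom K W ?T" if "t \<in> carrier (tensor K U V)" for t
  proof (rule module_homI)
    show "?b t w \<in> carrier ?T" if "w \<in> carrier W" for w
      using module_hom_mem[OF hom[OF that] \<open>t \<in> _\<close>] .
    fix w assume w: "w \<in> carrier W"
    show "?b t (w \<oplus>\<^bsub>W\<^esub> w') = ?b t w \<oplus>\<^bsub>?T\<^esub> ?b t w'" if w': "w' \<in> carrier W" for w'
    proof (rule tensor_hom_eqI[OF vs(1,2) T hom _ _ \<open>t \<in> _\<close>])
      show "(\<lambda>t. ?b t w \<oplus>\<^bsub>?T\<^esub> ?b t w') \<in> module_hom K (tensor K U V) ?T"
        using module_hom_mem[OF hom[OF w]] module_hom_mem[OF hom[OF w']]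
        by (intro module_homI) (simp_all add: module_hom_add[OF hom[OF w]] module_hom_add[OF hom[OF w']]
          module_hom_smult[OF hom[OF w]] module_hom_smult[OF hom[OF w']] T.smult_r_distr T.a_ac)
    qed (use w w' module_hom_add[OF pure] in auto)
    show "?b t (a \<odot>\<^bsub>W\<^esub> w) = a \<odot>\<^bsub>?T\<^esub> ?b t w" if a: "a \<in> carrier K" for a
    proof (rule tensor_hom_eqI[OF vs(1,2) T hom module_hom_smult_right[OF UV T hom a] _ \<open>t \<in> _\<close>])
    qed (use w a module_hom_smult[OF pure] in auto)
  qed
qed

lemma tensor_assoc_hom:
  "tensor_assoc K U V W \<in> module_hom K (tensor K (tensor K U V) W) (tensor K U (tensor K V W))"
  unfolding tensor_assoc_def by (intro tensor_lift_hom vectorspace_tensor vs bilinear_tensor_assoc)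

text \<open>On pure tensors both sides are the product of f u, g v and h w in \<open>K\<close>. The
  associator is a nested lift, so the reduction to pure tensors is nested as well.\<close>

lemma tensor_eval_assoc:
  assumes f: "f \<in> dual_hom K U" and g: "g \<in> dual_hom K V" and h: "h \<in> dual_hom K W"
    and t: "t \<in> carrier (tensor K (tensor K U V) W)"
  shows "tensor_eval K U (tensor K V W) f (tensor_eval K V W g h) (tensor_assoc K U V W t) =
    tensor_eval K (tensor K U V) W (tensor_eval K U V f g) h t"
proof -
  have VW: "vectorspace K (tensor K V W)" and UV: "vectorspace K (tensor K U V)"
    and T: "vectorspace K (tensor K U (tensor K V W))" by (intro vectorspace_tensor vs)+
  interpret U: vectorspace K U by (rule vs)
  note S = vectorspace_scalar[OF vs(1)]
  note VWhom = tensor_eval_hom[OF vs(2,3) g h]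
  note UVhom = tensor_eval_hom[OF vs(1,2) f g]
  note Thom = tensor_eval_hom[OF vs(1) VW f VWhom]
  show ?thesis
    unfolding tensor_assoc_def
  proof (rule tensor_eval_lift[OF UV vs(3) T bilinear_tensor_assoc Thom S bilinear_mult[OF UV vs(3) UVhom h] _ t])
    fix s w assume s: "s \<in> carrier (tensor K U V)" and w: "w \<in> carrier W"
    have hw: "h w \<in> carrier K" using module_hom_mem[OF h w] by simp
    \<comment> \<open>With \<open>w\<close> fixed, both sides are functionals of \<open>s\<close>,
      the right one being \<open>h w\<close> times a product functional.\<close>
    have "tensor_eval K U (tensor K V W) f (tensor_eval K V W g h)
        (tensor_lift K U V (tensor K U (tensor K V W))
           (\<lambda>u v. pure_tensor K U (tensor K V W) u (pure_tensor K V W v w)) s) =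
      h w \<odot>\<^bsub>scalar_module K\<^esub> tensor_eval K U V f g s"
    proof (rule tensor_hom_eqI[OF vs(1,2) S _ module_hom_smult_right[OF UV S UVhom hw] _ s])
      show "(\<lambda>s. tensor_eval K U (tensor K V W) f (tensor_eval K V W g h)
        (tensor_lift K U V (tensor K U (tensor K V W))
           (\<lambda>u v. pure_tensor K U (tensor K V W) u (pure_tensor K V W v w)) s))
        \<in> dual_hom K (tensor K U V)"
        by (rule module_hom_compose[OF tensor_lift_hom Thom]) (intro vs T bilinear_assoc_inner w)+
      fix u v assume uv: "u \<in> carrier U" "v \<in> carrier V"
      have "f u \<in> carrier K" "g v \<in> carrier K"
        using module_hom_mem[OF f uv(1)] module_hom_mem[OF g uv(2)] by simp_all
      then show "tensor_eval K U (tensor K V W) f (tensor_eval K V W g h)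
        (tensor_lift K U V (tensor K U (tensor K V W))
           (\<lambda>u v. pure_tensor K U (tensor K V W) u (pure_tensor K V W v w)) (pure_tensor K U V u v)) =
        h w \<odot>\<^bsub>scalar_module K\<^esub> tensor_eval K U V f g (pure_tensor K U V u v)"
        using uv w hw
        by (simp add: tensor_lift_pure[OF vs(1,2) T bilinear_assoc_inner] tensor_eval_pure vs VW f g h
            VWhom pure_tensor_closed U.R.m_ac)
    qed
    then show "tensor_eval K U (tensor K V W) f (tensor_eval K V W g h)
        (tensor_lift K U V (tensor K U (tensor K V W))
           (\<lambda>u v. pure_tensor K U (tensor K V W) u (pure_tensor K V W v w)) s) =
      tensor_eval K U V f g s \<otimes>\<^bsub>K\<^esub> h w"
      using module_hom_mem[OF UVhom s] hw by (simp add: U.R.m_comm)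
  qed
qed

end

section \<open>Dual bases\<close>

lemma scalar_module_minus [simp]:
  "\<ominus>\<^bsub>scalar_module K\<^esub> x = \<ominus>\<^bsub>K\<^esub> x" "x \<ominus>\<^bsub>scalar_module K\<^esub> y = x \<ominus>\<^bsub>K\<^esub> y"
  by (simp_all add: scalar_module_def a_minus_def a_inv_def m_inv_def)

text \<open>A maximal subspace \<open>H\<close> that contains \<open>L\<close> and avoids
  \<open>v\<close> is a complement of the line through \<open>v\<close>; the functional is the
  coordinate along \<open>v\<close> modulo \<open>H\<close>. Zorn's lemma covers spaces of arbitrary
  dimension, as the extension of functionals to the quotient ring precedes its finiteness.\<close>

lemma hyperplane_functional:
  assumes "vectorspace K V" "submodule K L V" "v \<in> carrier V" "v \<notin> L"
  obtains f where "f \<in> dual_hom K V" "f v = \<one>\<^bsub>K\<^esub>" "\<And>x. x \<in> L \<Longrightarrow> f x = \<zero>\<^bsub>K\<^esub>"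
proof -
  interpret V: vectorspace K V by fact
  let ?A = "{H. submodule K H V \<and> L \<subseteq> H \<and> v \<notin> H}"
  have "\<exists>M\<in>?A. \<forall>X\<in>?A. M \<subseteq> X \<longrightarrow> X = M"
  proof (rule subset_Zorn_nonempty)
    show "?A \<noteq> {}" using assms by blast
  next
    fix \<C> assume "\<C> \<noteq> {}" and "subset.chain ?A \<C>"
    then have c: "\<And>H. H \<in> \<C> \<Longrightarrow> submodule K H V" "\<And>H. H \<in> \<C> \<Longrightarrow> L \<subseteq> H" "\<And>H. H \<in> \<C> \<Longrightarrow> v \<notin> H"
      and lin: "\<And>H H'. H \<in> \<C> \<Longrightarrow> H' \<in> \<C> \<Longrightarrow> H \<subseteq> H' \<or> H' \<subseteq> H"
      unfolding subset_chain_def by blast+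
    note sm = c(1)[unfolded submodule_def]
    have "submodule K (\<Union>\<C>) V"
      unfolding submodule_def
    proof (intro conjI allI impI)
      fix x y assume "x \<in> \<Union>\<C>" "y \<in> \<Union>\<C>"
      then obtain H where "H \<in> \<C>" "x \<in> H" "y \<in> H" using lin by blast
      then show "x \<oplus>\<^bsub>V\<^esub> y \<in> \<Union>\<C>" using sm by blast
    next
      show "\<zero>\<^bsub>V\<^esub> \<in> \<Union>\<C>" using \<open>\<C> \<noteq> {}\<close> sm by blast
    next
      show "\<Union>\<C> \<subseteq> carrier V" using sm by blast
    next
      show "a \<odot>\<^bsub>V\<^esub> x \<in> \<Union>\<C>" if "a \<in> carrier K" "x \<in> \<Union>\<C>" for a x using that sm by blast
    qed (rule V.module_axioms)
    moreover have "L \<subseteq> \<Union>\<C>" "v \<notin> \<Union>\<C>" using \<open>\<C> \<noteq> {}\<close> c by blast+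
    ultimately show "\<Union>\<C> \<in> ?A" by blast
  qed
  then obtain H where HA: "H \<in> ?A" and mx: "\<forall>X\<in>?A. H \<subseteq> X \<longrightarrow> X = H"
    by (elim bexE)
  have H: "submodule K H V" "L \<subseteq> H" "v \<notin> H" using HA by auto
  have max: "X = H" if "submodule K X V" "H \<subseteq> X" "v \<notin> X" for X
    using mx[rule_format, of X] that H(2) by simp
  interpret H: submodule K H V by (rule H)
  interpret HG: abelian_subgroup H V by (rule submodule_abelian_subgroup) (rule H)
  have Hm: "x \<ominus>\<^bsub>V\<^esub> y \<in> H" if "x \<in> H" "y \<in> H" for x y
    using that by (auto simp: a_minus_def)
  have Hc: "x \<in> carrier V" if "x \<in> H" for x using that H.subset by blast
  \<comment> \<open>For \<open>x\<close> outside \<open>H\<close>, maximality forces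
    \<open>v\<close> into H + K x; solving v = h + a x for \<open>x\<close> gives the inverse of
    \<open>a\<close> as coefficient.\<close>
  have ex: "\<exists>a\<in>carrier K. x \<ominus>\<^bsub>V\<^esub> a \<odot>\<^bsub>V\<^esub> v \<in> H" if x: "x \<in> carrier V" for x
  proof (cases "x \<in> H")
    case True
    then show ?thesis using assms(3) by (intro bexI[of _ "\<zero>\<^bsub>K\<^esub>"]) (auto simp: a_minus_def Hc)
  next
    case False
    let ?X = "{h \<oplus>\<^bsub>V\<^esub> a \<odot>\<^bsub>V\<^esub> x | h a. h \<in> H \<and> a \<in> carrier K}"
    have "submodule K ?X V"
      unfolding submodule_def
    proof (intro conjI allI impI)
      show "?X \<subseteq> carrier V" using x Hc by auto
      show "\<zero>\<^bsub>V\<^esub> \<in> ?X"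
        using x by (intro CollectI exI[of _ "\<zero>\<^bsub>V\<^esub>"] exI[of _ "\<zero>\<^bsub>K\<^esub>"]) auto
    next
      fix y z assume "y \<in> ?X" "z \<in> ?X"
      then obtain h a h' a' where yz: "y = h \<oplus>\<^bsub>V\<^esub> a \<odot>\<^bsub>V\<^esub> x" "z = h' \<oplus>\<^bsub>V\<^esub> a' \<odot>\<^bsub>V\<^esub> x"
        and m: "h \<in> H" "h' \<in> H" "a \<in> carrier K" "a' \<in> carrier K" by blast
      have "y \<oplus>\<^bsub>V\<^esub> z = (h \<oplus>\<^bsub>V\<^esub> h') \<oplus>\<^bsub>V\<^esub> (a \<oplus>\<^bsub>K\<^esub> a') \<odot>\<^bsub>V\<^esub> x"
        using m x Hc by (simp add: yz V.smult_l_distr V.M.a_ac)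
      then show "y \<oplus>\<^bsub>V\<^esub> z \<in> ?X" using m by blast
    next
      fix b y assume b: "b \<in> carrier K" and "y \<in> ?X"
      then obtain h a where y: "y = h \<oplus>\<^bsub>V\<^esub> a \<odot>\<^bsub>V\<^esub> x" and m: "h \<in> H" "a \<in> carrier K" by blast
      have "b \<odot>\<^bsub>V\<^esub> y = b \<odot>\<^bsub>V\<^esub> h \<oplus>\<^bsub>V\<^esub> (b \<otimes>\<^bsub>K\<^esub> a) \<odot>\<^bsub>V\<^esub> x"
        using m x b Hc by (simp add: y V.smult_r_distr V.smult_assoc1)
      then show "b \<odot>\<^bsub>V\<^esub> y \<in> ?X" using m b by blast
    qed (rule V.module_axioms)
    moreover have "H \<subseteq> ?X"
    proof
      fix h assume "h \<in> H"
      then show "h \<in> ?X" using x Hc by (intro CollectI exI[of _ h] exI[of _ "\<zero>\<^bsub>K\<^esub>"]) auto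
    qed
    moreover have "x \<in> ?X"
      using x by (intro CollectI exI[of _ "\<zero>\<^bsub>V\<^esub>"] exI[of _ "\<one>\<^bsub>K\<^esub>"]) auto
    ultimately have "v \<in> ?X" using max[of ?X] False by blast
    then obtain h a where v: "v = h \<oplus>\<^bsub>V\<^esub> a \<odot>\<^bsub>V\<^esub> x" and m: "h \<in> H" "a \<in> carrier K" by blast
    have "a \<noteq> \<zero>\<^bsub>K\<^esub>" using v m x H(3) Hc by auto
    then have a: "inv\<^bsub>K\<^esub> a \<in> carrier K" "inv\<^bsub>K\<^esub> a \<otimes>\<^bsub>K\<^esub> a = \<one>\<^bsub>K\<^esub>"
      using m(2) V.field_Units by (auto intro: V.R.Units_inv_closed V.R.Units_l_inv)
    have "x \<ominus>\<^bsub>V\<^esub> inv\<^bsub>K\<^esub> a \<odot>\<^bsub>V\<^esub> v = x \<ominus>\<^bsub>V\<^esub> (inv\<^bsub>K\<^esub> a \<odot>\<^bsub>V\<^esub> h \<oplus>\<^bsub>V\<^esub> x)"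
      using m a x Hc by (simp add: v V.smult_r_distr V.smult_assoc1[symmetric])
    also have "\<dots> = \<ominus>\<^bsub>V\<^esub> (inv\<^bsub>K\<^esub> a \<odot>\<^bsub>V\<^esub> h)"
      using m a x Hc by (simp add: a_minus_def V.M.minus_add V.M.a_ac V.M.r_neg1 V.M.r_neg2)
    finally have "x \<ominus>\<^bsub>V\<^esub> inv\<^bsub>K\<^esub> a \<odot>\<^bsub>V\<^esub> v \<in> H"
      using m a by simp
    then show ?thesis using a by blast
  qed
  \<comment> \<open>Two coefficients for the same \<open>x\<close> would put a nonzero multiple of
    \<open>v\<close>, hence \<open>v\<close> itself, into \<open>H\<close>.\<close>
  have un: "a = b"
    if "a \<in> carrier K" "b \<in> carrier K" "x \<in> carrier V"
      "x \<ominus>\<^bsub>V\<^esub> a \<odot>\<^bsub>V\<^esub> v \<in> H" "x \<ominus>\<^bsub>V\<^esub> b \<odot>\<^bsub>V\<^esub> v \<in> H" for a b x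
  proof (rule ccontr)
    assume "a \<noteq> b"
    let ?c = "b \<ominus>\<^bsub>K\<^esub> a"
    have c: "?c \<in> carrier K" "?c \<noteq> \<zero>\<^bsub>K\<^esub>" using that \<open>a \<noteq> b\<close> by auto
    then have i: "inv\<^bsub>K\<^esub> ?c \<in> carrier K" "inv\<^bsub>K\<^esub> ?c \<otimes>\<^bsub>K\<^esub> ?c = \<one>\<^bsub>K\<^esub>"
      using V.field_Units by (auto intro: V.R.Units_inv_closed V.R.Units_l_inv)
    have "(x \<ominus>\<^bsub>V\<^esub> a \<odot>\<^bsub>V\<^esub> v) \<ominus>\<^bsub>V\<^esub> (x \<ominus>\<^bsub>V\<^esub> b \<odot>\<^bsub>V\<^esub> v) = ?c \<odot>\<^bsub>V\<^esub> v"
      using that assms(3)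
      by (simp add: a_minus_def V.smult_l_distr V.smult_l_minus V.M.minus_add V.M.minus_minus V.M.a_ac V.M.r_neg1 V.M.r_neg2)
    then have "?c \<odot>\<^bsub>V\<^esub> v \<in> H" using Hm that by metis
    then have "inv\<^bsub>K\<^esub> ?c \<odot>\<^bsub>V\<^esub> (?c \<odot>\<^bsub>V\<^esub> v) \<in> H" using i by blast
    then show False using H(3) i c assms(3) by (simp add: V.smult_assoc1[symmetric])
  qed
  define f where "f x = (SOME a. a \<in> carrier K \<and> x \<ominus>\<^bsub>V\<^esub> a \<odot>\<^bsub>V\<^esub> v \<in> H)" for x
  have f: "f x \<in> carrier K \<and> x \<ominus>\<^bsub>V\<^esub> f x \<odot>\<^bsub>V\<^esub> v \<in> H" if "x \<in> carrier V" for x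
  proof -
    have "\<exists>a. a \<in> carrier K \<and> x \<ominus>\<^bsub>V\<^esub> a \<odot>\<^bsub>V\<^esub> v \<in> H" using ex[OF that] by blast
    then show ?thesis unfolding f_def by (rule someI_ex)
  qed
  \<comment> \<open>It is enough to exhibit a coefficient that works, so linearity of
    \<open>f\<close> follows by adding and scaling the membership relations.\<close>
  have feq: "f x = a" if "x \<in> carrier V" "a \<in> carrier K" "x \<ominus>\<^bsub>V\<^esub> a \<odot>\<^bsub>V\<^esub> v \<in> H" for x a
    using un[OF _ that(2,1) _ that(3)] f[OF that(1)] by blast
  have "f \<in> dual_hom K V"
  proof (rule module_homI)
    show "f x \<in> carrier (scalar_module K)" if "x \<in> carrier V" for x using f[OF that] by simp
    show "f (x \<oplus>\<^bsub>V\<^esub> y) = f x \<oplus>\<^bsub>scalar_module K\<^esub> f y" if xy: "x \<in> carrier V" "y \<in> carrier V" for x y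
    proof -
      have "(x \<ominus>\<^bsub>V\<^esub> f x \<odot>\<^bsub>V\<^esub> v) \<oplus>\<^bsub>V\<^esub> (y \<ominus>\<^bsub>V\<^esub> f y \<odot>\<^bsub>V\<^esub> v) = (x \<oplus>\<^bsub>V\<^esub> y) \<ominus>\<^bsub>V\<^esub> (f x \<oplus>\<^bsub>K\<^esub> f y) \<odot>\<^bsub>V\<^esub> v"
        using f[OF xy(1)] f[OF xy(2)] xy assms(3)
        by (simp add: a_minus_def V.smult_l_distr V.M.minus_add V.M.a_ac)
      moreover have "(x \<ominus>\<^bsub>V\<^esub> f x \<odot>\<^bsub>V\<^esub> v) \<oplus>\<^bsub>V\<^esub> (y \<ominus>\<^bsub>V\<^esub> f y \<odot>\<^bsub>V\<^esub> v) \<in> H"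
        using f[OF xy(1)] f[OF xy(2)] by blast
      ultimately show ?thesis using f[OF xy(1)] f[OF xy(2)] xy by (intro trans[OF feq]) auto
    qed
    show "f (a \<odot>\<^bsub>V\<^esub> x) = a \<odot>\<^bsub>scalar_module K\<^esub> f x" if ax: "a \<in> carrier K" "x \<in> carrier V" for a x
    proof -
      have "a \<odot>\<^bsub>V\<^esub> (x \<ominus>\<^bsub>V\<^esub> f x \<odot>\<^bsub>V\<^esub> v) = a \<odot>\<^bsub>V\<^esub> x \<ominus>\<^bsub>V\<^esub> (a \<otimes>\<^bsub>K\<^esub> f x) \<odot>\<^bsub>V\<^esub> v"
        using f[OF ax(2)] ax assms(3)
        by (simp add: a_minus_def V.smult_r_distr V.smult_r_minus V.smult_assoc1)
      moreover have "a \<odot>\<^bsub>V\<^esub> (x \<ominus>\<^bsub>V\<^esub> f x \<odot>\<^bsub>V\<^esub> v) \<in> H"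
        using f[OF ax(2)] ax by blast
      ultimately show ?thesis using f[OF ax(2)] ax by (intro trans[OF feq]) auto
    qed
  qed
  moreover have "f v = \<one>\<^bsub>K\<^esub>"
    using assms(3) by (intro feq) (auto simp: a_minus_def V.M.r_neg)
  moreover have "f x = \<zero>\<^bsub>K\<^esub>" if "x \<in> L" for x
  proof -
    have "x \<in> H" using that H(2) by blast
    then show ?thesis using assms(3) Hc by (intro feq) (auto simp: a_minus_def)
  qed
  ultimately show thesis using that by blast
qed

text \<open>The kernel of a nonzero \<open>p\<close> is a hyperplane. So it suffices to find a
  functional \<open>g\<close> that kills the image of this kernel and is 1 at \<open>j s\<close> for
  some \<open>s\<close> with \<open>p s\<close> nonzero; then \<open>p s\<close> times
  \<open>g\<close> extends \<open>p\<close>. Injectivity of \<open>j\<close> keeps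
  \<open>j s\<close> out of the image of the kernel.\<close>

lemma functional_extension:
  assumes "vectorspace K R" "vectorspace K V" "j \<in> module_hom K R V" "inj_on j (carrier R)"
    and p: "p \<in> dual_hom K R"
  obtains f where "f \<in> dual_hom K V" "\<And>r. r \<in> carrier R \<Longrightarrow> f (j r) = p r"
proof (cases "\<exists>s\<in>carrier R. p s \<noteq> \<zero>\<^bsub>K\<^esub>")
  case False
  interpret R: vectorspace K R by fact
  have "(\<lambda>x. \<zero>\<^bsub>K\<^esub>) \<in> dual_hom K V" by (rule module_homI) auto
  with False show thesis by (intro that[of "\<lambda>x. \<zero>\<^bsub>K\<^esub>"]) auto
next
  case True
  then obtain s where s: "s \<in> carrier R" "p s \<noteq> \<zero>\<^bsub>K\<^esub>" by blast
  interpret R: vectorspace K R by fact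
  interpret V: vectorspace K V by fact
  note S = vectorspace_scalar[OF assms(1)]
  interpret p: mod_hom K R "scalar_module K" p
    by (intro mod_homI R.module_axioms vectorspace_imp_module S p)
  interpret j: mod_hom K R V j
    by (intro mod_homI R.module_axioms V.module_axioms assms(3))
  have pc: "p r \<in> carrier K" if "r \<in> carrier R" for r using p.f_im[OF that] by simp
  let ?L = "j ` p.ker"
  have L: "submodule K ?L V"
  proof -
    interpret k: submodule K p.ker R by (rule p.ker_is_submodule)
    have kc: "r \<in> carrier R" if "r \<in> p.ker" for r using that k.subset by blast
    show ?thesis
      unfolding submodule_def
    proof (intro conjI allI impI)
      show "?L \<subseteq> carrier V" using kc by auto
      fix x y assume "x \<in> ?L" "y \<in> ?L"
      then obtain r t where "r \<in> p.ker" "t \<in> p.ker" "x = j r" "y = j t" by blast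
      then show "x \<oplus>\<^bsub>V\<^esub> y \<in> ?L"
        using kc by (intro image_eqI[of _ _ "r \<oplus>\<^bsub>R\<^esub> t"]) auto
    next
      show "\<zero>\<^bsub>V\<^esub> \<in> ?L" by (intro image_eqI[of _ _ "\<zero>\<^bsub>R\<^esub>"]) auto
    next
      fix a x assume "a \<in> carrier K" "x \<in> ?L"
      then obtain r where "a \<in> carrier K" "r \<in> p.ker" "x = j r" by blast
      then show "a \<odot>\<^bsub>V\<^esub> x \<in> ?L"
        using kc by (intro image_eqI[of _ _ "a \<odot>\<^bsub>R\<^esub> r"]) auto
    qed (rule V.module_axioms)
  qed
  have nL: "j s \<notin> ?L"
  proof
    assume "j s \<in> ?L"
    then obtain r where "r \<in> carrier R" "p r = \<zero>\<^bsub>K\<^esub>" "j s = j r" by (auto simp: p.ker_def)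
    then show False using s inj_onD[OF assms(4)] by metis
  qed
  obtain g where g: "g \<in> dual_hom K V" "g (j s) = \<one>\<^bsub>K\<^esub>" "\<And>x. x \<in> ?L \<Longrightarrow> g x = \<zero>\<^bsub>K\<^esub>"
    using hyperplane_functional[OF assms(2) L j.f_im[OF s(1)] nL] by blast
  have inv: "inv\<^bsub>K\<^esub> p s \<in> carrier K" "inv\<^bsub>K\<^esub> p s \<otimes>\<^bsub>K\<^esub> p s = \<one>\<^bsub>K\<^esub>"
    using s pc R.field_Units by (auto intro: R.R.Units_inv_closed R.R.Units_l_inv)
  show thesis
  proof
    show "(\<lambda>x. p s \<odot>\<^bsub>scalar_module K\<^esub> g x) \<in> dual_hom K V"
      by (intro module_hom_smult_right[OF assms(2) S g(1)] pc s)
    show "p s \<odot>\<^bsub>scalar_module K\<^esub> g (j r) = p r" if r: "r \<in> carrier R" for r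
    proof -
      \<comment> \<open>Chosen so that r - ?a s lies in the kernel of \<open>p\<close>; the value of
        \<open>g\<close> at \<open>j r\<close> then comes from the component along \<open>s\<close>
        alone.\<close>
      let ?a = "p r \<otimes>\<^bsub>K\<^esub> inv\<^bsub>K\<^esub> p s"
      have a: "?a \<in> carrier K" using r inv pc by simp
      have "p (r \<ominus>\<^bsub>R\<^esub> ?a \<odot>\<^bsub>R\<^esub> s) = p r \<ominus>\<^bsub>K\<^esub> ?a \<otimes>\<^bsub>K\<^esub> p s"
        using module_hom_minus[OF assms(1) S p r] s a by (simp add: module_hom_smult[OF p])
      also have "\<dots> = \<zero>\<^bsub>K\<^esub>" using r s inv pc by (simp add: R.R.m_assoc R.R.r_neg a_minus_def)
      finally have "r \<ominus>\<^bsub>R\<^esub> ?a \<odot>\<^bsub>R\<^esub> s \<in> p.ker" using r s a by (simp add: p.ker_def)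
      then have g0: "g (j (r \<ominus>\<^bsub>R\<^esub> ?a \<odot>\<^bsub>R\<^esub> s)) = \<zero>\<^bsub>K\<^esub>" using g(3) by blast
      have "j r = j (r \<ominus>\<^bsub>R\<^esub> ?a \<odot>\<^bsub>R\<^esub> s) \<oplus>\<^bsub>V\<^esub> ?a \<odot>\<^bsub>V\<^esub> j s"
      proof -
        have "r = (r \<ominus>\<^bsub>R\<^esub> ?a \<odot>\<^bsub>R\<^esub> s) \<oplus>\<^bsub>R\<^esub> ?a \<odot>\<^bsub>R\<^esub> s"
          using r s a by (simp add: a_minus_def R.M.a_assoc R.M.l_neg)
        then have "j r = j ((r \<ominus>\<^bsub>R\<^esub> ?a \<odot>\<^bsub>R\<^esub> s) \<oplus>\<^bsub>R\<^esub> ?a \<odot>\<^bsub>R\<^esub> s)" by simp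
        also have "\<dots> = j (r \<ominus>\<^bsub>R\<^esub> ?a \<odot>\<^bsub>R\<^esub> s) \<oplus>\<^bsub>V\<^esub> ?a \<odot>\<^bsub>V\<^esub> j s"
          using r s a by (subst j.f_add) (simp_all del: j.f_minus)
        finally show ?thesis .
      qed
      then have "g (j r) = g (j (r \<ominus>\<^bsub>R\<^esub> ?a \<odot>\<^bsub>R\<^esub> s) \<oplus>\<^bsub>V\<^esub> ?a \<odot>\<^bsub>V\<^esub> j s)" by (rule arg_cong)
      also have "\<dots> = \<zero>\<^bsub>K\<^esub> \<oplus>\<^bsub>K\<^esub> ?a \<otimes>\<^bsub>K\<^esub> \<one>\<^bsub>K\<^esub>"
        using r s a g(2) g0
        by (simp add: module_hom_add[OF g(1)] module_hom_smult[OF g(1)] del: j.f_minus j.f_add j.f_smult)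
      finally have "g (j r) = \<zero>\<^bsub>K\<^esub> \<oplus>\<^bsub>K\<^esub> ?a \<otimes>\<^bsub>K\<^esub> \<one>\<^bsub>K\<^esub>" .
      then show ?thesis using r s a inv pc by (simp add: R.R.m_ac)
    qed
  qed
qed

section \<open>Dual bases and finite dimension\<close>

text \<open>A dual basis as in the dual basis lemma for projective modules: a reproducing formula,
  without independence of the \<open>e i\<close>. In this form it passes to dual spaces by
  exchanging \<open>e\<close> with \<open>\<phi>\<close>.\<close>

definition dual_basis ::
  "('k, 'm) ring_scheme \<Rightarrow> ('k, 'v, 'n) module_scheme \<Rightarrow> 'i set \<Rightarrow> ('i \<Rightarrow> 'v) \<Rightarrow> ('i \<Rightarrow> 'v \<Rightarrow> 'k) \<Rightarrow> bool"
  where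
  "dual_basis K V I e \<phi> \<longleftrightarrow> finite I \<and> (\<forall>i\<in>I. e i \<in> carrier V \<and> \<phi> i \<in> dual_hom K V) \<and>
    (\<forall>v\<in>carrier V. v = (\<Oplus>\<^bsub>V\<^esub>i\<in>I. \<phi> i v \<odot>\<^bsub>V\<^esub> e i))"

lemma dual_basisD:
  assumes "dual_basis K V I e \<phi>"
  shows "finite I" "i \<in> I \<Longrightarrow> e i \<in> carrier V" "i \<in> I \<Longrightarrow> \<phi> i \<in> dual_hom K V"
    "i \<in> I \<Longrightarrow> v \<in> carrier V \<Longrightarrow> \<phi> i v \<in> carrier K"
    "v \<in> carrier V \<Longrightarrow> v = (\<Oplus>\<^bsub>V\<^esub>i\<in>I. \<phi> i v \<odot>\<^bsub>V\<^esub> e i)"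
  using assms module_hom_mem[of "\<phi> i" K V "scalar_module K" v] by (auto simp: dual_basis_def)

lemma dual_basis_zero:
  assumes "vectorspace K V" "dual_basis K V I e \<phi>" "v \<in> carrier V" "\<And>i. i \<in> I \<Longrightarrow> \<phi> i v = \<zero>\<^bsub>K\<^esub>"
  shows "v = \<zero>\<^bsub>V\<^esub>"
proof -
  interpret V: vectorspace K V by fact
  have "(\<Oplus>\<^bsub>V\<^esub>i\<in>I. \<phi> i v \<odot>\<^bsub>V\<^esub> e i) = (\<Oplus>\<^bsub>V\<^esub>i\<in>I. \<zero>\<^bsub>V\<^esub>)"
    using assms(4) dual_basisD(2)[OF assms(2)] by (intro V.finsum_cong') auto
  then show ?thesis using dual_basisD(5)[OF assms(2,3)] by simp
qed

text \<open>Coordinates with respect to a basis are linear because they are unique. As a function,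
  \<open>c v\<close> is unique only when extensional on \<open>B\<close>; \<open>eq\<close> compares
  it with arbitrary coefficient functions.\<close>

lemma fin_dim_dual_basis:
  assumes "vectorspace K V" "vectorspace.fin_dim K V"
  obtains B \<phi> where "dual_basis K V B (\<lambda>x. x) \<phi>"
proof -
  interpret V: vectorspace K V by fact
  obtain B where B: "finite B" "V.basis B" using V.finite_basis_exists assms(2) by blast
  have BV: "B \<subseteq> carrier V" using B(2) by (simp add: V.basis_def)
  have ex: "\<exists>!a. a \<in> B \<rightarrow>\<^sub>E carrier K \<and> V.lincomb a B = v" if "v \<in> carrier V" for v
    using V.basis_criterion[OF B(1) BV] B(2) that by blast
  define c where "c v = (THE a. a \<in> B \<rightarrow>\<^sub>E carrier K \<and> V.lincomb a B = v)" for v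
  have c: "c v \<in> B \<rightarrow>\<^sub>E carrier K" "V.lincomb (c v) B = v" if "v \<in> carrier V" for v
    using theI'[OF ex[OF that]] unfolding c_def by auto
  have cc: "c v b \<in> carrier K" if "v \<in> carrier V" "b \<in> B" for v b
    using c(1)[OF that(1)] that(2) by blast
  have eq: "c v b = a b" if "v \<in> carrier V" "b \<in> B" "\<And>b. b \<in> B \<Longrightarrow> a b \<in> carrier K" "V.lincomb a B = v" for v b a
  proof -
    have "V.lincomb (restrict a B) B = V.lincomb a B"
      unfolding V.lincomb_def using that(3) BV by (intro V.finsum_cong') auto
    then have "restrict a B \<in> B \<rightarrow>\<^sub>E carrier K \<and> V.lincomb (restrict a B) B = v"
      using that by auto
    then have "c v = restrict a B" using ex[OF that(1)] c[OF that(1)] by blast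
    then show ?thesis using that(2) by simp
  qed
  have hom: "(\<lambda>v. c v b) \<in> dual_hom K V" if b: "b \<in> B" for b
  proof (rule module_homI)
    show "c v b \<in> carrier (scalar_module K)" if "v \<in> carrier V" for v
      using cc[OF that b] by simp
    show "c (v \<oplus>\<^bsub>V\<^esub> w) b = c v b \<oplus>\<^bsub>scalar_module K\<^esub> c w b" if vw: "v \<in> carrier V" "w \<in> carrier V" for v w
    proof -
      have "V.lincomb (\<lambda>b. c v b \<oplus>\<^bsub>K\<^esub> c w b) B = (\<Oplus>\<^bsub>V\<^esub>b\<in>B. c v b \<odot>\<^bsub>V\<^esub> b \<oplus>\<^bsub>V\<^esub> c w b \<odot>\<^bsub>V\<^esub> b)"
        unfolding V.lincomb_def using cc[OF vw(1)] cc[OF vw(2)] BV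
        by (intro V.finsum_cong') (auto simp: V.smult_l_distr subset_iff)
      also have "\<dots> = V.lincomb (c v) B \<oplus>\<^bsub>V\<^esub> V.lincomb (c w) B"
        unfolding V.lincomb_def using cc[OF vw(1)] cc[OF vw(2)] BV
        by (intro V.finsum_addf) (auto simp: subset_iff)
      finally show ?thesis using c(2) vw cc by (subst eq[of _ _ "\<lambda>b. c v b \<oplus>\<^bsub>K\<^esub> c w b"]) (auto simp: b)
    qed
    show "c (a \<odot>\<^bsub>V\<^esub> v) b = a \<odot>\<^bsub>scalar_module K\<^esub> c v b" if av: "a \<in> carrier K" "v \<in> carrier V" for a v
    proof -
      have "V.lincomb (\<lambda>b. a \<otimes>\<^bsub>K\<^esub> c v b) B = (\<Oplus>\<^bsub>V\<^esub>b\<in>B. a \<odot>\<^bsub>V\<^esub> (c v b \<odot>\<^bsub>V\<^esub> b))"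
        unfolding V.lincomb_def using av cc[OF av(2)] BV
        by (intro V.finsum_cong') (auto simp: V.smult_assoc1 subset_iff)
      also have "\<dots> = a \<odot>\<^bsub>V\<^esub> V.lincomb (c v) B"
        unfolding V.lincomb_def using av cc[OF av(2)] BV B(1)
        by (intro V.finsum_smult_ldistr[symmetric]) (auto simp: subset_iff)
      finally show ?thesis using c(2) av cc by (subst eq[of _ _ "\<lambda>b. a \<otimes>\<^bsub>K\<^esub> c v b"]) (auto simp: b)
    qed
  qed
  have "dual_basis K V B (\<lambda>x. x) (\<lambda>b v. c v b)"
    unfolding dual_basis_def using B BV hom c(2) by (auto simp: V.lincomb_def)
  then show thesis by (rule that)
qed

lemma submodule_finsum:
  assumes "submodule R N M" "finite I" "\<And>i. i \<in> I \<Longrightarrow> f i \<in> N"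
  shows "(\<Oplus>\<^bsub>M\<^esub>i\<in>I. f i) \<in> N"
proof -
  interpret submodule R N M by fact
  interpret M: module R M by (rule module)
  show ?thesis
    using assms(2,3)
  proof (induction I)
    case empty
    then show ?case using zero_closed by simp
  next
    case (insert i I)
    have "(\<Oplus>\<^bsub>M\<^esub>i\<in>insert i I. f i) = f i \<oplus>\<^bsub>M\<^esub> (\<Oplus>\<^bsub>M\<^esub>i\<in>I. f i)"
      using insert subset by (intro M.finsum_insert) auto
    then show ?case using insert m_closed by simp
  qed
qed

lemma dual_basis_fin_dim:
  assumes "vectorspace K V" "dual_basis K V I e \<phi>"
  shows "vectorspace.fin_dim K V"
proof -
  interpret V: vectorspace K V by fact
  have eI: "e ` I \<subseteq> carrier V" using dual_basisD(2)[OF assms(2)] by auto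
  have sub: "submodule K (V.span (e ` I)) V" using V.span_is_submodule[OF eI] .
  interpret s: submodule K "V.span (e ` I)" V by (rule sub)
  have "v \<in> V.span (e ` I)" if v: "v \<in> carrier V" for v
  proof -
    have "(\<Oplus>\<^bsub>V\<^esub>i\<in>I. \<phi> i v \<odot>\<^bsub>V\<^esub> e i) \<in> V.span (e ` I)"
      using V.in_own_span[OF eI] dual_basisD(1,4)[OF assms(2)] v
      by (intro submodule_finsum[OF sub] s.smult_closed) auto
    then show ?thesis using dual_basisD(5)[OF assms(2) v] by simp
  qed
  then show ?thesis
    unfolding V.fin_dim_def using eI dual_basisD(1)[OF assms(2)] V.span_is_subset2[OF eI]
    by (intro exI[of _ "e ` I"]) auto
qed

text \<open>Each functional cuts the dimension by at most one: \<open>U\<close> is spanned by the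
  kernel of \<open>f\<close> on \<open>U\<close> and one vector \<open>u\<close> where
  \<open>f\<close> is nonzero. The induction runs over all subspaces separated by the functionals,
  since the kernel of \<open>f\<close> on \<open>U\<close> is separated by the remaining
  ones.\<close>

lemma separating_functionals_fin_dim:
  assumes "vectorspace K V" "finite \<Phi>" "\<Phi> \<subseteq> dual_hom K V"
    and sep: "\<And>v. v \<in> carrier V \<Longrightarrow> (\<And>f. f \<in> \<Phi> \<Longrightarrow> f v = \<zero>\<^bsub>K\<^esub>) \<Longrightarrow> v = \<zero>\<^bsub>V\<^esub>"
  shows "vectorspace.fin_dim K V"
proof -
  interpret V: vectorspace K V by fact
  have "\<exists>S. finite S \<and> S \<subseteq> U \<and> U \<subseteq> V.span S"
    if "submodule K U V" "\<And>v. v \<in> U \<Longrightarrow> (\<And>f. f \<in> \<Phi> \<Longrightarrow> f v = \<zero>\<^bsub>K\<^esub>) \<Longrightarrow> v = \<zero>\<^bsub>V\<^esub>" for U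
    using assms(2,3) that
  proof (induction \<Phi> arbitrary: U)
    case empty
    interpret s: submodule K "V.span {}" V by (rule V.span_is_submodule) auto
    have "U \<subseteq> V.span {}" using empty.prems(3) s.zero_closed by blast
    then show ?case by blast
  next
    case (insert f \<Phi>)
    interpret U: submodule K U V by (rule insert.prems(2))
    have f: "f \<in> dual_hom K V" using insert.prems(1) by simp
    interpret f: mod_hom K V "scalar_module K" f
      by (intro mod_homI V.module_axioms vectorspace_imp_module vectorspace_scalar[OF assms(1)] f)
    have Uc: "u \<in> carrier V" if "u \<in> U" for u using U.subset that by blast
    have fc: "f u \<in> carrier K" if "u \<in> U" for u using f.f_im[OF Uc[OF that]] by simp
    let ?U = "{u \<in> U. f u = \<zero>\<^bsub>K\<^esub>}"
    have "submodule K ?U V"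
      unfolding submodule_def using Uc by (auto intro: V.module_axioms)
    moreover have "v = \<zero>\<^bsub>V\<^esub>" if "v \<in> ?U" "\<And>g. g \<in> \<Phi> \<Longrightarrow> g v = \<zero>\<^bsub>K\<^esub>" for v
      using insert.prems(3)[of v] that by blast
    ultimately obtain S where S: "finite S" "S \<subseteq> ?U" "?U \<subseteq> V.span S"
      using insert.IH[of ?U] insert.prems(1) by blast
    show ?case
    proof (cases "U \<subseteq> ?U")
      case True
      then show ?thesis using S by blast
    next
      case False
      then obtain u where u: "u \<in> U" "f u \<noteq> \<zero>\<^bsub>K\<^esub>" by blast
      have inv: "inv\<^bsub>K\<^esub> f u \<in> carrier K" "inv\<^bsub>K\<^esub> f u \<otimes>\<^bsub>K\<^esub> f u = \<one>\<^bsub>K\<^esub>"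
        using u fc V.field_Units by (auto intro: V.R.Units_inv_closed V.R.Units_l_inv)
      have SV: "insert u S \<subseteq> carrier V" using S(2) u Uc by blast
      interpret s: submodule K "V.span (insert u S)" V by (rule V.span_is_submodule[OF SV])
      have "x \<in> V.span (insert u S)" if x: "x \<in> U" for x
      proof -
        let ?a = "f x \<otimes>\<^bsub>K\<^esub> inv\<^bsub>K\<^esub> f u"
        \<comment> \<open>The projection of \<open>x\<close> to the kernel of \<open>f\<close> along
          \<open>u\<close>.\<close>
        let ?y = "x \<oplus>\<^bsub>V\<^esub> (\<ominus>\<^bsub>K\<^esub> ?a) \<odot>\<^bsub>V\<^esub> u"
        have a: "?a \<in> carrier K" "\<ominus>\<^bsub>K\<^esub> ?a \<in> carrier K" using fc[OF x] inv by auto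
        have "f ?y = f x \<ominus>\<^bsub>K\<^esub> ?a \<otimes>\<^bsub>K\<^esub> f u"
          using Uc x u a fc by (simp add: a_minus_def V.R.l_minus)
        also have "\<dots> = \<zero>\<^bsub>K\<^esub>"
          using fc x u inv by (simp add: V.R.m_assoc V.R.r_neg a_minus_def)
        finally have "?y \<in> ?U" using x u a by simp
        then have "?y \<in> V.span (insert u S)" using S(3) V.span_is_monotone[of S "insert u S"] by blast
        moreover have "u \<in> V.span (insert u S)" using V.in_own_span[OF SV] by blast
        ultimately have "?y \<oplus>\<^bsub>V\<^esub> ?a \<odot>\<^bsub>V\<^esub> u \<in> V.span (insert u S)" using a by blast
        moreover have "?y \<oplus>\<^bsub>V\<^esub> ?a \<odot>\<^bsub>V\<^esub> u = x"
          using Uc x u a by (simp add: V.M.a_assoc V.smult_l_minus V.M.l_neg)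
        ultimately show ?thesis by simp
      qed
      then show ?thesis using S(1,2) u by (intro exI[of _ "insert u S"]) auto
    qed
  qed
  from this[of "carrier V"] sep obtain S where "finite S" "S \<subseteq> carrier V" "carrier V \<subseteq> V.span S"
    using V.module_axioms by (auto simp: submodule_def)
  then show ?thesis
    unfolding V.fin_dim_def using V.span_is_subset2[of S] by blast
qed

section \<open>Dual spaces\<close>

lemma dual_space_simps:
  "carrier (dual_space K V) = dual_hom K V \<inter> extensional (carrier V)"
  "\<zero>\<^bsub>dual_space K V\<^esub> = (\<lambda>v\<in>carrier V. \<zero>\<^bsub>K\<^esub>)"
  "f \<oplus>\<^bsub>dual_space K V\<^esub> g = (\<lambda>v\<in>carrier V. f v \<oplus>\<^bsub>K\<^esub> g v)"
  "a \<odot>\<^bsub>dual_space K V\<^esub> f = (\<lambda>v\<in>carrier V. a \<otimes>\<^bsub>K\<^esub> f v)"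
  by (simp_all add: dual_space_def)

lemma restrict_dual_space:
  assumes "vectorspace K V" "f \<in> dual_hom K V"
  shows "restrict f (carrier V) \<in> carrier (dual_space K V)"
  using module_hom_cong[OF assms] by (auto simp: dual_space_simps)

lemma dual_space_value: "f \<in> carrier (dual_space K V) \<Longrightarrow> v \<in> carrier V \<Longrightarrow> f v \<in> carrier K"
  using module_hom_mem[of f K V "scalar_module K" v] by (simp add: dual_space_simps)

lemma dual_space_eqI:
  assumes "f \<in> carrier (dual_space K V)" "g \<in> carrier (dual_space K V)" "\<And>v. v \<in> carrier V \<Longrightarrow> f v = g v"
  shows "f = g"
  using assms by (intro extensionalityI[of f "carrier V" g]) (auto simp: dual_space_simps)

lemma vectorspace_dual_space:
  assumes "vectorspace K V" shows "vectorspace K (dual_space K V)"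
proof -
  interpret V: vectorspace K V by fact
  note S = vectorspace_scalar[OF assms]
  have hom: "f \<in> dual_hom K V" if "f \<in> carrier (dual_space K V)" for f
    using that by (simp add: dual_space_simps)
  have zero: "\<zero>\<^bsub>dual_space K V\<^esub> \<in> carrier (dual_space K V)"
    unfolding dual_space_simps(2) by (rule restrict_dual_space[OF assms]) (rule module_homI, auto)
  have add: "f \<oplus>\<^bsub>dual_space K V\<^esub> g \<in> carrier (dual_space K V)"
    if "f \<in> carrier (dual_space K V)" "g \<in> carrier (dual_space K V)" for f g
    unfolding dual_space_simps(3)
    using dual_space_value[OF that(1)] dual_space_value[OF that(2)]
    by (intro restrict_dual_space[OF assms] module_homI)
      (auto simp: module_hom_add[OF hom[OF that(1)]] module_hom_add[OF hom[OF that(2)]] V.R.a_ac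
        module_hom_smult[OF hom[OF that(1)]] module_hom_smult[OF hom[OF that(2)]] V.R.r_distr)
  have smult: "a \<odot>\<^bsub>dual_space K V\<^esub> f \<in> carrier (dual_space K V)"
    if "a \<in> carrier K" "f \<in> carrier (dual_space K V)" for a f
    unfolding dual_space_simps(4)
    using restrict_dual_space[OF assms module_hom_smult_right[OF assms S hom[OF that(2)] that(1)]] by simp
  note v = dual_space_value
  show ?thesis
  proof (rule vs_criteria, goal_cases)
    case 4
    show ?case
    proof
      fix f assume f: "f \<in> carrier (dual_space K V)"
      then show "\<exists>g\<in>carrier (dual_space K V). f \<oplus>\<^bsub>dual_space K V\<^esub> g = \<zero>\<^bsub>dual_space K V\<^esub>"
        by (intro bexI[of _ "(\<ominus>\<^bsub>K\<^esub> \<one>\<^bsub>K\<^esub>) \<odot>\<^bsub>dual_space K V\<^esub> f"] smult)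
          (auto simp: dual_space_simps(2-4) v[OF f] V.R.l_minus V.R.r_neg intro!: restrict_ext)
    qed
  next
    case 8
    show ?case
    proof
      fix f assume f: "f \<in> carrier (dual_space K V)"
      show "f \<oplus>\<^bsub>dual_space K V\<^esub> \<zero>\<^bsub>dual_space K V\<^esub> = f"
        by (rule dual_space_eqI[OF add[OF f zero] f]) (simp add: dual_space_simps(2,3) v[OF f])
    qed
  next
    case 10
    show ?case
    proof
      fix f assume f: "f \<in> carrier (dual_space K V)"
      show "\<one>\<^bsub>K\<^esub> \<odot>\<^bsub>dual_space K V\<^esub> f = f"
        by (rule dual_space_eqI[OF smult[OF V.R.one_closed f] f]) (simp add: dual_space_simps(4) v[OF f])
    qed
  qed (use V.field_axioms zero add smult in
      \<open>auto simp: dual_space_simps(2-4) v V.R.a_ac V.R.m_assoc V.R.l_distr V.R.r_distr intro!: restrict_ext\<close>)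
qed

lemma eval_hom: "v \<in> carrier V \<Longrightarrow> (\<lambda>f. f v) \<in> dual_hom K (dual_space K V)"
  using dual_space_value[of _ K V v] by (intro module_homI) (auto simp: dual_space_simps(3,4))

text \<open>Applying \<open>f\<close> to the reproducing formula of \<open>v\<close> gives f v = sum
  of \<phi> i (v) f (e i), which is the reproducing formula of \<open>f\<close> evaluated at
  \<open>v\<close>.\<close>

lemma dual_basis_dual_space:
  assumes "vectorspace K V" "dual_basis K V I e \<phi>"
  shows "dual_basis K (dual_space K V) I (\<lambda>i. restrict (\<phi> i) (carrier V)) (\<lambda>i f. f (e i))"
  unfolding dual_basis_def
proof (intro conjI ballI)
  interpret V: vectorspace K V by fact
  let ?D = "dual_space K V"
  interpret D: vectorspace K ?D by (rule vectorspace_dual_space[OF assms(1)])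
  note d = dual_basisD[OF assms(2)]
  note S = vectorspace_scalar[OF assms(1)]
  show "finite I" by (rule d)
  show \<phi>D: "restrict (\<phi> i) (carrier V) \<in> carrier ?D" if "i \<in> I" for i
    by (intro restrict_dual_space assms d that)
  show "(\<lambda>f. f (e i)) \<in> dual_hom K ?D" if "i \<in> I" for i
    by (intro eval_hom d that)
  fix f assume f: "f \<in> carrier ?D"
  have fh: "f \<in> dual_hom K V" using f by (simp add: dual_space_simps)
  have t: "f (e i) \<odot>\<^bsub>?D\<^esub> restrict (\<phi> i) (carrier V) \<in> carrier ?D" if "i \<in> I" for i
    using \<phi>D[OF that] dual_space_value[OF f d(2)[OF that]] by auto
  show "f = (\<Oplus>\<^bsub>?D\<^esub>i\<in>I. f (e i) \<odot>\<^bsub>?D\<^esub> restrict (\<phi> i) (carrier V))" (is "f = ?g")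
  proof (rule dual_space_eqI[OF f])
    show "?g \<in> carrier ?D" using t by (intro D.finsum_closed) auto
    fix v assume v: "v \<in> carrier V"
    have "?g v = (\<Oplus>\<^bsub>scalar_module K\<^esub>i\<in>I. (f (e i) \<odot>\<^bsub>?D\<^esub> restrict (\<phi> i) (carrier V)) v)"
      by (rule module_hom_finsum[OF D.vectorspace_axioms S eval_hom[OF v] d(1) t])
    also have "\<dots> = (\<Oplus>\<^bsub>scalar_module K\<^esub>i\<in>I. f (\<phi> i v \<odot>\<^bsub>V\<^esub> e i))"
    proof -
      interpret S: vectorspace K "scalar_module K" by (rule S)
      show ?thesis
        using d(2,4) v dual_space_value[OF f]
        by (intro S.finsum_cong') (auto simp: dual_space_simps(4) module_hom_smult[OF fh] V.R.m_comm)
    qed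
    also have "\<dots> = f (\<Oplus>\<^bsub>V\<^esub>i\<in>I. \<phi> i v \<odot>\<^bsub>V\<^esub> e i)"
      using d(2,4) v by (intro module_hom_finsum[OF assms(1) S fh d(1), symmetric]) auto
    also have "\<dots> = f v" using d(5)[OF v] by simp
    finally show "f v = ?g v" by simp
  qed
qed

section \<open>Expansion of tensors and equality tests by coordinates\<close>

lemma dual_basis_eqI:
  assumes "vectorspace K V" "dual_basis K V I e \<phi>" "v \<in> carrier V" "w \<in> carrier V"
    and "\<And>i. i \<in> I \<Longrightarrow> \<phi> i v = \<phi> i w"
  shows "v = w"
proof -
  interpret V: vectorspace K V by fact
  have "v = (\<Oplus>\<^bsub>V\<^esub>i\<in>I. \<phi> i v \<odot>\<^bsub>V\<^esub> e i)" by (rule dual_basisD(5)[OF assms(2,3)])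
  also have "\<dots> = (\<Oplus>\<^bsub>V\<^esub>i\<in>I. \<phi> i w \<odot>\<^bsub>V\<^esub> e i)"
    using assms(4,5) dual_basisD(2,4)[OF assms(2)] by (intro V.finsum_cong') auto
  also have "\<dots> = w" by (rule dual_basisD(5)[OF assms(2,4), symmetric])
  finally show ?thesis .
qed

text \<open>The right factors are the slices of \<open>t\<close> by the maps \<phi> i \<otimes> id.
  By linearity only pure tensors matter, and there the coefficients \<phi> i (v) of the left factor
  are carried over to the right one.\<close>

lemma tensor_expand_left:
  assumes vs: "vectorspace K V" "vectorspace K W" and d: "dual_basis K V I e \<phi>"
    and t: "t \<in> carrier (tensor K V W)"
  shows "t = (\<Oplus>\<^bsub>tensor K V W\<^esub>i\<in>I. pure_tensor K V W (e i) (tensor_lift K V W W (\<lambda>v w. \<phi> i v \<odot>\<^bsub>W\<^esub> w) t))"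
proof (rule tensor_hom_eqI[OF vs vectorspace_tensor[OF vs] module_hom_id module_hom_ext_finsum _ t])
  let ?T = "tensor K V W"
  interpret V: vectorspace K V by (rule vs)
  interpret W: vectorspace K W by (rule vs)
  interpret T: vectorspace K ?T by (rule vectorspace_tensor[OF vs])
  note b = bilinear_smult_left[OF vs dual_basisD(3)[OF d]]
  show "(\<lambda>t. pure_tensor K V W (e i) (tensor_lift K V W W (\<lambda>v w. \<phi> i v \<odot>\<^bsub>W\<^esub> w) t)) \<in> module_hom K ?T ?T"
    if "i \<in> I" for i
    by (rule module_hom_compose[OF tensor_lift_hom[OF vs vs(2) b[OF that]]])
      (rule bilinear_mapD(2)[OF bilinear_pure_tensor[OF vs] dual_basisD(2)[OF d that]])
  fix v w assume v: "v \<in> carrier V" and w: "w \<in> carrier W"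
  note hom = bilinear_mapD(1)[OF bilinear_pure_tensor[OF vs] w]
  have "pure_tensor K V W v w = pure_tensor K V W (\<Oplus>\<^bsub>V\<^esub>i\<in>I. \<phi> i v \<odot>\<^bsub>V\<^esub> e i) w"
    using dual_basisD(5)[OF d v] by simp
  also have "\<dots> = (\<Oplus>\<^bsub>?T\<^esub>i\<in>I. pure_tensor K V W (\<phi> i v \<odot>\<^bsub>V\<^esub> e i) w)"
    using dual_basisD(2,4)[OF d] v
    by (intro module_hom_finsum[OF vs(1) T.vectorspace_axioms hom dual_basisD(1)[OF d]]) auto
  also have "\<dots> = (\<Oplus>\<^bsub>?T\<^esub>i\<in>I. pure_tensor K V W (e i) (tensor_lift K V W W (\<lambda>v w. \<phi> i v \<odot>\<^bsub>W\<^esub> w)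
      (pure_tensor K V W v w)))"
    using dual_basisD(2,4)[OF d] v w
    by (intro T.finsum_cong') (auto simp: tensor_lift_pure[OF vs vs(2) b] pure_tensor_closed[OF vs]
        module_hom_smult[OF hom] module_hom_smult[OF bilinear_mapD(2)[OF bilinear_pure_tensor[OF vs]]])
  finally show "pure_tensor K V W v w = (\<Oplus>\<^bsub>?T\<^esub>i\<in>I. pure_tensor K V W (e i)
      (tensor_lift K V W W (\<lambda>v w. \<phi> i v \<odot>\<^bsub>W\<^esub> w) (pure_tensor K V W v w)))" .
qed (rule vectorspace_tensor[OF vs] dual_basisD(1)[OF d])+

lemma tensor_expand_right:
  assumes vs: "vectorspace K V" "vectorspace K W" and d: "dual_basis K W I e \<phi>"
    and t: "t \<in> carrier (tensor K V W)"
  shows "t = (\<Oplus>\<^bsub>tensor K V W\<^esub>i\<in>I. pure_tensor K V W (tensor_lift K V W V (\<lambda>v w. \<phi> i w \<odot>\<^bsub>V\<^esub> v) t) (e i))"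
proof (rule tensor_hom_eqI[OF vs vectorspace_tensor[OF vs] module_hom_id module_hom_ext_finsum _ t])
  let ?T = "tensor K V W"
  interpret V: vectorspace K V by (rule vs)
  interpret W: vectorspace K W by (rule vs)
  interpret T: vectorspace K ?T by (rule vectorspace_tensor[OF vs])
  note b = bilinear_smult_right[OF vs dual_basisD(3)[OF d]]
  show "(\<lambda>t. pure_tensor K V W (tensor_lift K V W V (\<lambda>v w. \<phi> i w \<odot>\<^bsub>V\<^esub> v) t) (e i)) \<in> module_hom K ?T ?T"
    if "i \<in> I" for i
    by (rule module_hom_compose[OF tensor_lift_hom[OF vs vs(1) b[OF that]]])
      (rule bilinear_mapD(1)[OF bilinear_pure_tensor[OF vs] dual_basisD(2)[OF d that]])
  fix v w assume v: "v \<in> carrier V" and w: "w \<in> carrier W"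
  note hom = bilinear_mapD(2)[OF bilinear_pure_tensor[OF vs] v]
  have "pure_tensor K V W v w = pure_tensor K V W v (\<Oplus>\<^bsub>W\<^esub>i\<in>I. \<phi> i w \<odot>\<^bsub>W\<^esub> e i)"
    using dual_basisD(5)[OF d w] by simp
  also have "\<dots> = (\<Oplus>\<^bsub>?T\<^esub>i\<in>I. pure_tensor K V W v (\<phi> i w \<odot>\<^bsub>W\<^esub> e i))"
    using dual_basisD(2,4)[OF d] w
    by (intro module_hom_finsum[OF vs(2) T.vectorspace_axioms hom dual_basisD(1)[OF d]]) auto
  also have "\<dots> = (\<Oplus>\<^bsub>?T\<^esub>i\<in>I. pure_tensor K V W (tensor_lift K V W V (\<lambda>v w. \<phi> i w \<odot>\<^bsub>V\<^esub> v)
      (pure_tensor K V W v w)) (e i))"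
    using dual_basisD(2,4)[OF d] v w
    by (intro T.finsum_cong') (auto simp: tensor_lift_pure[OF vs vs(1) b] pure_tensor_closed[OF vs]
        module_hom_smult[OF hom] module_hom_smult[OF bilinear_mapD(1)[OF bilinear_pure_tensor[OF vs]]])
  finally show "pure_tensor K V W v w = (\<Oplus>\<^bsub>?T\<^esub>i\<in>I. pure_tensor K V W
      (tensor_lift K V W V (\<lambda>v w. \<phi> i w \<odot>\<^bsub>V\<^esub> v) (pure_tensor K V W v w)) (e i))" .
qed (rule vectorspace_tensor[OF vs] dual_basisD(1)[OF d])+

text \<open>Slices are vectors of one factor; a functional on that factor sees them through product
  functionals, as \<open>g\<close> after f \<otimes> id is f \<otimes> g.\<close>

lemma tensor_slice_left:
  assumes vs: "vectorspace K V" "vectorspace K W" and f: "f \<in> dual_hom K V" and g: "g \<in> dual_hom K W"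
    and t: "t \<in> carrier (tensor K V W)"
  shows "g (tensor_lift K V W W (\<lambda>v w. f v \<odot>\<^bsub>W\<^esub> w) t) = tensor_eval K V W f g t"
  by (rule tensor_eval_lift[OF vs vs(2) bilinear_smult_left[OF vs f] g vectorspace_scalar[OF vs(1)]
        bilinear_mult[OF vs f g] _ t])
    (use module_hom_mem[OF f] module_hom_smult[OF g] in simp)

lemma tensor_slice_right:
  assumes vs: "vectorspace K V" "vectorspace K W" and f: "f \<in> dual_hom K V" and g: "g \<in> dual_hom K W"
    and t: "t \<in> carrier (tensor K V W)"
  shows "f (tensor_lift K V W V (\<lambda>v w. g w \<odot>\<^bsub>V\<^esub> v) t) = tensor_eval K V W f g t"
proof (rule tensor_eval_lift[OF vs vs(1) bilinear_smult_right[OF vs g] f vectorspace_scalar[OF vs(1)]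
        bilinear_mult[OF vs f g] _ t])
  interpret V: vectorspace K V by (rule vs)
  show "f (g w \<odot>\<^bsub>V\<^esub> v) = f v \<otimes>\<^bsub>K\<^esub> g w" if "v \<in> carrier V" "w \<in> carrier W" for v w
    using module_hom_mem[OF f that(1)] module_hom_mem[OF g that(2)] that
    by (simp add: module_hom_smult[OF f] V.R.m_comm)
qed

text \<open>The left factor carries a dual basis, the right one just a separating family of
  functionals. This asymmetry allows iteration to triple tensor products, where product functionals
  form the separating family.\<close>

lemma tensor_eval_eqI:
  assumes vs: "vectorspace K V" "vectorspace K W"
    and d: "dual_basis K V I e \<phi>" and \<Psi>: "\<Psi> \<subseteq> dual_hom K W"
    and sep: "\<And>w w'. \<lbrakk>w \<in> carrier W; w' \<in> carrier W; \<And>g. g \<in> \<Psi> \<Longrightarrow> g w = g w'\<rbrakk> \<Longrightarrow> w = w'"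
    and st: "s \<in> carrier (tensor K V W)" "t \<in> carrier (tensor K V W)"
    and eq: "\<And>i g. i \<in> I \<Longrightarrow> g \<in> \<Psi> \<Longrightarrow> tensor_eval K V W (\<phi> i) g s = tensor_eval K V W (\<phi> i) g t"
  shows "s = t"
proof -
  let ?T = "tensor K V W"
  interpret T: vectorspace K ?T by (rule vectorspace_tensor[OF vs])
  note b = bilinear_smult_left[OF vs dual_basisD(3)[OF d]]
  note cl = tensor_lift_closed[OF vs vs(2) b]
  have slice: "tensor_lift K V W W (\<lambda>v w. \<phi> i v \<odot>\<^bsub>W\<^esub> w) s = tensor_lift K V W W (\<lambda>v w. \<phi> i v \<odot>\<^bsub>W\<^esub> w) t"
    if i: "i \<in> I" for i
    using eq[OF i] \<Psi> by (intro sep cl i st) (simp add: tensor_slice_left[OF vs dual_basisD(3)[OF d i] _] st subset_iff)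
  have "s = (\<Oplus>\<^bsub>?T\<^esub>i\<in>I. pure_tensor K V W (e i) (tensor_lift K V W W (\<lambda>v w. \<phi> i v \<odot>\<^bsub>W\<^esub> w) s))"
    by (rule tensor_expand_left[OF vs d st(1)])
  also have "\<dots> = (\<Oplus>\<^bsub>?T\<^esub>i\<in>I. pure_tensor K V W (e i) (tensor_lift K V W W (\<lambda>v w. \<phi> i v \<odot>\<^bsub>W\<^esub> w) t))"
    using cl st dual_basisD(2)[OF d] pure_tensor_closed[OF vs] slice by (intro T.finsum_cong') auto
  also have "\<dots> = t" by (rule tensor_expand_left[OF vs d st(2), symmetric])
  finally show ?thesis .
qed

lemma tensor_eval_eqI2:
  assumes vs: "vectorspace K V" "vectorspace K W"
    and d: "dual_basis K V I e \<phi>" "dual_basis K W J f \<psi>"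
    and st: "s \<in> carrier (tensor K V W)" "t \<in> carrier (tensor K V W)"
    and eq: "\<And>i j. i \<in> I \<Longrightarrow> j \<in> J \<Longrightarrow> tensor_eval K V W (\<phi> i) (\<psi> j) s = tensor_eval K V W (\<phi> i) (\<psi> j) t"
  shows "s = t"
proof (rule tensor_eval_eqI[OF vs d(1) _ _ st, of "\<psi> ` J"])
  show "\<psi> ` J \<subseteq> dual_hom K W" using dual_basisD(3)[OF d(2)] by blast
  show "w = w'" if "w \<in> carrier W" "w' \<in> carrier W" "\<And>g. g \<in> \<psi> ` J \<Longrightarrow> g w = g w'" for w w'
    using that(3) by (intro dual_basis_eqI[OF vs(2) d(2) that(1,2)]) auto
qed (use eq in auto)

lemma tensor_eval_eqI3:
  assumes vs: "vectorspace K U" "vectorspace K V" "vectorspace K W"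
    and d: "dual_basis K U I e \<phi>" "dual_basis K V J f \<psi>" "dual_basis K W L g \<chi>"
    and st: "s \<in> carrier (tensor K U (tensor K V W))" "t \<in> carrier (tensor K U (tensor K V W))"
    and eq: "\<And>i j l. \<lbrakk>i \<in> I; j \<in> J; l \<in> L\<rbrakk> \<Longrightarrow>
      tensor_eval K U (tensor K V W) (\<phi> i) (tensor_eval K V W (\<psi> j) (\<chi> l)) s =
      tensor_eval K U (tensor K V W) (\<phi> i) (tensor_eval K V W (\<psi> j) (\<chi> l)) t"
  shows "s = t"
proof (rule tensor_eval_eqI[OF vs(1) vectorspace_tensor[OF vs(2,3)] d(1) _ _ st,
      of "(\<lambda>(j, l). tensor_eval K V W (\<psi> j) (\<chi> l)) ` (J \<times> L)"])
  show "(\<lambda>(j, l). tensor_eval K V W (\<psi> j) (\<chi> l)) ` (J \<times> L) \<subseteq> dual_hom K (tensor K V W)"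
    using dual_basisD(3)[OF d(2)] dual_basisD(3)[OF d(3)] by (auto intro!: tensor_eval_hom vs)
  show "w = w'" if "w \<in> carrier (tensor K V W)" "w' \<in> carrier (tensor K V W)"
    "\<And>g. g \<in> (\<lambda>(j, l). tensor_eval K V W (\<psi> j) (\<chi> l)) ` (J \<times> L) \<Longrightarrow> g w = g w'" for w w'
  proof (rule tensor_eval_eqI2[OF vs(2,3) d(2,3) that(1,2)])
    show "tensor_eval K V W (\<psi> j) (\<chi> l) w = tensor_eval K V W (\<psi> j) (\<chi> l) w'" if "j \<in> J" "l \<in> L" for j l
      using that by (intro \<open>\<And>g. g \<in> _ \<Longrightarrow> g w = g w'\<close> image_eqI[of _ _ "(j, l)"]) auto
  qed
qed (use eq in auto)

text \<open>
  Coassociativity of a coaction, tested on functionals: \<open>\<rho>\<close> is dual to the action of \<open>Y\<close> on \<open>X\<close>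
  and \<open>\<Delta>\<close> to the multiplication of \<open>Y\<close>.
\<close>

lemma coassoc_by_functionals:
  assumes vs: "vectorspace K V" "vectorspace K C"
    and \<rho>: "\<rho> \<in> module_hom K V (tensor K V C)" and \<Delta>: "\<Delta> \<in> module_hom K C (tensor K C C)"
    and \<alpha>: "\<And>x. x \<in> X \<Longrightarrow> \<alpha> x \<in> dual_hom K V" and \<beta>: "\<And>y. y \<in> Y \<Longrightarrow> \<beta> y \<in> dual_hom K C"
    and dV: "dual_basis K V I e (\<lambda>i. \<alpha> (p i))" "p \<in> I \<rightarrow> X"
    and dC: "dual_basis K C J f (\<lambda>j. \<beta> (q j))" "q \<in> J \<rightarrow> Y"
    and act: "\<And>x y. x \<in> X \<Longrightarrow> y \<in> Y \<Longrightarrow> act x y \<in> X" and mul: "\<And>y z. y \<in> Y \<Longrightarrow> z \<in> Y \<Longrightarrow> mul y z \<in> Y"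
    and \<rho>_eval: "\<And>x y v. \<lbrakk>x \<in> X; y \<in> Y; v \<in> carrier V\<rbrakk> \<Longrightarrow>
      tensor_eval K V C (\<alpha> x) (\<beta> y) (\<rho> v) = \<alpha> (act x y) v"
    and \<Delta>_eval: "\<And>y z c. \<lbrakk>y \<in> Y; z \<in> Y; c \<in> carrier C\<rbrakk> \<Longrightarrow>
      tensor_eval K C C (\<beta> y) (\<beta> z) (\<Delta> c) = \<beta> (mul y z) c"
    and assoc: "\<And>x y z. \<lbrakk>x \<in> X; y \<in> Y; z \<in> Y\<rbrakk> \<Longrightarrow> act (act x y) z = act x (mul y z)"
    and v: "v \<in> carrier V"
  shows "tensor_assoc K V C C (tensor_map K V C (tensor K V C) C \<rho> (\<lambda>c. c) (\<rho> v)) =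
    tensor_map K V C V (tensor K C C) (\<lambda>x. x) \<Delta> (\<rho> v)"
proof (rule tensor_eval_eqI3[OF vs vs(2) dV(1) dC(1) dC(1)])
  have VC: "vectorspace K (tensor K V C)" and CC: "vectorspace K (tensor K C C)"
    by (intro vectorspace_tensor vs)+
  note S = vectorspace_scalar[OF vs(1)]
  have \<rho>v: "\<rho> v \<in> carrier (tensor K V C)" by (rule module_hom_mem[OF \<rho> v])
  note map1 = tensor_map_hom[OF vs VC vs(2) \<rho> module_hom_id]
  note map2 = tensor_map_hom[OF vs vs(1) CC module_hom_id \<Delta>]
  have m1: "tensor_map K V C (tensor K V C) C \<rho> (\<lambda>c. c) (\<rho> v) \<in> carrier (tensor K (tensor K V C) C)"
    by (rule module_hom_mem[OF map1 \<rho>v])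
  show "tensor_assoc K V C C (tensor_map K V C (tensor K V C) C \<rho> (\<lambda>c. c) (\<rho> v))
      \<in> carrier (tensor K V (tensor K C C))"
    by (rule module_hom_mem[OF tensor_assoc_hom[OF vs vs(2)] m1])
  show "tensor_map K V C V (tensor K C C) (\<lambda>x. x) \<Delta> (\<rho> v) \<in> carrier (tensor K V (tensor K C C))"
    by (rule module_hom_mem[OF map2 \<rho>v])
  fix i j l assume "i \<in> I" "j \<in> J" "l \<in> J"
  define x y z where "x = p i" and "y = q j" and "z = q l"
  have xyz: "x \<in> X" "y \<in> Y" "z \<in> Y"
    using \<open>i \<in> I\<close> \<open>j \<in> J\<close> \<open>l \<in> J\<close> dV(2) dC(2) by (auto simp: x_def y_def z_def)
  note ax = \<alpha>[OF xyz(1)] and bz = \<beta>[OF xyz(2)] \<beta>[OF xyz(3)]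
  \<comment> \<open>The associator and the tensor maps are absorbed into the functionals until both
    sides are values of \<open>\<alpha>\<close> at \<open>v\<close>; the two computations meet in
    \<open>assoc\<close>.\<close>
  have "tensor_eval K V (tensor K C C) (\<alpha> x) (tensor_eval K C C (\<beta> y) (\<beta> z))
      (tensor_assoc K V C C (tensor_map K V C (tensor K V C) C \<rho> (\<lambda>c. c) (\<rho> v))) =
    tensor_eval K (tensor K V C) C (tensor_eval K V C (\<alpha> x) (\<beta> y)) (\<beta> z)
      (tensor_map K V C (tensor K V C) C \<rho> (\<lambda>c. c) (\<rho> v))"
    by (rule tensor_eval_assoc[OF vs vs(2) ax bz m1])
  also have "\<dots> = tensor_eval K V C (\<lambda>v. tensor_eval K V C (\<alpha> x) (\<beta> y) (\<rho> v)) (\<beta> z) (\<rho> v)"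
    by (rule tensor_lift_tensor_map[OF vs VC vs(2) \<rho> module_hom_id S
          bilinear_mult[OF VC vs(2) tensor_eval_hom[OF vs ax bz(1)] bz(2)] \<rho>v])
  also have "\<dots> = tensor_eval K V C (\<alpha> (act x y)) (\<beta> z) (\<rho> v)"
    using \<rho>_eval[OF xyz(1,2)] by (intro fun_cong[OF tensor_lift_cong]) simp
  also have "\<dots> = \<alpha> (act (act x y) z) v" by (intro \<rho>_eval act xyz v)
  also have "\<dots> = \<alpha> (act x (mul y z)) v" by (simp only: assoc[OF xyz])
  also have "\<dots> = tensor_eval K V C (\<alpha> x) (\<beta> (mul y z)) (\<rho> v)" by (intro \<rho>_eval[symmetric] mul xyz v)
  also have "\<dots> = tensor_eval K V C (\<alpha> x) (\<lambda>c. tensor_eval K C C (\<beta> y) (\<beta> z) (\<Delta> c)) (\<rho> v)"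
    using \<Delta>_eval[OF xyz(2,3)] by (intro fun_cong[OF tensor_lift_cong]) simp
  also have "\<dots> = tensor_eval K V (tensor K C C) (\<alpha> x) (tensor_eval K C C (\<beta> y) (\<beta> z))
      (tensor_map K V C V (tensor K C C) (\<lambda>x. x) \<Delta> (\<rho> v))"
    by (rule tensor_lift_tensor_map[OF vs vs(1) CC module_hom_id \<Delta> S
          bilinear_mult[OF vs(1) CC ax tensor_eval_hom[OF vs(2) vs(2) bz]] \<rho>v, symmetric])
  finally show "tensor_eval K V (tensor K C C) (\<alpha> (p i)) (tensor_eval K C C (\<beta> (q j)) (\<beta> (q l)))
      (tensor_assoc K V C C (tensor_map K V C (tensor K V C) C \<rho> (\<lambda>c. c) (\<rho> v))) =
    tensor_eval K V (tensor K C C) (\<alpha> (p i)) (tensor_eval K C C (\<beta> (q j)) (\<beta> (q l)))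
      (tensor_map K V C V (tensor K C C) (\<lambda>x. x) \<Delta> (\<rho> v))"
    by (simp only: x_def y_def z_def)
qed

section \<open>Dual coalgebras and dual algebras\<close>

text \<open>Tensor products depend only on carrier, addition and scalars. This identifies tensors
  over \<open>dual_space K A\<close>, where the comultiplication is defined, with tensors over
  \<open>dual_coalgebra K A\<close>, a record of another type with the same linear
  structure.\<close>

lemma tensor_cong:
  assumes "carrier V = carrier V'" "\<And>x y. x \<oplus>\<^bsub>V\<^esub> y = x \<oplus>\<^bsub>V'\<^esub> y" "\<And>a x. a \<odot>\<^bsub>V\<^esub> x = a \<odot>\<^bsub>V'\<^esub> x"
    and "carrier W = carrier W'" "\<And>x y. x \<oplus>\<^bsub>W\<^esub> y = x \<oplus>\<^bsub>W'\<^esub> y" "\<And>a x. a \<odot>\<^bsub>W\<^esub> x = a \<odot>\<^bsub>W'\<^esub> x"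
  shows "tensor K V W = tensor K V' W'" "tensor_lift K V W = tensor_lift K V' W'"
proof -
  have kernel: "tensor_kernel K V W = tensor_kernel K V' W'"
    unfolding tensor_kernel_def tensor_relations_def by (simp only: assms)
  then show tensor: "tensor K V W = tensor K V' W'"
    unfolding tensor_def by (simp only: assms)
  have pure: "pure_tensor K V W = pure_tensor K V' W'"
    unfolding pure_tensor_def kernel by (simp only: assms)
  show "tensor_lift K V W = tensor_lift K V' W'"
    unfolding tensor_lift_def by (intro ext) (simp only: tensor pure assms)
qed

lemma module_hom_cong_domain:
  assumes "carrier V = carrier V'" "\<And>x y. x \<oplus>\<^bsub>V\<^esub> y = x \<oplus>\<^bsub>V'\<^esub> y" "\<And>a x. a \<odot>\<^bsub>V\<^esub> x = a \<odot>\<^bsub>V'\<^esub> x"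
  shows "module_hom K V U = module_hom K V' U"
  unfolding module_hom_def by (simp only: assms)

lemma vectorspace_cong:
  assumes "vectorspace K V" "carrier V' = carrier V" "\<zero>\<^bsub>V'\<^esub> = \<zero>\<^bsub>V\<^esub>"
    "\<And>x y. x \<oplus>\<^bsub>V'\<^esub> y = x \<oplus>\<^bsub>V\<^esub> y" "\<And>a x. a \<odot>\<^bsub>V'\<^esub> x = a \<odot>\<^bsub>V\<^esub> x"
  shows "vectorspace K V'"
proof -
  interpret V: vectorspace K V by fact
  show ?thesis
    by (rule vs_criteria)
      (auto simp: assms(2-5) V.field_axioms V.M.a_ac V.smult_assoc1 V.smult_l_distr V.smult_r_distr
        intro: bexI[of _ "\<ominus>\<^bsub>V\<^esub> _"] V.M.r_neg)
qed

lemma dual_basis_cong: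
  fixes K :: "('a, 'm) ring_scheme" and V' :: "('a, 'b, 'd) module_scheme"
  assumes "dual_basis K V I e \<phi>" and vs: "vectorspace K V" and "carrier V' = carrier V" "\<zero>\<^bsub>V'\<^esub> = \<zero>\<^bsub>V\<^esub>"
    "\<And>x y. x \<oplus>\<^bsub>V'\<^esub> y = x \<oplus>\<^bsub>V\<^esub> y" "\<And>a x. a \<odot>\<^bsub>V'\<^esub> x = a \<odot>\<^bsub>V\<^esub> x"
  shows "dual_basis K V' I e \<phi>"
proof -
  have hom: "module_hom K V' U = module_hom K V U" for U :: "('a, 'a) module"
    by (rule module_hom_cong_domain) (simp_all add: assms)
  note d = dual_basisD[OF assms(1)]
  have id: "(\<lambda>x. x) \<in> module_hom K V V'" by (rule module_homI) (simp_all add: assms)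
  have "v = (\<Oplus>\<^bsub>V'\<^esub>i\<in>I. \<phi> i v \<odot>\<^bsub>V'\<^esub> e i)" if v: "v \<in> carrier V" for v
  proof -
    interpret V: vectorspace K V by fact
    have "(\<Oplus>\<^bsub>V\<^esub>i\<in>I. \<phi> i v \<odot>\<^bsub>V\<^esub> e i) = (\<Oplus>\<^bsub>V'\<^esub>i\<in>I. \<phi> i v \<odot>\<^bsub>V\<^esub> e i)"
      using d(2,4) v by (intro module_hom_finsum[OF vs vectorspace_cong[OF vs] id d(1)]) (auto simp: assms)
    then show ?thesis using d(5)[OF v] by (simp add: assms)
  qed
  then show ?thesis
    using d(1-3) unfolding dual_basis_def by (simp add: assms hom)
qed

section \<open>The dual coalgebra of a finite dimensional algebra\<close>

lemma dual_coalgebra_simps: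
  "carrier (dual_coalgebra K A) = carrier (dual_space K A)"
  "\<zero>\<^bsub>dual_coalgebra K A\<^esub> = \<zero>\<^bsub>dual_space K A\<^esub>"
  "f \<oplus>\<^bsub>dual_coalgebra K A\<^esub> g = f \<oplus>\<^bsub>dual_space K A\<^esub> g"
  "a \<odot>\<^bsub>dual_coalgebra K A\<^esub> f = a \<odot>\<^bsub>dual_space K A\<^esub> f"
  "counit (dual_coalgebra K A) f = f \<one>\<^bsub>A\<^esub>"
  by (simp_all add: dual_coalgebra_def Let_def)

lemma vectorspace_dual_coalgebra: "vectorspace K A \<Longrightarrow> vectorspace K (dual_coalgebra K A)"
  by (rule vectorspace_cong[OF vectorspace_dual_space]) (auto simp: dual_coalgebra_simps)

lemma dual_basis_dual_coalgebra:
  "\<lbrakk>vectorspace K A; dual_basis K A I e \<phi>\<rbrakk> \<Longrightarrow>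
    dual_basis K (dual_coalgebra K A) I (\<lambda>i. restrict (\<phi> i) (carrier A)) (\<lambda>i f. f (e i))"
  by (rule dual_basis_cong[OF dual_basis_dual_space vectorspace_dual_space]) (auto simp: dual_coalgebra_simps)

lemma dual_coalgebra_eval_hom: "x \<in> carrier A \<Longrightarrow> (\<lambda>f. f x) \<in> dual_hom K (dual_coalgebra K A)"
  by (subst module_hom_cong_domain[where V' = "dual_space K A"]) (simp_all add: dual_coalgebra_simps eval_hom)

locale finite_dim_algebra = assoc_algebra K A for K and A (structure) +
  fixes I :: "'i set" and e \<phi>
  assumes dual_basis: "dual_basis K A I e \<phi>"
begin

abbreviation "D \<equiv> dual_coalgebra K A"

lemmas vectorspace_A = vectorspace_axioms
lemmas vectorspace_D = vectorspace_dual_coalgebra[OF vectorspace_A]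
lemmas dual_basis_D = dual_basis_dual_coalgebra[OF vectorspace_A dual_basis]

sublocale D: vectorspace K D by (rule vectorspace_D)

lemma D_hom: "f \<in> carrier D \<Longrightarrow> f \<in> dual_hom K A"
  by (simp add: dual_coalgebra_simps dual_space_simps)

lemma D_value: "f \<in> carrier D \<Longrightarrow> x \<in> carrier A \<Longrightarrow> f x \<in> carrier K"
  using module_hom_mem[OF D_hom] by fastforce

text \<open>From y = sum of \<phi> i (y) e i follows f (x y) = sum of f (x e i) \<phi> i (y). So the
  tensor is the sum of the pure tensors of x \<mapsto> f (x e i) and \<phi> i. It is unique because
  the evaluations at the \<open>e i\<close> are coordinates on \<open>D\<close>.\<close>

lemma ex1_comult:
  assumes f: "f \<in> carrier D"
  shows "\<exists>!t. t \<in> carrier (tensor K D D) \<and>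
    (\<forall>x\<in>carrier A. \<forall>y\<in>carrier A. tensor_eval K D D (\<lambda>g. g x) (\<lambda>h. h y) t = f (x \<otimes> y))"
proof (rule ex_ex1I)
  fix s t
  assume "s \<in> carrier (tensor K D D) \<and>
      (\<forall>x\<in>carrier A. \<forall>y\<in>carrier A. tensor_eval K D D (\<lambda>g. g x) (\<lambda>h. h y) s = f (x \<otimes> y))"
    and "t \<in> carrier (tensor K D D) \<and>
      (\<forall>x\<in>carrier A. \<forall>y\<in>carrier A. tensor_eval K D D (\<lambda>g. g x) (\<lambda>h. h y) t = f (x \<otimes> y))"
  then show "s = t"
    using dual_basisD(2)[OF dual_basis]
    by (intro tensor_eval_eqI2[OF vectorspace_D vectorspace_D dual_basis_D dual_basis_D]) auto
next
  note d = dual_basisD[OF dual_basis]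
  note S = vectorspace_scalar[OF vectorspace_A]
  interpret T: vectorspace K "tensor K D D" by (rule vectorspace_tensor[OF vectorspace_D vectorspace_D])
  define l where "l i = (\<lambda>x\<in>carrier A. f (x \<otimes> e i))" for i
  have lD: "l i \<in> carrier D" if "i \<in> I" for i
    unfolding dual_coalgebra_simps l_def
  proof (rule restrict_dual_space[OF vectorspace_A module_hom_compose[OF _ D_hom[OF f]]])
    show "(\<lambda>x. x \<otimes> e i) \<in> module_hom K A A"
      using d(2)[OF that] by (intro module_homI) (auto simp: l_distr smult_mult_left)
  qed
  have rD: "restrict (\<phi> i) (carrier A) \<in> carrier D" if "i \<in> I" for i
    using restrict_dual_space[OF vectorspace_A d(3)[OF that]] by (simp add: dual_coalgebra_simps)
  let ?t = "\<Oplus>\<^bsub>tensor K D D\<^esub>i\<in>I. pure_tensor K D D (l i) (restrict (\<phi> i) (carrier A))"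
  have p: "pure_tensor K D D (l i) (restrict (\<phi> i) (carrier A)) \<in> carrier (tensor K D D)" if "i \<in> I" for i
    by (intro pure_tensor_closed vectorspace_D lD rD that)
  show "\<exists>t. t \<in> carrier (tensor K D D) \<and>
    (\<forall>x\<in>carrier A. \<forall>y\<in>carrier A. tensor_eval K D D (\<lambda>g. g x) (\<lambda>h. h y) t = f (x \<otimes> y))"
  proof (intro exI[of _ ?t] conjI ballI)
    show "?t \<in> carrier (tensor K D D)" using p by (intro T.finsum_closed) auto
    fix x y assume x: "x \<in> carrier A" and y: "y \<in> carrier A"
    note ev = dual_coalgebra_eval_hom[OF x] dual_coalgebra_eval_hom[OF y]
    interpret S: vectorspace K "scalar_module K" by (rule S)
    have xc: "(\<lambda>y. x \<otimes> y) \<in> module_hom K A A"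
      using x by (intro module_homI) (auto simp: r_distr smult_mult_right)
    note fx = module_hom_compose[OF xc D_hom[OF f]]
    have "tensor_eval K D D (\<lambda>g. g x) (\<lambda>h. h y) ?t =
      (\<Oplus>\<^bsub>scalar_module K\<^esub>i\<in>I. tensor_eval K D D (\<lambda>g. g x) (\<lambda>h. h y)
        (pure_tensor K D D (l i) (restrict (\<phi> i) (carrier A))))"
      by (rule module_hom_finsum[OF T.vectorspace_axioms S
            tensor_eval_hom[OF vectorspace_D vectorspace_D ev] d(1) p])
    also have "\<dots> = (\<Oplus>\<^bsub>scalar_module K\<^esub>i\<in>I. f (x \<otimes> (\<phi> i y \<odot> e i)))"
      using x y lD rD d(2,4) D_value[OF f]
      by (intro S.finsum_cong') (auto simp: tensor_eval_pure[OF vectorspace_D vectorspace_D ev] l_def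
        smult_mult_right module_hom_smult[OF D_hom[OF f]] R.m_comm)
    also have "\<dots> = f (x \<otimes> (\<Oplus>i\<in>I. \<phi> i y \<odot> e i))"
      using d(2,4) y by (intro module_hom_finsum[OF vectorspace_A S fx d(1), symmetric]) auto
    also have "\<dots> = f (x \<otimes> y)" using d(5)[OF y] by simp
    finally show "tensor_eval K D D (\<lambda>g. g x) (\<lambda>h. h y) ?t = f (x \<otimes> y)" .
  qed
qed

lemma comult_D:
  assumes f: "f \<in> carrier D"
  shows "comult D f \<in> carrier (tensor K D D)"
    and "\<lbrakk>x \<in> carrier A; y \<in> carrier A\<rbrakk> \<Longrightarrow>
      tensor_eval K D D (\<lambda>g. g x) (\<lambda>h. h y) (comult D f) = f (x \<otimes> y)"
proof -
  have T: "tensor K (dual_space K A) (dual_space K A) = tensor K D D"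
    "tensor_lift K (dual_space K A) (dual_space K A) = tensor_lift K D D"
    by (rule tensor_cong; simp add: dual_coalgebra_simps)+
  have "comult D f = (THE t. t \<in> carrier (tensor K D D) \<and>
    (\<forall>x\<in>carrier A. \<forall>y\<in>carrier A. tensor_eval K D D (\<lambda>g. g x) (\<lambda>h. h y) t = f (x \<otimes> y)))"
    unfolding T[symmetric] by (simp add: dual_coalgebra_def Let_def)
  then have *: "comult D f \<in> carrier (tensor K D D) \<and> (\<forall>x\<in>carrier A. \<forall>y\<in>carrier A.
      tensor_eval K D D (\<lambda>g. g x) (\<lambda>h. h y) (comult D f) = f (x \<otimes> y))"
    using theI'[OF ex1_comult[OF f]] by simp
  show "comult D f \<in> carrier (tensor K D D)"
    and "\<lbrakk>x \<in> carrier A; y \<in> carrier A\<rbrakk> \<Longrightarrow>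
      tensor_eval K D D (\<lambda>g. g x) (\<lambda>h. h y) (comult D f) = f (x \<otimes> y)"
    using * by auto
qed

text \<open>A tensor over \<open>D\<close> is determined by its evaluations at pairs of the
  \<open>e i\<close>, and for the comultiplication these are values of \<open>f\<close> at products,
  which are linear in \<open>f\<close>.\<close>

lemma comult_D_hom: "comult D \<in> module_hom K D (tensor K D D)"
proof (rule module_homI)
  interpret T: vectorspace K "tensor K D D" by (rule vectorspace_tensor[OF vectorspace_D vectorspace_D])
  note eqI = tensor_eval_eqI2[OF vectorspace_D vectorspace_D dual_basis_D dual_basis_D]
  note e = dual_basisD(2)[OF dual_basis]
  note ev = tensor_eval_hom[OF vectorspace_D vectorspace_D
      dual_coalgebra_eval_hom[OF e] dual_coalgebra_eval_hom[OF e]]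
  show "comult D f \<in> carrier (tensor K D D)" if "f \<in> carrier D" for f by (rule comult_D[OF that])
  show "comult D (f \<oplus>\<^bsub>D\<^esub> g) = comult D f \<oplus>\<^bsub>tensor K D D\<^esub> comult D g"
    if fg: "f \<in> carrier D" "g \<in> carrier D" for f g
  proof (rule eqI)
    fix i k assume ik: "i \<in> I" "k \<in> I"
    have "(f \<oplus>\<^bsub>D\<^esub> g) (e i \<otimes> e k) = f (e i \<otimes> e k) \<oplus>\<^bsub>K\<^esub> g (e i \<otimes> e k)"
      using e[OF ik(1)] e[OF ik(2)] by (simp add: dual_coalgebra_simps dual_space_simps)
    then show "tensor_eval K D D (\<lambda>g. g (e i)) (\<lambda>h. h (e k)) (comult D (f \<oplus>\<^bsub>D\<^esub> g)) =
        tensor_eval K D D (\<lambda>g. g (e i)) (\<lambda>h. h (e k)) (comult D f \<oplus>\<^bsub>tensor K D D\<^esub> comult D g)"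
      using ik fg D.M.a_closed[OF fg] by (simp add: module_hom_add[OF ev] comult_D e)
  qed (use fg comult_D(1) in auto)
  show "comult D (a \<odot>\<^bsub>D\<^esub> f) = a \<odot>\<^bsub>tensor K D D\<^esub> comult D f" if af: "a \<in> carrier K" "f \<in> carrier D" for a f
  proof (rule eqI)
    fix i k assume ik: "i \<in> I" "k \<in> I"
    have "(a \<odot>\<^bsub>D\<^esub> f) (e i \<otimes> e k) = a \<otimes>\<^bsub>K\<^esub> f (e i \<otimes> e k)"
      using e[OF ik(1)] e[OF ik(2)] by (simp add: dual_coalgebra_simps dual_space_simps)
    then show "tensor_eval K D D (\<lambda>g. g (e i)) (\<lambda>h. h (e k)) (comult D (a \<odot>\<^bsub>D\<^esub> f)) =
        tensor_eval K D D (\<lambda>g. g (e i)) (\<lambda>h. h (e k)) (a \<odot>\<^bsub>tensor K D D\<^esub> comult D f)"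
      using ik af D.smult_closed[OF af] by (simp add: module_hom_smult[OF ev] comult_D e)
  qed (use af comult_D(1) in auto)
qed

lemma counit_D_hom: "counit D \<in> dual_hom K D"
  using dual_coalgebra_eval_hom[OF one_closed, of K] by (simp add: dual_coalgebra_simps(5)[abs_def])

text \<open>Evaluated at points of \<open>A\<close>, coassociativity is associativity of the
  product, and the left and right counit laws are 1 x = x and x 1 = x. The points \<open>e i\<close>
  suffice.\<close>

theorem coalgebra_D: "coalgebra K D"
proof (rule coalgebra.intro[OF vectorspace_D coalgebra_axioms.intro])
  note e = dual_basisD(2)[OF dual_basis]
  show "comult D \<in> module_hom K D (tensor K D D)" by (rule comult_D_hom)
  show "counit D \<in> module_hom K D (scalar_module K)" by (rule counit_D_hom)
  fix f assume f: "f \<in> carrier D"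
  show "tensor_assoc K D D D (tensor_map K D D (tensor K D D) D (comult D) (\<lambda>x. x) (comult D f)) =
      tensor_map K D D D (tensor K D D) (\<lambda>x. x) (comult D) (comult D f)"
    by (rule coassoc_by_functionals[where X = "carrier A" and Y = "carrier A" and p = e and q = e
          and act = "(\<otimes>)" and mul = "(\<otimes>)", OF vectorspace_D vectorspace_D comult_D_hom comult_D_hom
            dual_coalgebra_eval_hom dual_coalgebra_eval_hom dual_basis_D _ dual_basis_D])
      (use e f comult_D in \<open>auto simp: m_assoc\<close>)
  show "tensor_lift K D D D (\<lambda>x y. counit D x \<odot>\<^bsub>D\<^esub> y) (comult D f) = f"
  proof (rule dual_basis_eqI[OF vectorspace_D dual_basis_D])
    show "tensor_lift K D D D (\<lambda>x y. counit D x \<odot>\<^bsub>D\<^esub> y) (comult D f) \<in> carrier D"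
      by (intro tensor_lift_closed bilinear_smult_left vectorspace_D counit_D_hom comult_D f)
    fix i assume i: "i \<in> I"
    have "(\<lambda>g. g (e i)) (tensor_lift K D D D (\<lambda>x y. counit D x \<odot>\<^bsub>D\<^esub> y) (comult D f)) =
        tensor_eval K D D (counit D) (\<lambda>g. g (e i)) (comult D f)"
      by (intro tensor_slice_left vectorspace_D counit_D_hom dual_coalgebra_eval_hom e i comult_D f)
    also have "\<dots> = f (e i)"
      using comult_D(2)[OF f one_closed e[OF i]] e[OF i] by (simp add: dual_coalgebra_simps(5))
    finally show "tensor_lift K D D D (\<lambda>x y. counit D x \<odot>\<^bsub>D\<^esub> y) (comult D f) (e i) = f (e i)" .
  qed (rule f)
  show "tensor_lift K D D D (\<lambda>x y. counit D y \<odot>\<^bsub>D\<^esub> x) (comult D f) = f"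
  proof (rule dual_basis_eqI[OF vectorspace_D dual_basis_D])
    show "tensor_lift K D D D (\<lambda>x y. counit D y \<odot>\<^bsub>D\<^esub> x) (comult D f) \<in> carrier D"
      by (intro tensor_lift_closed bilinear_smult_right vectorspace_D counit_D_hom comult_D f)
    fix i assume i: "i \<in> I"
    have "(\<lambda>g. g (e i)) (tensor_lift K D D D (\<lambda>x y. counit D y \<odot>\<^bsub>D\<^esub> x) (comult D f)) =
        tensor_eval K D D (\<lambda>g. g (e i)) (counit D) (comult D f)"
      by (intro tensor_slice_right vectorspace_D counit_D_hom dual_coalgebra_eval_hom e i comult_D f)
    also have "\<dots> = f (e i)"
      using comult_D(2)[OF f e[OF i] one_closed] e[OF i] by (simp add: dual_coalgebra_simps(5))
    finally show "tensor_lift K D D D (\<lambda>x y. counit D y \<odot>\<^bsub>D\<^esub> x) (comult D f) (e i) = f (e i)" .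
  qed (rule f)
qed

end

section \<open>The dual algebra of a coalgebra\<close>

lemma dual_algebra_simps:
  "carrier (dual_algebra K C) = carrier (dual_space K C)"
  "\<zero>\<^bsub>dual_algebra K C\<^esub> = \<zero>\<^bsub>dual_space K C\<^esub>"
  "f \<oplus>\<^bsub>dual_algebra K C\<^esub> g = f \<oplus>\<^bsub>dual_space K C\<^esub> g"
  "a \<odot>\<^bsub>dual_algebra K C\<^esub> f = a \<odot>\<^bsub>dual_space K C\<^esub> f"
  "f \<otimes>\<^bsub>dual_algebra K C\<^esub> g = (\<lambda>c\<in>carrier C. tensor_eval K C C f g (comult C c))"
  "\<one>\<^bsub>dual_algebra K C\<^esub> = (\<lambda>c\<in>carrier C. counit C c)"
  by (simp_all add: dual_algebra_def dual_space_def)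

lemma vectorspace_dual_algebra: "vectorspace K C \<Longrightarrow> vectorspace K (dual_algebra K C)"
  by (rule vectorspace_cong[OF vectorspace_dual_space]) (auto simp: dual_algebra_simps)

lemma dual_basis_dual_algebra:
  "\<lbrakk>vectorspace K C; dual_basis K C I e \<phi>\<rbrakk> \<Longrightarrow>
    dual_basis K (dual_algebra K C) I (\<lambda>i. restrict (\<phi> i) (carrier C)) (\<lambda>i f. f (e i))"
  by (rule dual_basis_cong[OF dual_basis_dual_space vectorspace_dual_space]) (auto simp: dual_algebra_simps)

lemma dual_algebra_eval_hom: "c \<in> carrier C \<Longrightarrow> (\<lambda>f. f c) \<in> dual_hom K (dual_algebra K C)"
  by (subst module_hom_cong_domain[where V' = "dual_space K C"]) (simp_all add: dual_algebra_simps eval_hom)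

text \<open>Given the ring structure, what remains is that scalars pass through convolution. The
  ring structure is a premise here; it will come with the hypothesis on the quotient ring, which
  speaks of right modules over the dual algebra.\<close>

lemma assoc_algebra_dual_algebra:
  assumes "coalgebra K C" "ring (dual_algebra K C)"
  shows "assoc_algebra K (dual_algebra K C)"
proof (intro assoc_algebra.intro vectorspace_dual_algebra assoc_algebra_axioms.intro)
  interpret C: coalgebra K C by fact
  let ?R = "dual_algebra K C"
  interpret R: ring ?R by fact
  interpret RV: vectorspace K ?R by (rule vectorspace_dual_algebra) (rule C.vectorspace_axioms)
  note vs = C.vectorspace_axioms
  have hom: "f \<in> dual_hom K C" if "f \<in> carrier ?R" for f
    using that by (simp add: dual_algebra_simps dual_space_simps)
  have eq: "f = g" if "f \<in> carrier ?R" "g \<in> carrier ?R" "\<And>c. c \<in> carrier C \<Longrightarrow> f c = g c" for f g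
    using that by (intro dual_space_eqI) (auto simp: dual_algebra_simps)
  have val: "f c \<in> carrier K" if "f \<in> carrier ?R" "c \<in> carrier C" for f c
    using module_hom_mem[OF hom[OF that(1)] that(2)] by simp
  show "vectorspace K C" "ring ?R" by (fact vs assms)+
  \<comment> \<open>The bilinear map \<open>b\<close> is left open so that one statement covers a
    scalar attached to either factor.\<close>
  have pull: "tensor_lift K C C (scalar_module K) b (comult C c) =
      a \<otimes>\<^bsub>K\<^esub> tensor_eval K C C f g (comult C c)"
    if "a \<in> carrier K" "f \<in> carrier ?R" "g \<in> carrier ?R" "c \<in> carrier C"
      and b: "\<And>x y. x \<in> carrier C \<Longrightarrow> y \<in> carrier C \<Longrightarrow> b x y = a \<otimes>\<^bsub>K\<^esub> (f x \<otimes>\<^bsub>K\<^esub> g y)" for a f g c b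
  proof -
    note S = vectorspace_scalar[OF vs]
    note bil = bilinear_mult[OF vs vs hom[OF that(2)] hom[OF that(3)]]
    have "bilinear_map K C C (scalar_module K) (\<lambda>x y. a \<odot>\<^bsub>scalar_module K\<^esub> (f x \<otimes>\<^bsub>K\<^esub> g y))"
      by (intro bilinear_mapI module_hom_smult_right[OF vs S _ that(1)] bilinear_mapD[OF bil])
    then have "a \<odot>\<^bsub>scalar_module K\<^esub> tensor_eval K C C f g (comult C c) =
        tensor_lift K C C (scalar_module K) (\<lambda>x y. a \<otimes>\<^bsub>K\<^esub> (f x \<otimes>\<^bsub>K\<^esub> g y)) (comult C c)"
      using module_hom_mem[OF C.comult_hom that(4)]
      by (intro tensor_eval_lift[OF vs vs S bil module_hom_smult_right[OF S S module_hom_id that(1)] S]) auto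
    also have "\<dots> = tensor_lift K C C (scalar_module K) b (comult C c)"
      by (rule fun_cong[OF tensor_lift_cong]) (simp add: b)
    finally show ?thesis by simp
  qed
  fix a f g assume afg: "a \<in> carrier K" "f \<in> carrier ?R" "g \<in> carrier ?R"
  show "(a \<odot>\<^bsub>?R\<^esub> f) \<otimes>\<^bsub>?R\<^esub> g = a \<odot>\<^bsub>?R\<^esub> (f \<otimes>\<^bsub>?R\<^esub> g)"
  proof (rule eq)
    fix c assume c: "c \<in> carrier C"
    then show "((a \<odot>\<^bsub>?R\<^esub> f) \<otimes>\<^bsub>?R\<^esub> g) c = (a \<odot>\<^bsub>?R\<^esub> (f \<otimes>\<^bsub>?R\<^esub> g)) c"
      using afg val
      by (simp add: dual_algebra_simps(4,5) dual_space_simps(4) pull[of a f g c] C.R.m_assoc)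
  qed (use afg in auto)
  show "f \<otimes>\<^bsub>?R\<^esub> (a \<odot>\<^bsub>?R\<^esub> g) = a \<odot>\<^bsub>?R\<^esub> (f \<otimes>\<^bsub>?R\<^esub> g)"
  proof (rule eq)
    fix c assume c: "c \<in> carrier C"
    then show "(f \<otimes>\<^bsub>?R\<^esub> (a \<odot>\<^bsub>?R\<^esub> g)) c = (a \<odot>\<^bsub>?R\<^esub> (f \<otimes>\<^bsub>?R\<^esub> g)) c"
      using afg val
      by (simp add: dual_algebra_simps(4,5) dual_space_simps(4) pull[of a f g c] C.R.m_lcomm)
  qed (use afg in auto)
qed

section \<open>The maximal right ring of quotients of an algebra\<close>

locale algebra_with_quotient_ring = R: assoc_algebra K R
  for K :: "('k, 'm) ring_scheme" and R :: "('k, 'r, 'n) module_scheme" +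
  fixes E :: "('r, 'e, 'p) module_scheme" and j :: "'r \<Rightarrow> 'e" and Q :: "('e, 'q) ring_scheme"
  assumes max_quotient: "max_right_quotient_ring R E j Q"
begin

abbreviation "A \<equiv> overring_with_scalars R j Q"

lemma A_simps:
  "carrier A = carrier Q" "\<zero>\<^bsub>A\<^esub> = \<zero>\<^bsub>Q\<^esub>" "\<one>\<^bsub>A\<^esub> = \<one>\<^bsub>Q\<^esub>" "x \<oplus>\<^bsub>A\<^esub> y = x \<oplus>\<^bsub>Q\<^esub> y"
  "x \<otimes>\<^bsub>A\<^esub> y = x \<otimes>\<^bsub>Q\<^esub> y" "a \<odot>\<^bsub>A\<^esub> x = x \<otimes>\<^bsub>Q\<^esub> j (a \<odot>\<^bsub>R\<^esub> \<one>\<^bsub>R\<^esub>)"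
  by (simp_all add: overring_with_scalars_def)

lemma hull: "injective_hull R E j" and Q_ring: "ring Q"
  and Q_carrier: "carrier Q = {x \<in> carrier E. \<forall>f \<in> module_hom R E E.
      (\<forall>r\<in>carrier R. f (j r) = \<zero>\<^bsub>E\<^esub>) \<longrightarrow> f x = \<zero>\<^bsub>E\<^esub>}"
  and Q_add: "\<lbrakk>x \<in> carrier Q; y \<in> carrier Q\<rbrakk> \<Longrightarrow> x \<oplus>\<^bsub>Q\<^esub> y = x \<oplus>\<^bsub>E\<^esub> y"
  and Q_one: "\<one>\<^bsub>Q\<^esub> = j \<one>\<^bsub>R\<^esub>"
  and Q_act: "\<lbrakk>x \<in> carrier Q; r \<in> carrier R\<rbrakk> \<Longrightarrow> x \<otimes>\<^bsub>Q\<^esub> j r = r \<odot>\<^bsub>E\<^esub> x"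
  using max_quotient by (auto simp: max_right_quotient_ring_def)

lemma injective: "injective_right_module R E"
  and j_hom: "j \<in> module_hom R (regular_right_module R) E" and j_inj: "inj_on j (carrier R)"
  and j_essential: "\<lbrakk>right_submodule R E N; N \<noteq> {\<zero>\<^bsub>E\<^esub>}\<rbrakk> \<Longrightarrow> N \<inter> j ` carrier R \<noteq> {\<zero>\<^bsub>E\<^esub>}"
  using hull by (auto simp: injective_hull_def)

lemma right_module_E: "right_module R E"
  using injective by (auto simp: injective_right_module_def)

sublocale Q: ring Q by (rule Q_ring)
sublocale E: right_module R E by (rule right_module_E)

lemma Q_subset: "x \<in> carrier Q \<Longrightarrow> x \<in> carrier E"
  by (simp add: Q_carrier)

lemma j_closed_E: "r \<in> carrier R \<Longrightarrow> j r \<in> carrier E"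
  using module_hom_mem[OF j_hom] by (simp add: regular_right_module_def)

lemma j_closed [simp, intro]: "r \<in> carrier R \<Longrightarrow> j r \<in> carrier Q"
  using j_closed_E by (auto simp: Q_carrier)

lemma j_add: "\<lbrakk>r \<in> carrier R; s \<in> carrier R\<rbrakk> \<Longrightarrow> j (r \<oplus>\<^bsub>R\<^esub> s) = j r \<oplus>\<^bsub>Q\<^esub> j s"
  using module_hom_add[OF j_hom] by (simp add: regular_right_module_def Q_add)

lemma j_mult: "\<lbrakk>r \<in> carrier R; s \<in> carrier R\<rbrakk> \<Longrightarrow> j (r \<otimes>\<^bsub>R\<^esub> s) = j r \<otimes>\<^bsub>Q\<^esub> j s"
  using module_hom_smult[OF j_hom, of s r] by (simp add: regular_right_module_def Q_act)

text \<open>Sums in \<open>Q\<close> are known to be sums in \<open>E\<close>, and zero is the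
  element equal to its own double.\<close>

lemma Q_zero: "\<zero>\<^bsub>Q\<^esub> = \<zero>\<^bsub>E\<^esub>"
proof -
  have "\<zero>\<^bsub>Q\<^esub> \<oplus>\<^bsub>E\<^esub> \<zero>\<^bsub>Q\<^esub> = \<zero>\<^bsub>Q\<^esub>" using Q_add[of "\<zero>\<^bsub>Q\<^esub>" "\<zero>\<^bsub>Q\<^esub>"] by simp
  then show ?thesis using Q_subset[OF Q.zero_closed] by (simp add: E.E.add.l_cancel_one')
qed

lemma j_zero: "j \<zero>\<^bsub>R\<^esub> = \<zero>\<^bsub>Q\<^esub>"
  using j_add[of "\<zero>\<^bsub>R\<^esub>" "\<zero>\<^bsub>R\<^esub>"] by (simp add: Q.add.l_cancel_one')

text \<open>
  Left multiplication by \<open>j c\<close> and the right action of a central \<open>c\<close> are two right linear maps on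
  \<open>Q\<close> that agree on \<open>R\<close>; extended to \<open>E\<close> by injectivity, their difference kills \<open>Q\<close>.
\<close>

lemma j_central:
  assumes c: "c \<in> carrier R" "\<And>r. r \<in> carrier R \<Longrightarrow> c \<otimes>\<^bsub>R\<^esub> r = r \<otimes>\<^bsub>R\<^esub> c" and y: "y \<in> carrier Q"
  shows "j c \<otimes>\<^bsub>Q\<^esub> y = y \<otimes>\<^bsub>Q\<^esub> j c"
proof -
  \<comment> \<open>Injectivity of \<open>E\<close> is formulated for test modules on the type
    \<open>'r + 'e\<close>; \<open>M S\<close> is the copy of a submodule \<open>S\<close> of
    \<open>E\<close> in the right summand.\<close>
  define M :: "'e set \<Rightarrow> ('r, 'r + 'e) module" where
    "M S = \<lparr>carrier = Inr ` S, mult = (\<lambda>x y. x), one = Inr \<zero>\<^bsub>E\<^esub>, zero = Inr \<zero>\<^bsub>E\<^esub>,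
       add = (\<lambda>x y. Inr (projr x \<oplus>\<^bsub>E\<^esub> projr y)), smult = (\<lambda>r x. Inr (r \<odot>\<^bsub>E\<^esub> projr x))\<rparr>" for S
  have M: "right_module R (M S)"
    if S: "S \<subseteq> carrier E" "\<zero>\<^bsub>E\<^esub> \<in> S" "\<And>x y. x \<in> S \<Longrightarrow> y \<in> S \<Longrightarrow> x \<oplus>\<^bsub>E\<^esub> y \<in> S"
      "\<And>x. x \<in> S \<Longrightarrow> \<ominus>\<^bsub>E\<^esub> x \<in> S" "\<And>r x. r \<in> carrier R \<Longrightarrow> x \<in> S \<Longrightarrow> r \<odot>\<^bsub>E\<^esub> x \<in> S" for S
  proof -
    have "abelian_group (M S)"
    proof (rule abelian_groupI)
      fix x assume "x \<in> carrier (M S)"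
      then obtain u where u: "u \<in> S" "x = Inr u" by (auto simp: M_def)
      show "\<exists>y\<in>carrier (M S). y \<oplus>\<^bsub>M S\<^esub> x = \<zero>\<^bsub>M S\<^esub>"
        using u S(1,4) by (intro bexI[of _ "Inr (\<ominus>\<^bsub>E\<^esub> u)"]) (auto simp: M_def E.E.l_neg subset_iff)
    qed (use S(1-3) in \<open>auto simp: M_def E.E.a_ac subset_iff\<close>)
    then show ?thesis
      by (intro right_module.intro right_module_axioms.intro R.ring_axioms)
        (use S in \<open>auto simp: M_def E.act_add_left E.act_add_right E.act_assoc E.act_one subset_iff\<close>)
  qed
  have Q_act_closed: "r \<odot>\<^bsub>E\<^esub> x \<in> carrier Q" if "r \<in> carrier R" "x \<in> carrier Q" for r x
    using Q_act[OF that(2,1)] that by (metis Q.m_closed j_closed)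
  have Q_neg: "\<ominus>\<^bsub>E\<^esub> x \<in> carrier Q" if "x \<in> carrier Q" for x
  proof -
    have "\<ominus>\<^bsub>Q\<^esub> x \<oplus>\<^bsub>E\<^esub> x = \<zero>\<^bsub>E\<^esub>"
      using that Q_add[of "\<ominus>\<^bsub>Q\<^esub> x" x] by (simp add: Q.l_neg Q_zero)
    then have "\<ominus>\<^bsub>E\<^esub> x = \<ominus>\<^bsub>Q\<^esub> x"
      using that Q_subset by (intro E.E.minus_equality) auto
    then show ?thesis using that by simp
  qed
  have MQ: "right_module R (M (carrier Q))"
    using Q_add Q_act_closed Q_neg Q_subset Q_zero Q.zero_closed
    by (intro M) (auto simp flip: Q_add)
  have ME: "right_module R (M (carrier E))" by (intro M) (auto simp: E.act_closed)
  \<comment> \<open>Left multiplication by \<open>j c\<close> on the copy of \<open>Q\<close>; by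
    associativity it commutes with the right action of \<open>R\<close>.\<close>
  let ?f = "\<lambda>x. j c \<otimes>\<^bsub>Q\<^esub> projr x"
  have f: "?f \<in> module_hom R (M (carrier Q)) E"
  proof (rule module_homI)
    show "?f x \<in> carrier E" if "x \<in> carrier (M (carrier Q))" for x
      using that c by (auto simp: M_def intro: Q_subset)
    show "?f (x \<oplus>\<^bsub>M (carrier Q)\<^esub> z) = ?f x \<oplus>\<^bsub>E\<^esub> ?f z"
      if "x \<in> carrier (M (carrier Q))" "z \<in> carrier (M (carrier Q))" for x z
      using that c by (auto simp: M_def Q.r_distr simp flip: Q_add)
    show "?f (r \<odot>\<^bsub>M (carrier Q)\<^esub> x) = r \<odot>\<^bsub>E\<^esub> ?f x" if "r \<in> carrier R" "x \<in> carrier (M (carrier Q))" for r x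
      using that c by (auto simp: M_def Q.m_assoc simp flip: Q_act)
  qed
  have i: "(\<lambda>x. x) \<in> module_hom R (M (carrier Q)) (M (carrier E))"
    by (rule module_homI) (auto simp: M_def Q_subset)
  have "\<exists>g \<in> module_hom R (M (carrier E)) E. \<forall>x\<in>carrier (M (carrier Q)). g x = ?f x"
    using injective MQ ME i f unfolding injective_right_module_def by (metis inj_on_id2)
  then obtain g where g: "g \<in> module_hom R (M (carrier E)) E"
    and gf: "\<And>x. x \<in> carrier (M (carrier Q)) \<Longrightarrow> g x = ?f x"
    by blast
  define k where "k x = g (Inr x) \<ominus>\<^bsub>E\<^esub> c \<odot>\<^bsub>E\<^esub> x" for x
  have gc: "g (Inr x) \<in> carrier E" if "x \<in> carrier E" for x
    using module_hom_mem[OF g] that by (simp add: M_def)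
  have gadd: "g (Inr (x \<oplus>\<^bsub>E\<^esub> z)) = g (Inr x) \<oplus>\<^bsub>E\<^esub> g (Inr z)" if "x \<in> carrier E" "z \<in> carrier E" for x z
    using module_hom_add[OF g, of "Inr x" "Inr z"] that by (simp add: M_def)
  have gact: "g (Inr (r \<odot>\<^bsub>E\<^esub> x)) = r \<odot>\<^bsub>E\<^esub> g (Inr x)" if "r \<in> carrier R" "x \<in> carrier E" for r x
    using module_hom_smult[OF g, of r "Inr x"] that by (simp add: M_def)
  have act_neg: "r \<odot>\<^bsub>E\<^esub> (\<ominus>\<^bsub>E\<^esub> x) = \<ominus>\<^bsub>E\<^esub> (r \<odot>\<^bsub>E\<^esub> x)" if "r \<in> carrier R" "x \<in> carrier E" for r x
  proof -
    have "r \<odot>\<^bsub>E\<^esub> \<zero>\<^bsub>E\<^esub> \<oplus>\<^bsub>E\<^esub> r \<odot>\<^bsub>E\<^esub> \<zero>\<^bsub>E\<^esub> = r \<odot>\<^bsub>E\<^esub> \<zero>\<^bsub>E\<^esub>"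
      using that E.act_add_right[of r "\<zero>\<^bsub>E\<^esub>" "\<zero>\<^bsub>E\<^esub>"] by simp
    then have "r \<odot>\<^bsub>E\<^esub> \<zero>\<^bsub>E\<^esub> = \<zero>\<^bsub>E\<^esub>" using that by (simp add: E.E.add.l_cancel_one' E.act_closed)
    then show ?thesis
      using that E.act_add_right[of r "\<ominus>\<^bsub>E\<^esub> x" x]
      by (intro E.E.minus_equality[symmetric]) (auto simp: E.E.l_neg E.act_closed)
  qed
  have "k \<in> module_hom R E E"
  proof (rule module_homI)
    show "k x \<in> carrier E" if "x \<in> carrier E" for x
      using that gc c by (simp add: k_def E.act_closed)
    show "k (x \<oplus>\<^bsub>E\<^esub> z) = k x \<oplus>\<^bsub>E\<^esub> k z" if "x \<in> carrier E" "z \<in> carrier E" for x z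
      using that gc c
      by (simp add: k_def gadd E.act_add_right E.act_closed a_minus_def E.E.minus_add E.E.a_ac)
    show "k (r \<odot>\<^bsub>E\<^esub> x) = r \<odot>\<^bsub>E\<^esub> k x" if "r \<in> carrier R" "x \<in> carrier E" for r x
    proof -
      \<comment> \<open>Acting by \<open>c\<close> is an endomorphism of the right module because
        \<open>c\<close> is central in \<open>R\<close>.\<close>
      have "c \<odot>\<^bsub>E\<^esub> (r \<odot>\<^bsub>E\<^esub> x) = r \<odot>\<^bsub>E\<^esub> (c \<odot>\<^bsub>E\<^esub> x)"
        using that c by (simp flip: E.act_assoc)
      then show ?thesis
        using that gc c
        by (simp add: k_def gact E.act_add_right E.act_closed a_minus_def act_neg)
    qed
  qed
  moreover have "k (j r) = \<zero>\<^bsub>E\<^esub>" if r: "r \<in> carrier R" for r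
  proof -
    have "g (Inr (j r)) = j c \<otimes>\<^bsub>Q\<^esub> j r" using r gf[of "Inr (j r)"] by (simp add: M_def)
    also have "\<dots> = j (r \<otimes>\<^bsub>R\<^esub> c)" using r c by (simp flip: j_mult)
    also have "\<dots> = c \<odot>\<^bsub>E\<^esub> j r" using r c by (simp add: j_mult Q_act)
    finally show ?thesis using r c j_closed_E by (simp add: k_def a_minus_def E.E.r_neg E.act_closed)
  qed
  \<comment> \<open>By definition \<open>Q\<close> consists of the points killed by every
    endomorphism of \<open>E\<close> that vanishes on the image of \<open>R\<close>.\<close>
  ultimately have "k y = \<zero>\<^bsub>E\<^esub>" using y by (auto simp: Q_carrier)
  moreover have "g (Inr y) = j c \<otimes>\<^bsub>Q\<^esub> y" using y gf[of "Inr y"] by (simp add: M_def)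
  ultimately have "j c \<otimes>\<^bsub>Q\<^esub> y \<ominus>\<^bsub>E\<^esub> c \<odot>\<^bsub>E\<^esub> y = \<zero>\<^bsub>E\<^esub>" by (simp add: k_def)
  then have "j c \<otimes>\<^bsub>Q\<^esub> y = c \<odot>\<^bsub>E\<^esub> y"
    using y c Q_subset by (simp add: E.act_closed)
  then show ?thesis using y c by (simp add: Q_act)
qed

section \<open>The quotient ring as an algebra over the ground field\<close>

lemma scalar_central:
  "\<lbrakk>a \<in> carrier K; y \<in> carrier Q\<rbrakk> \<Longrightarrow> j (a \<odot>\<^bsub>R\<^esub> \<one>\<^bsub>R\<^esub>) \<otimes>\<^bsub>Q\<^esub> y = y \<otimes>\<^bsub>Q\<^esub> j (a \<odot>\<^bsub>R\<^esub> \<one>\<^bsub>R\<^esub>)"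
  by (intro j_central) (auto simp: R.smult_mult_left R.smult_mult_right)

lemma vectorspace_A: "vectorspace K A"
proof (rule vs_criteria, goal_cases)
  case 4
  show ?case by (auto simp: A_simps intro: bexI[of _ "\<ominus>\<^bsub>Q\<^esub> _"] Q.r_neg)
next
  case 9
  \<comment> \<open>Scalars act by multiplication from the right, so their product appears in
    reversed order; this is harmless because multiples of 1 commute in \<open>R\<close>.\<close>
  have "j ((a \<otimes>\<^bsub>K\<^esub> b) \<odot>\<^bsub>R\<^esub> \<one>\<^bsub>R\<^esub>) = j (b \<odot>\<^bsub>R\<^esub> \<one>\<^bsub>R\<^esub>) \<otimes>\<^bsub>Q\<^esub> j (a \<odot>\<^bsub>R\<^esub> \<one>\<^bsub>R\<^esub>)"
    if "a \<in> carrier K" "b \<in> carrier K" for a b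
  proof -
    have "(a \<otimes>\<^bsub>K\<^esub> b) \<odot>\<^bsub>R\<^esub> \<one>\<^bsub>R\<^esub> = (b \<odot>\<^bsub>R\<^esub> \<one>\<^bsub>R\<^esub>) \<otimes>\<^bsub>R\<^esub> (a \<odot>\<^bsub>R\<^esub> \<one>\<^bsub>R\<^esub>)"
      using that by (simp add: R.smult_mult_left R.smult_mult_right R.smult_assoc1)
    then show ?thesis using that by (simp add: j_mult)
  qed
  then show ?case by (auto simp: A_simps Q.m_assoc)
qed (auto simp: A_simps Q.a_ac Q.l_distr Q.r_distr j_add R.smult_l_distr Q_one[symmetric] R.field_axioms)

lemma ring_A: "ring A"
proof (rule ringI)
  show "abelian_group A"
    using vectorspace_A by (simp add: vectorspace_def module_def)
  show "monoid A"
    by (rule monoidI) (auto simp: A_simps Q.m_assoc)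
qed (auto simp: A_simps Q.l_distr Q.r_distr)

text \<open>The first law needs centrality in \<open>Q\<close>: in x s y the scalar \<open>s\<close>
  has to be moved past \<open>y\<close>.\<close>

theorem assoc_algebra_A: "assoc_algebra K A"
proof (intro assoc_algebra.intro vectorspace_A ring_A assoc_algebra_axioms.intro)
  fix a x y assume "a \<in> carrier K" "x \<in> carrier A" "y \<in> carrier A"
  then show "(a \<odot>\<^bsub>A\<^esub> x) \<otimes>\<^bsub>A\<^esub> y = a \<odot>\<^bsub>A\<^esub> (x \<otimes>\<^bsub>A\<^esub> y)"
    and "x \<otimes>\<^bsub>A\<^esub> (a \<odot>\<^bsub>A\<^esub> y) = a \<odot>\<^bsub>A\<^esub> (x \<otimes>\<^bsub>A\<^esub> y)"
    by (simp_all add: A_simps Q.m_assoc scalar_central)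
qed

sublocale A: assoc_algebra K A by (rule assoc_algebra_A)

section \<open>Essentiality and finite dimension\<close>

lemma j_linear: "j \<in> module_hom K R A"
proof (rule module_homI)
  fix a r assume ar: "a \<in> carrier K" "r \<in> carrier R"
  have "j (a \<odot>\<^bsub>R\<^esub> r) = j (r \<otimes>\<^bsub>R\<^esub> (a \<odot>\<^bsub>R\<^esub> \<one>\<^bsub>R\<^esub>))"
    using ar by (simp add: R.smult_mult_right)
  then show "j (a \<odot>\<^bsub>R\<^esub> r) = a \<odot>\<^bsub>A\<^esub> j r" using ar by (simp add: A_simps j_mult)
qed (auto simp: A_simps j_add)

text \<open>Sums in \<open>A\<close> and right multiplication by \<open>j r\<close> are those of the
  hull \<open>E\<close>, so such an \<open>N\<close> is a right submodule of \<open>E\<close> and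
  essentiality of \<open>R\<close> in \<open>E\<close> applies.\<close>

lemma A_essential:
  assumes N: "submodule K N A" and act: "\<And>x r. \<lbrakk>x \<in> N; r \<in> carrier R\<rbrakk> \<Longrightarrow> x \<otimes>\<^bsub>A\<^esub> j r \<in> N"
    and int: "\<And>r. \<lbrakk>r \<in> carrier R; j r \<in> N\<rbrakk> \<Longrightarrow> r = \<zero>\<^bsub>R\<^esub>"
  shows "N = {\<zero>\<^bsub>A\<^esub>}"
proof (rule ccontr)
  assume nz: "N \<noteq> {\<zero>\<^bsub>A\<^esub>}"
  interpret N: submodule K N A by (rule N)
  interpret NA: abelian_subgroup N A by (rule submodule_abelian_subgroup[OF N])
  have NQ: "x \<in> carrier Q" if "x \<in> N" for x using N.subset that by (auto simp: A_simps)
  have NE: "x \<in> carrier E" if "x \<in> N" for x using NQ[OF that] by (rule Q_subset)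
  have add: "x \<oplus>\<^bsub>E\<^esub> y = x \<oplus>\<^bsub>A\<^esub> y" if "x \<in> N" "y \<in> N" for x y
    using Q_add NQ that by (simp add: A_simps)
  have "right_submodule R E N"
    unfolding right_submodule_def
  proof (intro conjI ballI additive_subgroup.intro E.E.add.subgroupI)
    show "N \<subseteq> carrier E" using NE by blast
    show "N \<noteq> {}" using N.zero_closed by blast
    show "x \<oplus>\<^bsub>E\<^esub> y \<in> N" if "x \<in> N" "y \<in> N" for x y
      using that by (simp add: add)
    show "\<ominus>\<^bsub>E\<^esub> x \<in> N" if x: "x \<in> N" for x
    proof -
      \<comment> \<open>The negative in \<open>A\<close> is also a negative in \<open>E\<close>, by
        uniqueness of additive inverses there.\<close>
      have m: "\<ominus>\<^bsub>A\<^esub> x \<in> N" using x by simp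
      have "\<ominus>\<^bsub>A\<^esub> x \<oplus>\<^bsub>E\<^esub> x = \<zero>\<^bsub>E\<^esub>"
        using add[OF m x] N.subset x by (simp add: A.l_neg subset_iff A_simps(2) Q_zero)
      then have "\<ominus>\<^bsub>E\<^esub> x = \<ominus>\<^bsub>A\<^esub> x" using NE m x by (intro E.E.minus_equality) auto
      then show ?thesis using m by simp
    qed
    show "r \<odot>\<^bsub>E\<^esub> x \<in> N" if "r \<in> carrier R" "x \<in> N" for r x
      using act[OF that(2,1)] Q_act[OF NQ[OF that(2)] that(1)] by (simp add: A_simps)
  qed
  then have "N \<inter> j ` carrier R \<noteq> {\<zero>\<^bsub>E\<^esub>}"
    using nz by (intro j_essential) (simp_all add: A_simps Q_zero)
  moreover have "\<zero>\<^bsub>E\<^esub> \<in> N \<inter> j ` carrier R"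
    using N.zero_closed j_zero by (auto simp: A_simps Q_zero intro: image_eqI[of _ _ "\<zero>\<^bsub>R\<^esub>"])
  ultimately obtain r where "r \<in> carrier R" "j r \<in> N" "j r \<noteq> \<zero>\<^bsub>E\<^esub>" by blast
  then show False using int j_zero Q_zero by auto
qed

text \<open>
  Extend the coordinate functionals of \<open>R\<close> to functionals \<open>l i\<close> on \<open>A\<close>. The elements \<open>x\<close> with
  \<open>l i (x r) = 0\<close> for all \<open>i\<close> and \<open>r\<close> form a right \<open>R\<close>-submodule meeting \<open>R\<close> trivially, so the
  finitely many functionals \<open>x \<mapsto> l i (x (e k))\<close> separate the points of \<open>A\<close>.
\<close>

theorem fin_dim_A:
  assumes d: "dual_basis K R I e \<phi>"
  shows "vectorspace.fin_dim K A"
proof -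
  note D = dual_basisD[OF d]
  note S = vectorspace_scalar[OF vectorspace_A]
  \<comment> \<open>These extensions are \<open>K\<close>-linear but need not respect the action of
    \<open>R\<close>; the set \<open>N\<close> below quantifies over all \<open>r\<close> to be
    stable under it.\<close>
  have "\<exists>f. f \<in> dual_hom K A \<and> (\<forall>r\<in>carrier R. f (j r) = \<phi> i r)" if "i \<in> I" for i
    using functional_extension[OF R.vectorspace_axioms vectorspace_A j_linear j_inj D(3)[OF that]] by metis
  then obtain l where l: "\<And>i. i \<in> I \<Longrightarrow> l i \<in> dual_hom K A"
    and lj: "\<And>i r. \<lbrakk>i \<in> I; r \<in> carrier R\<rbrakk> \<Longrightarrow> l i (j r) = \<phi> i r"
    by metis
  have jA: "j r \<in> carrier A" if "r \<in> carrier R" for r using module_hom_mem[OF j_linear that] .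
  have right: "(\<lambda>x. x \<otimes>\<^bsub>A\<^esub> y) \<in> module_hom K A A" if "y \<in> carrier A" for y
    using that by (intro module_homI) (auto simp: A.l_distr A.smult_mult_left)
  have left: "(\<lambda>y. x \<otimes>\<^bsub>A\<^esub> y) \<in> module_hom K A A" if "x \<in> carrier A" for x
    using that by (intro module_homI) (auto simp: A.r_distr A.smult_mult_right)
  note lr = module_hom_compose[OF right l]
  let ?\<Phi> = "(\<lambda>(i, k) x. l i (x \<otimes>\<^bsub>A\<^esub> j (e k))) ` (I \<times> I)"
  define N where "N = {x \<in> carrier A. \<forall>i\<in>I. \<forall>r\<in>carrier R. l i (x \<otimes>\<^bsub>A\<^esub> j r) = \<zero>\<^bsub>K\<^esub>}"
  have "N = {\<zero>\<^bsub>A\<^esub>}"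
  proof (rule A_essential)
    show "submodule K N A"
      unfolding submodule_def N_def
      using module_hom_add[OF lr[OF jA]] module_hom_smult[OF lr[OF jA]] module_hom_zero[OF vectorspace_A S lr[OF jA]]
      by (auto intro: A.module_axioms)
    show "x \<otimes>\<^bsub>A\<^esub> j r \<in> N" if "x \<in> N" "r \<in> carrier R" for x r
    proof -
      have "(x \<otimes>\<^bsub>A\<^esub> j r) \<otimes>\<^bsub>A\<^esub> j s = x \<otimes>\<^bsub>A\<^esub> j (r \<otimes>\<^bsub>R\<^esub> s)" if "s \<in> carrier R" for s
        using that \<open>x \<in> N\<close> \<open>r \<in> carrier R\<close> by (simp add: N_def A_simps Q.m_assoc j_mult)
      then show ?thesis
        using that jA by (simp add: N_def)
    qed
    show "r = \<zero>\<^bsub>R\<^esub>" if r: "r \<in> carrier R" "j r \<in> N" for r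
    proof (rule dual_basis_zero[OF R.vectorspace_axioms d r(1)])
      fix i assume "i \<in> I"
      \<comment> \<open>Testing with the element 1 recovers the coordinates of \<open>r\<close>
        itself.\<close>
      then have "l i (j r \<otimes>\<^bsub>A\<^esub> j \<one>\<^bsub>R\<^esub>) = \<zero>\<^bsub>K\<^esub>" using r(2) by (simp add: N_def)
      then show "\<phi> i r = \<zero>\<^bsub>K\<^esub>" using \<open>i \<in> I\<close> r by (simp add: A_simps lj flip: j_mult)
    qed
  qed
  show ?thesis
  proof (rule separating_functionals_fin_dim[OF vectorspace_A, of ?\<Phi>])
    show "finite ?\<Phi>" using D(1) by auto
    show "?\<Phi> \<subseteq> dual_hom K A" using lr jA D(2) by auto
    fix x assume x: "x \<in> carrier A" and z: "\<And>f. f \<in> ?\<Phi> \<Longrightarrow> f x = \<zero>\<^bsub>K\<^esub>"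
    \<comment> \<open>Expanding \<open>r\<close> in the \<open>e k\<close> reduces the condition for
      all \<open>r\<close> to the finitely many functionals in \<open>?\<Phi>\<close>.\<close>
    have "l i (x \<otimes>\<^bsub>A\<^esub> j r) = \<zero>\<^bsub>K\<^esub>" if i: "i \<in> I" and r: "r \<in> carrier R" for i r
    proof -
      note h = module_hom_compose[OF j_linear module_hom_compose[OF left[OF x] l[OF i]]]
      have "l i (x \<otimes>\<^bsub>A\<^esub> j r) = l i (x \<otimes>\<^bsub>A\<^esub> j (\<Oplus>\<^bsub>R\<^esub>k\<in>I. \<phi> k r \<odot>\<^bsub>R\<^esub> e k))"
        using D(5)[OF r] by simp
      also have "\<dots> = (\<Oplus>\<^bsub>scalar_module K\<^esub>k\<in>I. l i (x \<otimes>\<^bsub>A\<^esub> j (\<phi> k r \<odot>\<^bsub>R\<^esub> e k)))"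
        using D(2,4) r by (intro module_hom_finsum[OF R.vectorspace_axioms S h D(1)]) auto
      also have "\<dots> = (\<Oplus>\<^bsub>scalar_module K\<^esub>k\<in>I. \<zero>\<^bsub>scalar_module K\<^esub>)"
      proof -
        interpret S: vectorspace K "scalar_module K" by (rule S)
        have "l i (x \<otimes>\<^bsub>A\<^esub> j (e k)) = \<zero>\<^bsub>K\<^esub>" if "k \<in> I" for k
          using that i by (intro z[of "\<lambda>x. l i (x \<otimes>\<^bsub>A\<^esub> j (e k))"] image_eqI[of _ _ "(i, k)"]) auto
        then show ?thesis
          using D(2,4) r by (intro S.finsum_cong') (auto simp: module_hom_smult[OF h])
      qed
      also have "\<dots> = \<zero>\<^bsub>K\<^esub>"
      proof -
        interpret S: vectorspace K "scalar_module K" by (rule S)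
        show ?thesis using S.finsum_zero by simp
      qed
      finally show ?thesis .
    qed
    then have "x \<in> N" using x by (simp add: N_def)
    then show "x = \<zero>\<^bsub>A\<^esub>" using \<open>N = {\<zero>\<^bsub>A\<^esub>}\<close> by blast
  qed
qed

end

section \<open>The dual of an essential overring\<close>

text \<open>Abstracts from the quotient ring and its hull: what is kept is a finite dimensional
  algebra that contains the dual algebra of \<open>C\<close> as an essential right submodule.
  Closure under convolution is supplied by \<open>j_mult\<close>.\<close>

locale dual_essential_extension = finite_dim_algebra K A I e \<phi> + C: coalgebra K C
  for K :: "('k, 'm) ring_scheme" and A :: "('k, 'a, 'n) module_scheme" (structure)
    and I :: "'i set" and e \<phi> and C :: "('k, 'c, 'p) coalgebra_scheme" +
  fixes J :: "'l set" and b \<chi> and j :: "('c \<Rightarrow> 'k) \<Rightarrow> 'a"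
  assumes dual_basis_C: "dual_basis K C J b \<chi>"
    and j_linear: "j \<in> module_hom K (dual_algebra K C) A"
    and j_inj: "inj_on j (carrier (dual_algebra K C))"
    and j_mult: "\<lbrakk>r \<in> carrier (dual_algebra K C); s \<in> carrier (dual_algebra K C)\<rbrakk> \<Longrightarrow>
      r \<otimes>\<^bsub>dual_algebra K C\<^esub> s \<in> carrier (dual_algebra K C) \<and>
      j (r \<otimes>\<^bsub>dual_algebra K C\<^esub> s) = j r \<otimes> j s"
    and j_one: "j \<one>\<^bsub>dual_algebra K C\<^esub> = \<one>"
    and j_essential: "\<lbrakk>submodule K N A; \<And>x r. \<lbrakk>x \<in> N; r \<in> carrier (dual_algebra K C)\<rbrakk> \<Longrightarrow> x \<otimes> j r \<in> N;
      \<And>r. \<lbrakk>r \<in> carrier (dual_algebra K C); j r \<in> N\<rbrakk> \<Longrightarrow> r = \<zero>\<^bsub>dual_algebra K C\<^esub>\<rbrakk> \<Longrightarrow> N = {\<zero>}"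
begin

section \<open>The projection onto C\<close>

abbreviation "R \<equiv> dual_algebra K C"

lemmas vectorspace_C = C.vectorspace_axioms
lemmas vectorspace_R = vectorspace_dual_algebra[OF vectorspace_C]
lemmas scalar = vectorspace_scalar[OF vectorspace_C]

lemma R_hom: "r \<in> carrier R \<Longrightarrow> r \<in> dual_hom K C"
  by (simp add: dual_algebra_simps dual_space_simps)

lemma j_closed [simp, intro]: "r \<in> carrier R \<Longrightarrow> j r \<in> carrier A"
  by (rule module_hom_mem[OF j_linear])

text \<open>The coordinates on \<open>C\<close> made extensional, as members of the dual algebra
  must be.\<close>

definition \<chi>' where "\<chi>' i = restrict (\<chi> i) (carrier C)"

lemma \<chi>'_closed: "i \<in> J \<Longrightarrow> \<chi>' i \<in> carrier R"
  unfolding \<chi>'_def dual_algebra_simps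
  by (rule restrict_dual_space[OF vectorspace_C dual_basisD(3)[OF dual_basis_C]])

lemma dual_basis_\<chi>': "dual_basis K C J b \<chi>'"
  using dual_basis_C R_hom[OF \<chi>'_closed] by (simp add: dual_basis_def \<chi>'_def)

lemma C_eqI:
  assumes "c \<in> carrier C" "c' \<in> carrier C" "\<And>r. r \<in> carrier R \<Longrightarrow> r c = r c'"
  shows "c = c'"
  by (rule dual_basis_eqI[OF vectorspace_C dual_basis_\<chi>' assms(1,2)]) (rule assms(3)[OF \<chi>'_closed])

text \<open>In coordinates, the transpose of \<open>j\<close> followed by the inverse of the
  canonical isomorphism from \<open>C\<close> to its double dual; \<open>\<pi>_eval\<close> is the
  description free of coordinates.\<close>

definition \<pi> where "\<pi> f = (\<Oplus>\<^bsub>C\<^esub>i\<in>J. f (j (\<chi>' i)) \<odot>\<^bsub>C\<^esub> b i)"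

lemma \<pi>_hom: "\<pi> \<in> module_hom K D C"
  unfolding \<pi>_def[abs_def]
  using dual_basisD[OF dual_basis_C]
  by (intro module_hom_ext_finsum vectorspace_D vectorspace_C module_hom_smult_left
      dual_coalgebra_eval_hom j_closed \<chi>'_closed)

lemma \<pi>_closed [simp, intro]: "f \<in> carrier D \<Longrightarrow> \<pi> f \<in> carrier C"
  by (rule module_hom_mem[OF \<pi>_hom])

text \<open>Rests on the expansion of \<open>r\<close> in the dual algebra, r = sum of r (b i)
  \<chi>' i, to which \<open>f\<close> after \<open>j\<close> is applied termwise.\<close>

lemma \<pi>_eval:
  assumes f: "f \<in> carrier D" and r: "r \<in> carrier R"
  shows "r (\<pi> f) = f (j r)"
proof -
  note d = dual_basisD[OF dual_basis_C]
  interpret S: vectorspace K "scalar_module K" by (rule scalar)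
  interpret VR: vectorspace K R by (rule vectorspace_R)
  have rb: "r (b i) \<in> carrier K" if "i \<in> J" for i
    using module_hom_mem[OF R_hom[OF r] d(2)[OF that]] by simp
  have fj: "f (j (\<chi>' i)) \<in> carrier K" if "i \<in> J" for i
    using that by (intro D_value[OF f] j_closed \<chi>'_closed)
  have "r (\<pi> f) = (\<Oplus>\<^bsub>scalar_module K\<^esub>i\<in>J. r (f (j (\<chi>' i)) \<odot>\<^bsub>C\<^esub> b i))"
    unfolding \<pi>_def using d(2) fj
    by (intro module_hom_finsum[OF vectorspace_C scalar R_hom[OF r] d(1)]) auto
  also have "\<dots> = (\<Oplus>\<^bsub>scalar_module K\<^esub>i\<in>J. f (j (r (b i) \<odot>\<^bsub>R\<^esub> \<chi>' i)))"
    using d(2) fj rb \<chi>'_closed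
    by (intro S.finsum_cong') (auto simp: module_hom_smult[OF R_hom[OF r]] module_hom_smult[OF j_linear]
        module_hom_smult[OF D_hom[OF f]] R.m_comm)
  also have "\<dots> = f (j (\<Oplus>\<^bsub>R\<^esub>i\<in>J. r (b i) \<odot>\<^bsub>R\<^esub> \<chi>' i))"
    using rb \<chi>'_closed
    by (intro module_hom_finsum[OF vectorspace_R scalar module_hom_compose[OF j_linear D_hom[OF f]] d(1), symmetric]) auto
  also have "(\<Oplus>\<^bsub>R\<^esub>i\<in>J. r (b i) \<odot>\<^bsub>R\<^esub> \<chi>' i) = r"
    using dual_basisD(5)[OF dual_basis_dual_algebra[OF vectorspace_C dual_basis_C] r] by (simp add: \<chi>'_def)
  finally show ?thesis .
qed

text \<open>A preimage of \<open>c\<close> is evaluation at \<open>c\<close>, a functional on the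
  dual algebra, extended to \<open>A\<close> along the injection \<open>j\<close>.\<close>

lemma \<pi>_surj: "\<pi> ` carrier D = carrier C"
proof
  show "carrier C \<subseteq> \<pi> ` carrier D"
  proof
    fix c assume c: "c \<in> carrier C"
    obtain F where F: "F \<in> dual_hom K A" "\<And>r. r \<in> carrier R \<Longrightarrow> F (j r) = r c"
      using functional_extension[OF vectorspace_R vectorspace_A j_linear j_inj dual_algebra_eval_hom[OF c]] by blast
    have FD: "restrict F (carrier A) \<in> carrier D"
      using restrict_dual_space[OF vectorspace_A F(1)] by (simp add: dual_coalgebra_simps)
    have "\<pi> (restrict F (carrier A)) = c"
      using FD c by (intro C_eqI) (auto simp: \<pi>_eval F(2))
    then show "c \<in> \<pi> ` carrier D" using FD by blast
  qed
qed auto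

lemma comult_C_eval:
  "\<lbrakk>r \<in> carrier R; s \<in> carrier R; c \<in> carrier C\<rbrakk> \<Longrightarrow>
    tensor_eval K C C r s (comult C c) = (r \<otimes>\<^bsub>R\<^esub> s) c"
  by (simp add: dual_algebra_simps)

lemma one_R_closed: "\<one>\<^bsub>R\<^esub> \<in> carrier R"
  using restrict_dual_space[OF vectorspace_C C.counit_hom] by (simp add: dual_algebra_simps)

text \<open>The transpose of a unital multiplicative map: evaluation on pairs r, s turns
  compatibility with the comultiplications into j (r s) = j r j s, and compatibility with the
  counits is \<open>j_one\<close>.\<close>

lemma \<pi>_coalgebra_hom: "\<pi> \<in> coalgebra_hom K D C"
  unfolding coalgebra_hom_def
proof (intro CollectI conjI ballI \<pi>_hom)
  fix d assume d: "d \<in> carrier D"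
  show "counit C (\<pi> d) = counit D d"
    using \<pi>_eval[OF d one_R_closed] d by (simp add: j_one dual_coalgebra_simps(5)) (simp add: dual_algebra_simps)
  note map = tensor_map_hom[OF vectorspace_D vectorspace_D vectorspace_C vectorspace_C \<pi>_hom \<pi>_hom]
  show "comult C (\<pi> d) = tensor_map K D D C C \<pi> \<pi> (comult D d)"
  proof (rule tensor_eval_eqI2[OF vectorspace_C vectorspace_C dual_basis_\<chi>' dual_basis_\<chi>'])
    show "comult C (\<pi> d) \<in> carrier (tensor K C C)"
      using d by (intro module_hom_mem[OF C.comult_hom]) auto
    show "tensor_map K D D C C \<pi> \<pi> (comult D d) \<in> carrier (tensor K C C)"
      by (rule module_hom_mem[OF map comult_D(1)[OF d]])
    fix i k assume "i \<in> J" "k \<in> J"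
    define r s where "r = \<chi>' i" and "s = \<chi>' k"
    have r: "r \<in> carrier R" and s: "s \<in> carrier R"
      using \<open>i \<in> J\<close> \<open>k \<in> J\<close> by (auto simp: r_def s_def \<chi>'_closed)
    have "tensor_eval K C C r s (comult C (\<pi> d)) = d (j r \<otimes> j s)"
      using d r s j_mult[OF r s] by (simp add: comult_C_eval \<pi>_eval)
    also have "\<dots> = tensor_eval K D D (\<lambda>g. g (j r)) (\<lambda>h. h (j s)) (comult D d)"
      using d r s by (simp add: comult_D)
    also have "\<dots> = tensor_eval K D D (\<lambda>g. r (\<pi> g)) (\<lambda>h. s (\<pi> h)) (comult D d)"
      using r s by (intro fun_cong[OF tensor_lift_cong]) (simp add: \<pi>_eval)
    also have "\<dots> = tensor_eval K C C r s (tensor_map K D D C C \<pi> \<pi> (comult D d))"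
      by (rule tensor_lift_tensor_map[OF vectorspace_D vectorspace_D vectorspace_C vectorspace_C \<pi>_hom \<pi>_hom
            scalar bilinear_mult[OF vectorspace_C vectorspace_C R_hom[OF r] R_hom[OF s]] comult_D(1)[OF d], symmetric])
    finally show "tensor_eval K C C (\<chi>' i) (\<chi>' k) (comult C (\<pi> d)) =
        tensor_eval K C C (\<chi>' i) (\<chi>' k) (tensor_map K D D C C \<pi> \<pi> (comult D d))"
      by (simp only: r_def s_def)
  qed
qed

section \<open>The coaction on D\<close>

definition \<rho> where "\<rho> d = tensor_map K D D D C (\<lambda>x. x) \<pi> (comult D d)"

lemma \<rho>_hom: "\<rho> \<in> module_hom K D (tensor K D C)"
  unfolding \<rho>_def[abs_def]
  by (rule module_hom_compose[OF comult_D_hom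
        tensor_map_hom[OF vectorspace_D vectorspace_D vectorspace_D vectorspace_C module_hom_id \<pi>_hom]])

text \<open>Exhibits the coaction as dual to the right action of the dual algebra on
  \<open>A\<close> through \<open>j\<close>.\<close>

lemma \<rho>_eval:
  assumes x: "x \<in> carrier A" and r: "r \<in> carrier R" and d: "d \<in> carrier D"
  shows "tensor_eval K D C (\<lambda>f. f x) r (\<rho> d) = d (x \<otimes> j r)"
proof -
  have "tensor_eval K D C (\<lambda>f. f x) r (\<rho> d) = tensor_eval K D D (\<lambda>f. f x) (\<lambda>h. r (\<pi> h)) (comult D d)"
    unfolding \<rho>_def
    by (rule tensor_lift_tensor_map[OF vectorspace_D vectorspace_D vectorspace_D vectorspace_C module_hom_id \<pi>_hom
            scalar bilinear_mult[OF vectorspace_D vectorspace_C dual_coalgebra_eval_hom[OF x] R_hom[OF r]] comult_D(1)[OF d]])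
  also have "\<dots> = tensor_eval K D D (\<lambda>f. f x) (\<lambda>h. h (j r)) (comult D d)"
    using r by (intro fun_cong[OF tensor_lift_cong]) (simp add: \<pi>_eval)
  also have "\<dots> = d (x \<otimes> j r)" using x r d by (simp add: comult_D)
  finally show ?thesis .
qed

text \<open>By \<open>\<rho>_eval\<close>, the comodule axioms are the axioms of \<open>A\<close> as
  a right module: (x j r) j s = x j (r s) and x j 1 = x.\<close>

lemma right_comodule_D: "right_comodule K C D \<rho>"
proof (intro right_comodule.intro vectorspace_D C.coalgebra_axioms right_comodule_axioms.intro)
  note e = dual_basisD(2)[OF dual_basis]
  show "\<rho> \<in> module_hom K D (tensor K D C)" by (rule \<rho>_hom)
  fix d assume d: "d \<in> carrier D"
  show "tensor_assoc K D C C (tensor_map K D C (tensor K D C) C \<rho> (\<lambda>c. c) (\<rho> d)) =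
      tensor_map K D C D (tensor K C C) (\<lambda>x. x) (comult C) (\<rho> d)"
    by (rule coassoc_by_functionals[where X = "carrier A" and Y = "carrier R" and p = e and q = \<chi>'
          and \<beta> = "\<lambda>r. r" and act = "\<lambda>x r. x \<otimes> j r" and mul = "(\<otimes>\<^bsub>R\<^esub>)",
          OF vectorspace_D vectorspace_C \<rho>_hom C.comult_hom dual_coalgebra_eval_hom R_hom
            dual_basis_D _ dual_basis_\<chi>'])
      (use e \<chi>'_closed d j_mult in \<open>auto simp: \<rho>_eval comult_C_eval m_assoc\<close>)
  show "tensor_lift K D C D (\<lambda>x c. counit C c \<odot>\<^bsub>D\<^esub> x) (\<rho> d) = d"
  proof (rule dual_basis_eqI[OF vectorspace_D dual_basis_D])
    note \<rho>d = module_hom_mem[OF \<rho>_hom d]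
    show "tensor_lift K D C D (\<lambda>x c. counit C c \<odot>\<^bsub>D\<^esub> x) (\<rho> d) \<in> carrier D"
      by (intro tensor_lift_closed bilinear_smult_right vectorspace_D vectorspace_C C.counit_hom \<rho>d)
    fix i assume i: "i \<in> I"
    have "(\<lambda>g. g (e i)) (tensor_lift K D C D (\<lambda>x c. counit C c \<odot>\<^bsub>D\<^esub> x) (\<rho> d)) =
        tensor_eval K D C (\<lambda>g. g (e i)) (counit C) (\<rho> d)"
      by (intro tensor_slice_right vectorspace_D vectorspace_C C.counit_hom dual_coalgebra_eval_hom e i \<rho>d)
    also have "\<dots> = tensor_eval K D C (\<lambda>g. g (e i)) \<one>\<^bsub>R\<^esub> (\<rho> d)"
      by (rule fun_cong[OF tensor_lift_cong]) (simp add: dual_algebra_simps)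
    also have "\<dots> = d (e i)"
      using e[OF i] d by (simp add: \<rho>_eval one_R_closed j_one)
    finally show "tensor_lift K D C D (\<lambda>x c. counit C c \<odot>\<^bsub>D\<^esub> x) (\<rho> d) (e i) = d (e i)" .
  qed (rule d)
qed

section \<open>Subcomodules as stable subspaces\<close>

lemma bilinear_slice: "r \<in> carrier R \<Longrightarrow> bilinear_map K D C D (\<lambda>v w. r w \<odot>\<^bsub>D\<^esub> v)"
  by (intro bilinear_smult_right vectorspace_D vectorspace_C R_hom)

text \<open>The left action of \<open>C\<^sup>*\<close> on the right comodule \<open>D\<close>.\<close>

abbreviation slice where "slice r d \<equiv> tensor_lift K D C D (\<lambda>v w. r w \<odot>\<^bsub>D\<^esub> v) (\<rho> d)"

lemma slice_closed: "r \<in> carrier R \<Longrightarrow> d \<in> carrier D \<Longrightarrow> slice r d \<in> carrier D"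
  by (intro tensor_lift_closed vectorspace_D vectorspace_C bilinear_slice module_hom_mem[OF \<rho>_hom])

lemma slice_eval:
  assumes "x \<in> carrier A" "r \<in> carrier R" "d \<in> carrier D"
  shows "slice r d x = d (x \<otimes> j r)"
proof -
  have "(\<lambda>f. f x) (slice r d) = tensor_eval K D C (\<lambda>f. f x) r (\<rho> d)"
    by (intro tensor_slice_right vectorspace_D vectorspace_C dual_coalgebra_eval_hom R_hom
        module_hom_mem[OF \<rho>_hom] assms)
  then show ?thesis using \<rho>_eval[OF assms] by simp
qed

text \<open>The slice by \<open>r\<close> is id \<otimes> r after \<open>\<rho>\<close>, and id
  \<otimes> r sends a generator y \<otimes> c with \<open>y\<close> in \<open>L\<close> to a
  multiple of \<open>y\<close>. So the preimage of \<open>L\<close> contains the whole span.\<close>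

lemma subcomodule_slice:
  assumes L: "subcomodule K C D \<rho> L" and r: "r \<in> carrier R" and d: "d \<in> L"
  shows "slice r d \<in> L"
proof -
  interpret T: vectorspace K "tensor K D C" by (rule vectorspace_tensor[OF vectorspace_D vectorspace_C])
  have sub: "submodule K L D"
    and span: "\<rho> d \<in> T.span {pure_tensor K D C y c | y c. y \<in> L \<and> c \<in> carrier C}"
    using L d by (auto simp: subcomodule_def)
  interpret L: submodule K L D by (rule sub)
  let ?h = "tensor_lift K D C D (\<lambda>v w. r w \<odot>\<^bsub>D\<^esub> v)"
  note h = tensor_lift_hom[OF vectorspace_D vectorspace_C vectorspace_D bilinear_slice[OF r]]
  have LD: "y \<in> carrier D" if "y \<in> L" for y using L.subset that by blast
  have "submodule K {t \<in> carrier (tensor K D C). ?h t \<in> L} (tensor K D C)"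
    unfolding submodule_def
    using module_hom_zero[OF T.vectorspace_axioms vectorspace_D h]
    by (auto simp: module_hom_add[OF h] module_hom_smult[OF h] T.module_axioms)
  moreover have "?h (pure_tensor K D C y c) \<in> L" if "y \<in> L" "c \<in> carrier C" for y c
    using that LD module_hom_mem[OF R_hom[OF r] that(2)]
    by (simp add: tensor_lift_pure[OF vectorspace_D vectorspace_C vectorspace_D bilinear_slice[OF r]])
  then have "{pure_tensor K D C y c | y c. y \<in> L \<and> c \<in> carrier C} \<subseteq> {t \<in> carrier (tensor K D C). ?h t \<in> L}"
    using LD pure_tensor_closed[OF vectorspace_D vectorspace_C] by blast
  ultimately have "\<rho> d \<in> {t \<in> carrier (tensor K D C). ?h t \<in> L}"
    using T.span_is_subset span by blast
  then show ?thesis by simp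
qed

text \<open>Expanding \<open>\<rho> d\<close> along the dual basis of \<open>C\<close> gives left
  factors that are slices of \<open>d\<close>.\<close>

lemma subcomoduleI:
  assumes L: "submodule K L D" and slice: "\<And>r d. \<lbrakk>r \<in> carrier R; d \<in> L\<rbrakk> \<Longrightarrow> slice r d \<in> L"
  shows "subcomodule K C D \<rho> L"
  unfolding subcomodule_def
proof (intro conjI ballI right_comodule_D L)
  interpret L: submodule K L D by (rule L)
  interpret T: vectorspace K "tensor K D C" by (rule vectorspace_tensor[OF vectorspace_D vectorspace_C])
  let ?P = "{pure_tensor K D C y c | y c. y \<in> L \<and> c \<in> carrier C}"
  have P: "?P \<subseteq> carrier (tensor K D C)"
    using L.subset pure_tensor_closed[OF vectorspace_D vectorspace_C] by blast
  fix d assume d: "d \<in> L"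
  then have dD: "d \<in> carrier D" using L.subset by blast
  have "\<rho> d = (\<Oplus>\<^bsub>tensor K D C\<^esub>i\<in>J. pure_tensor K D C (slice (\<chi>' i) d) (b i))"
    by (rule tensor_expand_right[OF vectorspace_D vectorspace_C dual_basis_\<chi>' module_hom_mem[OF \<rho>_hom dD]])
  also have "\<dots> \<in> T.span ?P"
  proof (rule submodule_finsum[OF T.span_is_submodule[OF P] dual_basisD(1)[OF dual_basis_C]])
    fix i assume i: "i \<in> J"
    have "pure_tensor K D C (slice (\<chi>' i) d) (b i) \<in> ?P"
      using slice[OF \<chi>'_closed[OF i] d] dual_basisD(2)[OF dual_basis_C i] by blast
    then show "pure_tensor K D C (slice (\<chi>' i) d) (b i) \<in> T.span ?P"
      using T.in_own_span[OF P] by blast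
  qed
  finally show "\<rho> d \<in> T.span ?P" .
qed

section \<open>The kernel of the projection and its smallness\<close>

lemma kernel_eq: "a_kernel D C \<pi> = {d \<in> carrier D. \<forall>r\<in>carrier R. d (j r) = \<zero>\<^bsub>K\<^esub>}"
proof -
  have "\<pi> d = \<zero>\<^bsub>C\<^esub> \<longleftrightarrow> (\<forall>r\<in>carrier R. d (j r) = \<zero>\<^bsub>K\<^esub>)" if d: "d \<in> carrier D" for d
  proof
    have r0: "r \<zero>\<^bsub>C\<^esub> = \<zero>\<^bsub>K\<^esub>" if "r \<in> carrier R" for r
      using module_hom_zero[OF vectorspace_C scalar R_hom[OF that]] by simp
    show "\<forall>r\<in>carrier R. d (j r) = \<zero>\<^bsub>K\<^esub>" if "\<pi> d = \<zero>\<^bsub>C\<^esub>"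
      using that by (auto simp: r0 simp flip: \<pi>_eval[OF d])
    show "\<pi> d = \<zero>\<^bsub>C\<^esub>" if "\<forall>r\<in>carrier R. d (j r) = \<zero>\<^bsub>K\<^esub>"
      using that d by (intro C_eqI) (auto simp: r0 \<pi>_eval)
  qed
  then show ?thesis by (auto simp: a_kernel_def')
qed

text \<open>The image of \<open>j\<close> is closed under multiplication, so for \<open>d\<close>
  vanishing on it the slice by \<open>r\<close> takes the value d (j (s r)) = 0 at
  \<open>j s\<close>.\<close>

lemma subcomodule_kernel: "subcomodule K C D \<rho> (a_kernel D C \<pi>)"
proof (rule subcomoduleI)
  interpret \<pi>: mod_hom K D C \<pi> by (intro mod_homI D.module_axioms C.module_axioms \<pi>_hom)
  have "a_kernel D C \<pi> = \<pi>.ker" by (auto simp: a_kernel_def' \<pi>.ker_def)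
  then show "submodule K (a_kernel D C \<pi>) D" using \<pi>.ker_is_submodule by simp
  fix r d assume r: "r \<in> carrier R" and d: "d \<in> a_kernel D C \<pi>"
  have "slice r d (j s) = \<zero>\<^bsub>K\<^esub>" if s: "s \<in> carrier R" for s
  proof -
    have "d (j (s \<otimes>\<^bsub>R\<^esub> r)) = \<zero>\<^bsub>K\<^esub>"
      using d j_mult[OF s r] unfolding kernel_eq by blast
    then show ?thesis
      using d r s j_mult[OF s r] by (simp add: slice_eval kernel_eq)
  qed
  then show "slice r d \<in> a_kernel D C \<pi>"
    using slice_closed[OF r] d by (simp add: kernel_eq)
qed

text \<open>Reflexivity in finite dimension: the point representing \<open>F\<close> has the
  coefficients F (\<phi> i) at the \<open>e i\<close>.\<close>

lemma D_functional:
  assumes F: "F \<in> dual_hom K D"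
  obtains x where "x \<in> carrier A" "\<And>d. d \<in> carrier D \<Longrightarrow> F d = d x"
proof
  note db = dual_basisD[OF dual_basis]
  interpret S: vectorspace K "scalar_module K" by (rule scalar)
  let ?\<phi> = "\<lambda>i. restrict (\<phi> i) (carrier A)"
  let ?x = "\<Oplus>i\<in>I. F (?\<phi> i) \<odot> e i"
  have \<phi>D: "?\<phi> i \<in> carrier D" if "i \<in> I" for i by (rule dual_basisD(2)[OF dual_basis_D that])
  have F\<phi>: "F (?\<phi> i) \<in> carrier K" if "i \<in> I" for i using module_hom_mem[OF F \<phi>D[OF that]] by simp
  show "?x \<in> carrier A" using F\<phi> db(2) by (intro finsum_closed) auto
  fix d assume d: "d \<in> carrier D"
  have "d ?x = (\<Oplus>\<^bsub>scalar_module K\<^esub>i\<in>I. d (F (?\<phi> i) \<odot> e i))"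
    using F\<phi> db(2) by (intro module_hom_finsum[OF vectorspace_A scalar D_hom[OF d] db(1)]) auto
  also have "\<dots> = (\<Oplus>\<^bsub>scalar_module K\<^esub>i\<in>I. F (d (e i) \<odot>\<^bsub>D\<^esub> ?\<phi> i))"
    using F\<phi> db(2) \<phi>D D_value[OF d]
    by (intro S.finsum_cong') (auto simp: module_hom_smult[OF F] module_hom_smult[OF D_hom[OF d]] R.m_comm)
  also have "\<dots> = F (\<Oplus>\<^bsub>D\<^esub>i\<in>I. d (e i) \<odot>\<^bsub>D\<^esub> ?\<phi> i)"
    using D_value[OF d] db(2) \<phi>D
    by (intro module_hom_finsum[OF vectorspace_D scalar F db(1), symmetric]) auto
  also have "\<dots> = F d" using dual_basisD(5)[OF dual_basis_D d] by simp
  finally show "F d = d ?x" by simp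
qed

text \<open>
  If \<open>L\<close> is a subcomodule, its annihilator \<open>P\<close> in \<open>A\<close> is a right submodule over \<open>C\<^sup>*\<close>; if moreover
  \<open>L\<close> and the kernel span \<open>D\<close>, then \<open>P\<close> meets the essential submodule \<open>C\<^sup>*\<close> trivially.
\<close>

theorem small_kernel: "small_subcomodule K C D \<rho> (a_kernel D C \<pi>)"
  unfolding small_subcomodule_def
proof (intro conjI allI impI subcomodule_kernel notI)
  fix L assume "subcomodule K C D \<rho> L \<and> L \<noteq> carrier D" and sum: "a_kernel D C \<pi> <+>\<^bsub>D\<^esub> L = carrier D"
  then have L: "subcomodule K C D \<rho> L" and ne: "L \<noteq> carrier D" by auto
  have sub: "submodule K L D" using L by (simp add: subcomodule_def)
  interpret L: submodule K L D by (rule sub)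
  have LD: "d \<in> carrier D" if "d \<in> L" for d using that L.subset by blast
  define P where "P = {x \<in> carrier A. \<forall>d\<in>L. d x = \<zero>\<^bsub>K\<^esub>}"
  have "P = {\<zero>}"
  proof (rule j_essential)
    have zero: "d \<zero> = \<zero>\<^bsub>K\<^esub>" if "d \<in> L" for d
      using module_hom_zero[OF vectorspace_A scalar D_hom[OF LD[OF that]]] by simp
    show "submodule K P A"
      unfolding submodule_def
    proof (intro conjI allI impI module_axioms)
      show "P \<subseteq> carrier A" "\<zero> \<in> P" by (auto simp: P_def zero)
      have P: "x \<in> carrier A" "d \<in> L \<Longrightarrow> d x = \<zero>\<^bsub>K\<^esub>" if "x \<in> P" for x d
        using that unfolding P_def by blast+
      fix x assume x: "x \<in> P"
      show "x \<oplus> y \<in> P" if y: "y \<in> P" for y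
      proof -
        have "d (x \<oplus> y) = \<zero>\<^bsub>K\<^esub> \<oplus>\<^bsub>K\<^esub> \<zero>\<^bsub>K\<^esub>" if "d \<in> L" for d
          using module_hom_add[OF D_hom[OF LD[OF that]] P(1)[OF x] P(1)[OF y]]
          by (simp only: P(2)[OF x that] P(2)[OF y that] scalar_module_simps)
        then show ?thesis using P(1)[OF x] P(1)[OF y] by (simp add: P_def)
      qed
      show "a \<odot> x \<in> P" if a: "a \<in> carrier K" for a
      proof -
        have "d (a \<odot> x) = a \<otimes>\<^bsub>K\<^esub> \<zero>\<^bsub>K\<^esub>" if "d \<in> L" for d
          using module_hom_smult[OF D_hom[OF LD[OF that]] a P(1)[OF x]]
          by (simp only: P(2)[OF x that] scalar_module_simps)
        then show ?thesis using P(1)[OF x] a by (simp add: P_def)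
      qed
    qed
    show "x \<otimes> j r \<in> P" if xr: "x \<in> P" "r \<in> carrier R" for x r
    proof -
      have "d (x \<otimes> j r) = \<zero>\<^bsub>K\<^esub>" if d: "d \<in> L" for d
        using xr subcomodule_slice[OF L xr(2) d] by (simp add: P_def LD[OF d] flip: slice_eval)
      then show ?thesis using xr by (simp add: P_def)
    qed
    show "r = \<zero>\<^bsub>R\<^esub>" if r: "r \<in> carrier R" "j r \<in> P" for r
    proof -
      \<comment> \<open>By \<open>sum\<close>, each \<open>d\<close> splits into a part in the
        kernel, which vanishes on the image of \<open>j\<close>, and a part in \<open>L\<close>,
        which vanishes on \<open>P\<close>; the point \<open>j r\<close> lies in both.\<close>
      have z: "d (j r) = \<zero>\<^bsub>K\<^esub>" if d: "d \<in> carrier D" for d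
      proof -
        obtain n l where "n \<in> a_kernel D C \<pi>" "l \<in> L" and dnl: "d = n \<oplus>\<^bsub>D\<^esub> l"
          using d unfolding sum[symmetric] set_add_def' by blast
        then have "n (j r) = \<zero>\<^bsub>K\<^esub>" "l (j r) = \<zero>\<^bsub>K\<^esub>" using r by (auto simp: kernel_eq P_def)
        then show ?thesis using r by (simp add: dnl dual_coalgebra_simps dual_space_simps)
      qed
      have "j r = \<zero>"
        using r z[OF dual_basisD(2)[OF dual_basis_D]]
        by (intro dual_basis_zero[OF vectorspace_A dual_basis]) auto
      then have "j r = j \<zero>\<^bsub>R\<^esub>"
        using module_hom_zero[OF vectorspace_R vectorspace_A j_linear] by simp
      then show ?thesis
        using inj_onD[OF j_inj] r(1) vectorspace_R
        by (meson abelian_group_def abelian_monoid.zero_closed module_def vectorspace_def)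
    qed
  qed
  \<comment> \<open>Reflexivity turns P = 0 into L = D: a functional that vanishes on
    \<open>L\<close> but not at \<open>v\<close> is evaluation at a point of
    \<open>P\<close>.\<close>
  obtain v where v: "v \<in> carrier D" "v \<notin> L" using ne L.subset by blast
  obtain F where F: "F \<in> dual_hom K D" "F v = \<one>\<^bsub>K\<^esub>" "\<And>d. d \<in> L \<Longrightarrow> F d = \<zero>\<^bsub>K\<^esub>"
    using hyperplane_functional[OF vectorspace_D sub v] by blast
  obtain x where x: "x \<in> carrier A" "\<And>d. d \<in> carrier D \<Longrightarrow> F d = d x"
    using D_functional[OF F(1)] by blast
  have "x \<in> P" using x F(3) LD by (auto simp: P_def)
  then have "v x = \<zero>\<^bsub>K\<^esub>"
    using \<open>P = {\<zero>}\<close> module_hom_zero[OF vectorspace_A scalar D_hom[OF v(1)]] by simp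
  then show False using x(2)[OF v(1)] F(2) one_not_zero by simp
qed

end

theorem mainTheorem1:
  fixes K :: "('k, 'm) ring_scheme"
    and C :: "('k, 'c) coalgebra"
    and E :: "('c \<Rightarrow> 'k, 'e) module"
    and j :: "('c \<Rightarrow> 'k) \<Rightarrow> 'e"
    and Q :: "'e ring"
  assumes "field K"
    and "coalgebra K C"
    and "vectorspace.fin_dim K C"
    and "max_right_quotient_ring (dual_algebra K C) E j Q"
  shows "let A = overring_with_scalars (dual_algebra K C) j Q;
             D = dual_coalgebra K A
         in assoc_algebra K A \<and> vectorspace.fin_dim K A \<and>
            coalgebra K D \<and> vectorspace.fin_dim K D \<and>
            (\<exists>\<pi> \<in> coalgebra_hom K D C.
               \<pi> ` carrier D = carrier C \<and>
               small_subcomodule K C D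
                 (\<lambda>d. tensor_map K D D D C (\<lambda>x. x) \<pi> (comult D d))
                 (a_kernel D C \<pi>))"
proof -
  interpret C: coalgebra K C by fact
  let ?R = "dual_algebra K C"
  let ?A = "overring_with_scalars ?R j Q"
  let ?D = "dual_coalgebra K ?A"
  \<comment> \<open>The hypothesis on \<open>Q\<close> speaks of a right module over
    \<open>?R\<close>, and \<open>right_module\<close> includes that \<open>?R\<close> is a
    ring.\<close>
  have "ring ?R"
    using assms(4)
    by (auto simp: max_right_quotient_ring_def injective_hull_def injective_right_module_def right_module_def)
  then interpret Q: algebra_with_quotient_ring K ?R E j Q
    by (intro algebra_with_quotient_ring.intro algebra_with_quotient_ring_axioms.intro
        assoc_algebra_dual_algebra assms)
  obtain B \<chi> where C: "dual_basis K C B (\<lambda>x. x) \<chi>"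
    using fin_dim_dual_basis[OF C.vectorspace_axioms assms(3)] .
  have fin_A: "vectorspace.fin_dim K ?A"
    by (rule Q.fin_dim_A[OF dual_basis_dual_algebra[OF C.vectorspace_axioms C]])
  obtain B' \<phi> where A: "dual_basis K ?A B' (\<lambda>x. x) \<phi>"
    using fin_dim_dual_basis[OF Q.vectorspace_A fin_A] .
  \<comment> \<open>The coaction \<open>X.\<rho>\<close> of this locale unfolds to the one in the
    statement, with \<open>X.\<pi>\<close> as the required homomorphism.\<close>
  interpret X: dual_essential_extension K ?A B' "\<lambda>x. x" \<phi> C B "\<lambda>x. x" \<chi> j
  proof (intro dual_essential_extension.intro finite_dim_algebra.intro finite_dim_algebra_axioms.intro
      dual_essential_extension_axioms.intro)
    show "assoc_algebra K ?A" by (rule Q.assoc_algebra_A)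
    show "dual_basis K ?A B' (\<lambda>x. x) \<phi>" by (rule A)
    show "coalgebra K C" by fact
    show "dual_basis K C B (\<lambda>x. x) \<chi>" by (rule C)
    show "j \<in> module_hom K ?R ?A" by (rule Q.j_linear)
    show "inj_on j (carrier ?R)" by (rule Q.j_inj)
    show "r \<otimes>\<^bsub>?R\<^esub> s \<in> carrier ?R \<and> j (r \<otimes>\<^bsub>?R\<^esub> s) = j r \<otimes>\<^bsub>?A\<^esub> j s"
      if "r \<in> carrier ?R" "s \<in> carrier ?R" for r s
      using that by (simp add: Q.j_mult Q.A_simps Q.R.m_closed)
    show "j \<one>\<^bsub>?R\<^esub> = \<one>\<^bsub>?A\<^esub>" by (simp add: Q.A_simps Q.Q_one)
  qed (rule Q.A_essential)
  have "vectorspace.fin_dim K ?D"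
    by (rule dual_basis_fin_dim[OF X.vectorspace_D X.dual_basis_D])
  moreover have "small_subcomodule K C ?D (\<lambda>d. tensor_map K ?D ?D ?D C (\<lambda>x. x) X.\<pi> (comult ?D d)) (a_kernel ?D C X.\<pi>)"
    using X.small_kernel unfolding X.\<rho>_def[abs_def] .
  ultimately show ?thesis
    unfolding Let_def
    using Q.assoc_algebra_A fin_A X.coalgebra_D X.\<pi>_coalgebra_hom X.\<pi>_surj by blast
qed

end
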